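(* Let $\mathcal{C}$ be a modular tensor category, and let $G$ be a subgroup of $\mathcal{G}(\mathcal{C})$ such that $\mathcal{G}(\mathcal{C}_{\mathrm{ad}})\leq G\leq \mathcal{G}(\mathcal{C})$ and such that $|G|$ and $|\mathcal{G}(\mathcal{C})|/|G|$ are relatively prime. Then $\mathcal{C}$ contains a pointed modular subcategory of Frobenius-Perron dimension $[\mathcal{G}(\mathcal{C}):G]$.
   Context: All categories are over an algebraically closed field $\mathbf{k}$ of characteristic zero. A modular tensor category is a (semisimple) braided fusion category with a spherical structure whose $S$-matrix is invertible. $\mathcal{G}(\mathcal{D})$ is the group of isomorphism classes of invertible objects of a fusion category $\mathcal{D}$; $\mathcal{C}_{\mathrm{ad}}$ is the adjoint subcategory, the fusion subcategory generated by $X\otimes X^*$ for all simple $X\in\mathcal{C}$. A fusion category is pointed if all its simple objects are invertible. For a fusion subcategory $\mathcal{K}\subseteq\mathcal{C}$, its Müger centralizer $\mathcal{K}'$ is the fusion subcategory of all $Y\in\mathcal{C}$ with $c_{Y,X}c_{X,Y}=\mathrm{id}_{X\otimes Y}$ for all $X\in\mathcal{K}$; $\mathcal{K}$ is a modular subcategory if $\mathcal{K}\cap\mathcal{K}'=\mathrm{Vec}$. The Frobenius-Perron dimension of a fusion category is the sum of the squares of the Frobenius-Perron dimensions of its simple objects. *)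

theory Defs
  imports "HOL-Algebra.Coset" "HOL-Computational_Algebra.Polynomial"
begin

section \<open>Linear and abelian categories\<close>

text \<open>
  A small \<open>k\<close>-linear category: the objects are the elements of the type \<open>'o\<close>, and the
  morphism spaces \<open>Hom X Y\<close> are subspaces of one ambient \<open>k\<close>-vector space \<open>'m\<close>. This is no
  restriction, since one may take for \<open>'m\<close> the direct sum of all morphism spaces, on which
  composition extends to a bilinear map (with value zero on non-composable pairs). Every axiom
  below only concerns composable morphisms. Composition is written in applicative order:
  \<open>g \<cdot> f\<close> is \<open>f\<close> followed by \<open>g\<close>.
\<close>

record ('o, 'm, 'k) linear_cat =
  Hom :: "'o \<Rightarrow> 'o \<Rightarrow> 'm set"
  ident :: "'o \<Rightarrow> 'm"
  cmp :: "'m \<Rightarrow> 'm \<Rightarrow> 'm"  (infixl "\<cdot>\<index>" 70)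
  scl :: "'k \<Rightarrow> 'm \<Rightarrow> 'm"

locale linear_category = vector_space "scl C"
  for C :: "('o, 'm::ab_group_add, 'k::field, 'z) linear_cat_scheme" (structure) +
  assumes subspace_Hom: "subspace (Hom C X Y)"
    and ident_in_Hom: "ident C X \<in> Hom C X X"
    and cmp_in_Hom: "f \<in> Hom C X Y \<Longrightarrow> g \<in> Hom C Y Z \<Longrightarrow> g \<cdot> f \<in> Hom C X Z"
    and cmp_ident: "f \<in> Hom C X Y \<Longrightarrow> f \<cdot> ident C X = f"
    and ident_cmp: "f \<in> Hom C X Y \<Longrightarrow> ident C Y \<cdot> f = f"
    and cmp_assoc: "f \<in> Hom C W X \<Longrightarrow> g \<in> Hom C X Y \<Longrightarrow> h \<in> Hom C Y Z \<Longrightarrow>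
          h \<cdot> g \<cdot> f = h \<cdot> (g \<cdot> f)"
    and cmp_add_left: "f \<in> Hom C X Y \<Longrightarrow> g \<in> Hom C Y Z \<Longrightarrow> g' \<in> Hom C Y Z \<Longrightarrow>
          (g + g') \<cdot> f = g \<cdot> f + g' \<cdot> f"
    and cmp_add_right: "f \<in> Hom C X Y \<Longrightarrow> f' \<in> Hom C X Y \<Longrightarrow> g \<in> Hom C Y Z \<Longrightarrow>
          g \<cdot> (f + f') = g \<cdot> f + g \<cdot> f'"
    and cmp_scl_left: "f \<in> Hom C X Y \<Longrightarrow> g \<in> Hom C Y Z \<Longrightarrow> scl C a g \<cdot> f = scl C a (g \<cdot> f)"
    and cmp_scl_right: "f \<in> Hom C X Y \<Longrightarrow> g \<in> Hom C Y Z \<Longrightarrow> g \<cdot> scl C a f = scl C a (g \<cdot> f)"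
begin

definition monic :: "'o \<Rightarrow> 'o \<Rightarrow> 'm \<Rightarrow> bool" where
  "monic X Y f \<longleftrightarrow> f \<in> Hom C X Y \<and>
     (\<forall>W. \<forall>g\<in>Hom C W X. \<forall>h\<in>Hom C W X. f \<cdot> g = f \<cdot> h \<longrightarrow> g = h)"

definition epic :: "'o \<Rightarrow> 'o \<Rightarrow> 'm \<Rightarrow> bool" where
  "epic X Y f \<longleftrightarrow> f \<in> Hom C X Y \<and>
     (\<forall>Z. \<forall>g\<in>Hom C Y Z. \<forall>h\<in>Hom C Y Z. g \<cdot> f = h \<cdot> f \<longrightarrow> g = h)"

definition is_inverse :: "'o \<Rightarrow> 'o \<Rightarrow> 'm \<Rightarrow> 'm \<Rightarrow> bool" where
  "is_inverse X Y f g \<longleftrightarrow> f \<in> Hom C X Y \<and> g \<in> Hom C Y X \<and>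
     g \<cdot> f = ident C X \<and> f \<cdot> g = ident C Y"

definition iso_arr :: "'o \<Rightarrow> 'o \<Rightarrow> 'm \<Rightarrow> bool" where
  "iso_arr X Y f \<longleftrightarrow> (\<exists>g. is_inverse X Y f g)"

definition inverse_arr :: "'o \<Rightarrow> 'o \<Rightarrow> 'm \<Rightarrow> 'm" where
  "inverse_arr X Y f = (THE g. is_inverse X Y f g)"

definition isomorphic :: "'o \<Rightarrow> 'o \<Rightarrow> bool" where
  "isomorphic X Y \<longleftrightarrow> (\<exists>f. iso_arr X Y f)"

definition iso_class :: "'o \<Rightarrow> 'o set" where
  "iso_class X = {Y. isomorphic X Y}"

definition is_kernel :: "'o \<Rightarrow> 'o \<Rightarrow> 'm \<Rightarrow> 'o \<Rightarrow> 'm \<Rightarrow> bool" where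
  "is_kernel X Y f K k \<longleftrightarrow> k \<in> Hom C K X \<and> f \<cdot> k = 0 \<and>
     (\<forall>W. \<forall>g\<in>Hom C W X. f \<cdot> g = 0 \<longrightarrow> (\<exists>!h. h \<in> Hom C W K \<and> k \<cdot> h = g))"

definition is_cokernel :: "'o \<Rightarrow> 'o \<Rightarrow> 'm \<Rightarrow> 'o \<Rightarrow> 'm \<Rightarrow> bool" where
  "is_cokernel X Y f Q q \<longleftrightarrow> q \<in> Hom C Y Q \<and> q \<cdot> f = 0 \<and>
     (\<forall>Z. \<forall>g\<in>Hom C Y Z. g \<cdot> f = 0 \<longrightarrow> (\<exists>!h. h \<in> Hom C Q Z \<and> h \<cdot> q = g))"

text \<open>
  \<open>X\<close> is a direct sum (biproduct) of the finite list of objects \<open>Ys\<close>. For the empty list this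
  says \<open>ident C X = 0\<close>, i.e. \<open>X\<close> is a zero object; for a list of length one it says that \<open>X\<close> is
  isomorphic to the entry.
\<close>

definition direct_sum :: "'o \<Rightarrow> 'o list \<Rightarrow> bool" where
  "direct_sum X Ys \<longleftrightarrow> (\<exists>i p.
     (\<forall>j<length Ys. i j \<in> Hom C (Ys ! j) X \<and> p j \<in> Hom C X (Ys ! j)) \<and>
     (\<forall>j<length Ys. \<forall>l<length Ys. p j \<cdot> i l = (if j = l then ident C (Ys ! j) else 0)) \<and>
     (\<Sum>j<length Ys. i j \<cdot> p j) = ident C X)"

text \<open>A non-zero object whose only subobjects are zero and itself.\<close>

definition simple :: "'o \<Rightarrow> bool" where
  "simple X \<longleftrightarrow> ident C X \<noteq> 0 \<and> (\<forall>Y f. monic Y X f \<longrightarrow> f = 0 \<or> iso_arr Y X f)"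

end

locale abelian_linear_category = linear_category C
  for C :: "('o, 'm::ab_group_add, 'k::field, 'z) linear_cat_scheme" (structure) +
  assumes direct_sums: "\<exists>X. direct_sum X Ys"
    and kernels: "f \<in> Hom C X Y \<Longrightarrow> \<exists>K k. is_kernel X Y f K k"
    and cokernels: "f \<in> Hom C X Y \<Longrightarrow> \<exists>Q q. is_cokernel X Y f Q q"
    and monic_normal: "monic X Y f \<Longrightarrow> \<exists>Z. \<exists>g\<in>Hom C Y Z. is_kernel Y Z g X f"
    and epic_conormal: "epic X Y f \<Longrightarrow> \<exists>W. \<exists>g\<in>Hom C W X. is_cokernel W X g Y f"

locale finite_semisimple_category = abelian_linear_category C
  for C :: "('o, 'm::ab_group_add, 'k::field, 'z) linear_cat_scheme" (structure) +
  assumes finite_dim_Hom: "\<exists>B. finite B \<and> span B = Hom C X Y"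
    and finite_simples: "finite (iso_class ` {X. simple X})"
    and semisimple: "\<exists>Ys. (\<forall>Y\<in>set Ys. simple Y) \<and> direct_sum X Ys"

section \<open>Fusion categories\<close>

text \<open>
  \<open>\<odot>\<close> is the tensor product of objects and \<open>\<star>\<close> that of morphisms;
  \<open>asc X Y Z : (X \<odot> Y) \<odot> Z \<rightarrow> X \<odot> (Y \<odot> Z)\<close>,
  \<open>lun X : \<I> \<odot> X \<rightarrow> X\<close>, \<open>run X : X \<odot> \<I> \<rightarrow> X\<close>.
  \<open>dual X\<close> is a chosen left dual of \<open>X\<close>, with \<open>ev X : dual X \<odot> X \<rightarrow> \<I>\<close> and
  \<open>coev X : \<I> \<rightarrow> X \<odot> dual X\<close>.
\<close>

record ('o, 'm, 'k) monoidal_cat = "('o, 'm, 'k) linear_cat" +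
  tensor_ob :: "'o \<Rightarrow> 'o \<Rightarrow> 'o"  (infixl "\<odot>\<index>" 75)
  tensor_mor :: "'m \<Rightarrow> 'm \<Rightarrow> 'm"  (infixl "\<star>\<index>" 75)
  unit_ob :: 'o  ("\<I>\<index>")
  asc :: "'o \<Rightarrow> 'o \<Rightarrow> 'o \<Rightarrow> 'm"
  lun :: "'o \<Rightarrow> 'm"
  run :: "'o \<Rightarrow> 'm"

record ('o, 'm, 'k) rigid_cat = "('o, 'm, 'k) monoidal_cat" +
  dual :: "'o \<Rightarrow> 'o"
  ev :: "'o \<Rightarrow> 'm"
  coev :: "'o \<Rightarrow> 'm"

locale linear_monoidal_category = linear_category C
  for C :: "('o, 'm::ab_group_add, 'k::field, 'z) monoidal_cat_scheme" (structure) +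
  assumes tensor_in_Hom: "f \<in> Hom C X Y \<Longrightarrow> g \<in> Hom C X' Y' \<Longrightarrow>
          f \<star> g \<in> Hom C (X \<odot> X') (Y \<odot> Y')"
    and tensor_ident: "ident C X \<star> ident C Y = ident C (X \<odot> Y)"
    and tensor_cmp: "f \<in> Hom C X Y \<Longrightarrow> g \<in> Hom C Y Z \<Longrightarrow> f' \<in> Hom C X' Y' \<Longrightarrow> g' \<in> Hom C Y' Z' \<Longrightarrow>
          (g \<cdot> f) \<star> (g' \<cdot> f') = (g \<star> g') \<cdot> (f \<star> f')"
    and tensor_add_left: "f \<in> Hom C X Y \<Longrightarrow> f' \<in> Hom C X Y \<Longrightarrow> g \<in> Hom C X' Y' \<Longrightarrow>
          (f + f') \<star> g = f \<star> g + f' \<star> g"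
    and tensor_add_right: "f \<in> Hom C X Y \<Longrightarrow> g \<in> Hom C X' Y' \<Longrightarrow> g' \<in> Hom C X' Y' \<Longrightarrow>
          f \<star> (g + g') = f \<star> g + f \<star> g'"
    and tensor_scl_left: "f \<in> Hom C X Y \<Longrightarrow> g \<in> Hom C X' Y' \<Longrightarrow>
          scl C a f \<star> g = scl C a (f \<star> g)"
    and tensor_scl_right: "f \<in> Hom C X Y \<Longrightarrow> g \<in> Hom C X' Y' \<Longrightarrow>
          f \<star> scl C a g = scl C a (f \<star> g)"
    and asc_iso: "iso_arr ((X \<odot> Y) \<odot> Z) (X \<odot> (Y \<odot> Z)) (asc C X Y Z)"
    and asc_natural: "f \<in> Hom C X X' \<Longrightarrow> g \<in> Hom C Y Y' \<Longrightarrow> h \<in> Hom C Z Z' \<Longrightarrow>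
          asc C X' Y' Z' \<cdot> ((f \<star> g) \<star> h) = (f \<star> (g \<star> h)) \<cdot> asc C X Y Z"
    and lun_iso: "iso_arr (\<I> \<odot> X) X (lun C X)"
    and lun_natural: "f \<in> Hom C X Y \<Longrightarrow> lun C Y \<cdot> (ident C \<I> \<star> f) = f \<cdot> lun C X"
    and run_iso: "iso_arr (X \<odot> \<I>) X (run C X)"
    and run_natural: "f \<in> Hom C X Y \<Longrightarrow> run C Y \<cdot> (f \<star> ident C \<I>) = f \<cdot> run C X"
    and pentagon:
      "(ident C W \<star> asc C X Y Z) \<cdot> asc C W (X \<odot> Y) Z \<cdot> (asc C W X Y \<star> ident C Z)
         = asc C W X (Y \<odot> Z) \<cdot> asc C (W \<odot> X) Y Z"
    and triangle: "(ident C X \<star> lun C Y) \<cdot> asc C X \<I> Y = run C X \<star> ident C Y"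
begin

abbreviation asc_inv :: "'o \<Rightarrow> 'o \<Rightarrow> 'o \<Rightarrow> 'm" where
  "asc_inv X Y Z \<equiv> inverse_arr ((X \<odot> Y) \<odot> Z) (X \<odot> (Y \<odot> Z)) (asc C X Y Z)"

abbreviation run_inv :: "'o \<Rightarrow> 'm" where
  "run_inv X \<equiv> inverse_arr (X \<odot> \<I>) X (run C X)"

text \<open>\<open>Y\<close> is a left dual of \<open>X\<close> (equivalently, \<open>X\<close> is a right dual of \<open>Y\<close>), with evaluation
  \<open>e : Y \<odot> X \<rightarrow> \<I>\<close> and coevaluation \<open>d : \<I> \<rightarrow> X \<odot> Y\<close>.\<close>

definition is_left_dual :: "'o \<Rightarrow> 'o \<Rightarrow> 'm \<Rightarrow> 'm \<Rightarrow> bool" where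
  "is_left_dual X Y e d \<longleftrightarrow> e \<in> Hom C (Y \<odot> X) \<I> \<and> d \<in> Hom C \<I> (X \<odot> Y) \<and>
     run C X \<cdot> (ident C X \<star> e) \<cdot> asc C X Y X \<cdot> (d \<star> ident C X) = lun C X \<and>
     lun C Y \<cdot> (e \<star> ident C Y) \<cdot> asc_inv Y X Y \<cdot> (ident C Y \<star> d) = run C Y"

end

locale fusion_category =
  finite_semisimple_category C + linear_monoidal_category C
  for C :: "('o, 'm::ab_group_add, 'k::{alg_closed_field, field_char_0}, 'z) rigid_cat_scheme"
    (structure) +
  assumes left_dual: "is_left_dual X (dual C X) (ev C X) (coev C X)"
    and right_dual: "\<exists>Y e d. is_left_dual Y X e d"
    and unit_simple: "simple \<I>"
begin

text \<open>
  Full subcategories are represented by their sets of objects. The closure condition on direct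
  sums covers both closure under finite direct sums and closure under direct summands, hence in
  particular under isomorphism. By semisimplicity every subobject is a direct summand, so the simple
  objects of a fusion subcategory are the simple objects of the ambient category that lie in it.
\<close>

definition fusion_subcategory :: "'o set \<Rightarrow> bool" where
  "fusion_subcategory K \<longleftrightarrow> \<I> \<in> K \<and>
     (\<forall>X\<in>K. \<forall>Y\<in>K. X \<odot> Y \<in> K) \<and> (\<forall>X\<in>K. dual C X \<in> K) \<and>
     (\<forall>X Ys. direct_sum X Ys \<longrightarrow> (X \<in> K \<longleftrightarrow> set Ys \<subseteq> K))"

definition adjoint_subcategory :: "'o set" where
  "adjoint_subcategory = \<Inter>{K. fusion_subcategory K \<and> (\<forall>X. simple X \<longrightarrow> X \<odot> dual C X \<in> K)}"

definition Vec :: "'o set" where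
  "Vec = {X. \<exists>n. direct_sum X (replicate n \<I>)}"

definition invertible_in :: "'o set \<Rightarrow> 'o \<Rightarrow> bool" where
  "invertible_in K X \<longleftrightarrow> X \<in> K \<and> (\<exists>Y\<in>K. isomorphic (X \<odot> Y) \<I> \<and> isomorphic (Y \<odot> X) \<I>)"

text \<open>Isomorphism classes are taken in the ambient category, which agrees with isomorphism in \<open>K\<close>
  since fusion subcategories are full and closed under isomorphism.\<close>

definition inv_group :: "'o set \<Rightarrow> 'o set monoid" where
  "inv_group K = \<lparr> carrier = iso_class ` {X. invertible_in K X},
     monoid.mult = (\<lambda>A B. {Z. \<exists>X\<in>A. \<exists>Y\<in>B. isomorphic (X \<odot> Y) Z}),
     one = iso_class \<I> \<rparr>"

definition pointed :: "'o set \<Rightarrow> bool" where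
  "pointed K \<longleftrightarrow> (\<forall>X\<in>K. simple X \<longrightarrow> invertible_in K X)"

definition Irr :: "'o set \<Rightarrow> 'o set set" where
  "Irr K = iso_class ` {X\<in>K. simple X}"

definition rep :: "'o set \<Rightarrow> 'o" where
  "rep A = (SOME X. X \<in> A)"

text \<open>The multiplicity of the simple class \<open>D\<close> in \<open>X \<odot> Y\<close>, where \<open>Y\<close> represents \<open>B\<close>; as the
  ground field is algebraically closed it is the dimension of a morphism space.\<close>

definition fusion_coeff :: "'o \<Rightarrow> 'o set \<Rightarrow> 'o set \<Rightarrow> nat" where
  "fusion_coeff X B D = dim (Hom C (rep D) (X \<odot> rep B))"

text \<open>Real eigenvalues of left multiplication by \<open>X\<close> on the Grothendieck ring of \<open>K\<close>, in the
  basis of simple classes.\<close>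

definition left_mult_eigenvalue :: "'o set \<Rightarrow> 'o \<Rightarrow> real \<Rightarrow> bool" where
  "left_mult_eigenvalue K X r \<longleftrightarrow> (\<exists>v :: 'o set \<Rightarrow> real. (\<exists>B\<in>Irr K. v B \<noteq> 0) \<and>
     (\<forall>D\<in>Irr K. (\<Sum>B\<in>Irr K. real (fusion_coeff X B D) * v B) = r * v D))"

text \<open>The Frobenius-Perron dimension of an object is its largest non-negative eigenvalue, which
  exists by the Frobenius-Perron theorem.\<close>

definition FPdim_ob :: "'o set \<Rightarrow> 'o \<Rightarrow> real" where
  "FPdim_ob K X = Max {r. 0 \<le> r \<and> left_mult_eigenvalue K X r}"

definition FPdim :: "'o set \<Rightarrow> real" where
  "FPdim K = (\<Sum>A\<in>Irr K. (FPdim_ob K (rep A))\<^sup>2)"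

text \<open>The morphism \<open>A \<rightarrow> dual B\<close> corresponding to a pairing \<open>q : A \<odot> B \<rightarrow> \<I>\<close>.\<close>

definition mate :: "'o \<Rightarrow> 'o \<Rightarrow> 'm \<Rightarrow> 'm" where
  "mate A B q = lun C (dual C B) \<cdot> (q \<star> ident C (dual C B)) \<cdot> asc_inv A B (dual C B) \<cdot>
     (ident C A \<star> coev C B) \<cdot> run_inv A"

text \<open>For \<open>f : X \<rightarrow> Y\<close>, the dual morphism \<open>dual Y \<rightarrow> dual X\<close>.\<close>

definition dual_mor :: "'o \<Rightarrow> 'o \<Rightarrow> 'm \<Rightarrow> 'm" where
  "dual_mor X Y f = mate (dual C Y) X (ev C Y \<cdot> (ident C (dual C Y) \<star> f))"

text \<open>The canonical isomorphism \<open>dual Y \<odot> dual X \<rightarrow> dual (X \<odot> Y)\<close>, obtained from the nested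
  pairing.\<close>

definition dual_tensor :: "'o \<Rightarrow> 'o \<Rightarrow> 'm" where
  "dual_tensor X Y = mate (dual C Y \<odot> dual C X) (X \<odot> Y)
     (ev C Y \<cdot> (ident C (dual C Y) \<star> lun C Y) \<cdot>
      (ident C (dual C Y) \<star> (ev C X \<star> ident C Y)) \<cdot>
      (ident C (dual C Y) \<star> asc_inv (dual C X) X Y) \<cdot>
      asc C (dual C Y) (dual C X) (X \<odot> Y))"

end

section \<open>Spherical structures, braidings and modularity\<close>

text \<open>
  A pivotal structure is an isomorphism of monoidal functors from the identity to the double dual.
  With \<open>u = dual_tensor X Y\<close>, the monoidal structure of the double dual functor is the composite
  of \<open>dual_tensor (dual Y) (dual X) : dual (dual X) \<odot> dual (dual Y) \<rightarrow> dual (dual Y \<odot> dual X)\<close> with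
  the inverse of the dual of \<open>u\<close>; \<open>piv_monoidal\<close> is compatibility with it, with that inverse
  moved to the other side.
\<close>

locale pivotal_fusion_category = fusion_category C
  for C :: "('o, 'm::ab_group_add, 'k::{alg_closed_field, field_char_0}, 'z) rigid_cat_scheme"
    (structure) +
  fixes piv :: "'o \<Rightarrow> 'm"
  assumes piv_iso: "iso_arr X (dual C (dual C X)) (piv X)"
    and piv_natural: "f \<in> Hom C X Y \<Longrightarrow>
          piv Y \<cdot> f = dual_mor (dual C Y) (dual C X) (dual_mor X Y f) \<cdot> piv X"
    and piv_monoidal:
      "dual_mor (dual C Y \<odot> dual C X) (dual C (X \<odot> Y)) (dual_tensor X Y) \<cdot> piv (X \<odot> Y)
         = dual_tensor (dual C Y) (dual C X) \<cdot> (piv X \<star> piv Y)"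
begin

text \<open>The trace of \<open>f : X \<rightarrow> X\<close> is an endomorphism of the unit object, hence a scalar.\<close>

definition trace :: "'o \<Rightarrow> 'm \<Rightarrow> 'k" where
  "trace X f = (THE s. ev C (dual C X) \<cdot> ((piv X \<cdot> f) \<star> ident C (dual C X)) \<cdot> coev C X
                         = scl C s (ident C \<I>))"

end

locale spherical_fusion_category = pivotal_fusion_category C piv
  for C :: "('o, 'm::ab_group_add, 'k::{alg_closed_field, field_char_0}, 'z) rigid_cat_scheme"
    (structure) and piv +
  assumes spherical: "trace (dual C X) (ident C (dual C X)) = trace X (ident C X)"

locale braided_fusion_category = fusion_category C
  for C :: "('o, 'm::ab_group_add, 'k::{alg_closed_field, field_char_0}, 'z) rigid_cat_scheme"
    (structure) +
  fixes braid :: "'o \<Rightarrow> 'o \<Rightarrow> 'm"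
  assumes braid_iso: "iso_arr (X \<odot> Y) (Y \<odot> X) (braid X Y)"
    and braid_natural: "f \<in> Hom C X X' \<Longrightarrow> g \<in> Hom C Y Y' \<Longrightarrow>
          braid X' Y' \<cdot> (f \<star> g) = (g \<star> f) \<cdot> braid X Y"
    and hexagon:
      "asc C Y Z X \<cdot> braid X (Y \<odot> Z) \<cdot> asc C X Y Z
         = (ident C Y \<star> braid X Z) \<cdot> asc C Y X Z \<cdot> (braid X Y \<star> ident C Z)"
    and hexagon_inv:
      "asc_inv Z X Y \<cdot> braid (X \<odot> Y) Z \<cdot> asc_inv X Y Z
         = (braid X Z \<star> ident C Y) \<cdot> asc_inv X Z Y \<cdot> (ident C X \<star> braid Y Z)"
begin

definition centralizer :: "'o set \<Rightarrow> 'o set" where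
  "centralizer K = {Y. \<forall>X\<in>K. braid Y X \<cdot> braid X Y = ident C (X \<odot> Y)}"

definition modular_subcategory :: "'o set \<Rightarrow> bool" where
  "modular_subcategory K \<longleftrightarrow> fusion_subcategory K \<and> K \<inter> centralizer K = Vec"

end

locale premodular_category =
  spherical_fusion_category C piv + braided_fusion_category C braid
  for C :: "('o, 'm::ab_group_add, 'k::{alg_closed_field, field_char_0}, 'z) rigid_cat_scheme"
    (structure) and piv and braid
begin

definition S_matrix :: "'o set \<Rightarrow> 'o set \<Rightarrow> 'k" where
  "S_matrix A B = trace (rep A \<odot> rep B) (braid (rep B) (rep A) \<cdot> braid (rep A) (rep B))"

end

locale modular_tensor_category = premodular_category C piv braid
  for C :: "('o, 'm::ab_group_add, 'k::{alg_closed_field, field_char_0}, 'z) rigid_cat_scheme"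
    (structure) and piv and braid +
  assumes S_matrix_invertible:
    "\<exists>T. (\<forall>A\<in>Irr UNIV. \<forall>B\<in>Irr UNIV.
            (\<Sum>D\<in>Irr UNIV. S_matrix A D * T D B) = (if A = B then 1 else 0)) \<and>
         (\<forall>A\<in>Irr UNIV. \<forall>B\<in>Irr UNIV.
            (\<Sum>D\<in>Irr UNIV. T A D * S_matrix D B) = (if A = B then 1 else 0))"

end

theory Submission
  imports Defs "HOL-Algebra.FiniteProduct" "HOL-Algebra.Generated_Groups"
begin

text \<open>
  Write \<open>\<beta>\<close> for the bicharacter on the group of invertible objects given by the double braiding. Its
  radical consists of the invertible objects of the adjoint subcategory, so it lies in \<open>G\<close>. As \<open>|G|\<close>
  and the index of \<open>G\<close> are coprime, the group is the product of \<open>G\<close> and a complement \<open>H\<close>, and these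
  are orthogonal for \<open>\<beta>\<close>. Hence \<open>\<beta>\<close> is nondegenerate on \<open>H\<close>, and the direct sums of objects in \<open>H\<close>
  form the required subcategory.

  The statement on the radical is usually derived from the double centralizer theorem. Here it follows
  from the characters \<open>X \<mapsto> S(Y, X) / S(Y, 1)\<close> of the Grothendieck ring, where \<open>Y\<close> is simple;
  they are multiplicative since the partial trace over \<open>X\<close> of the double braiding of \<open>Y\<close> and \<open>X\<close> is a
  scalar. As the S-matrix is invertible, they separate the elements of the ring and are all of its
  characters.
  (1) If the character of \<open>Y\<close> agrees with that of the unit on all \<open>X \<otimes> X*\<close>, then \<open>Y\<close> is invertible: the
  character \<open>X \<mapsto> S(Y, X*) / S(Y, 1)\<close> belongs to some \<open>Y'\<close>, and \<open>Y \<otimes> Y'\<close> has the same S-column as a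
  multiple of the unit. (2) By (1), a product of factors \<open>X \<otimes> X* - c\<close> over the noninvertible \<open>Y\<close> is an
  element of the Grothendieck ring of the adjoint subcategory on which these characters vanish, but not
  that of the unit. (3) If \<open>g\<close> is transparent to all invertible objects, then multiplication by \<open>g\<close>
  scales this element, so \<open>g\<close> lies in the adjoint subcategory.
\<close>

section \<open>Arrows and coherence\<close>

text \<open>
  The morphism spaces \<open>Hom C X Y\<close> need not be disjoint. An arrow carries its source and target, so that
  composability is an equation between objects.
\<close>

datatype ('a, 'b) arrow = Arrow (src: 'a) (mor: 'b) (trg: 'a)

context linear_category
begin

lemma zero_in_Hom: "0 \<in> Hom C X Y"
  using subspace_Hom subspace_0 by blast

lemma is_inverse_unique:
  assumes "is_inverse X Y f g" "is_inverse X Y f h"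
  shows "g = h"
proof -
  have "g = g \<cdot> (f \<cdot> h)" using assms cmp_ident unfolding is_inverse_def by metis
  also have "\<dots> = (g \<cdot> f) \<cdot> h" using assms cmp_assoc unfolding is_inverse_def by metis
  also have "\<dots> = h" using assms ident_cmp unfolding is_inverse_def by metis
  finally show ?thesis .
qed

lemma inverse_arr_is_inverse:
  assumes "iso_arr X Y f"
  shows "is_inverse X Y f (inverse_arr X Y f)"
  using assms is_inverse_unique unfolding iso_arr_def inverse_arr_def by (metis the_equality)

definition arr :: "('o, 'm) arrow \<Rightarrow> bool" where
  "arr f \<longleftrightarrow> mor f \<in> Hom C (src f) (trg f)"

definition comp :: "('o, 'm) arrow \<Rightarrow> ('o, 'm) arrow \<Rightarrow> ('o, 'm) arrow"  (infixr "\<bullet>" 70) where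
  "g \<bullet> f = Arrow (src f) (mor g \<cdot> mor f) (trg g)"

definition Id :: "'o \<Rightarrow> ('o, 'm) arrow" where
  "Id X = Arrow X (ident C X) X"

definition inverse_arrow :: "('o, 'm) arrow \<Rightarrow> ('o, 'm) arrow" where
  "inverse_arrow f = Arrow (trg f) (inverse_arr (src f) (trg f) (mor f)) (src f)"

lemma arr_Arrow [simp]: "arr (Arrow X f Y) \<longleftrightarrow> f \<in> Hom C X Y"
  by (simp add: arr_def)

lemma src_comp [simp]: "src (g \<bullet> f) = src f"
  and trg_comp [simp]: "trg (g \<bullet> f) = trg g"
  and mor_comp: "mor (g \<bullet> f) = mor g \<cdot> mor f"
  by (simp_all add: comp_def)

lemma src_Id [simp]: "src (Id X) = X"
  and trg_Id [simp]: "trg (Id X) = X"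
  and mor_Id: "mor (Id X) = ident C X"
  and arr_Id [simp]: "arr (Id X)"
  by (simp_all add: Id_def ident_in_Hom)

lemma arr_comp [simp]: "arr g \<Longrightarrow> arr f \<Longrightarrow> src g = trg f \<Longrightarrow> arr (g \<bullet> f)"
  by (auto simp: arr_def comp_def intro: cmp_in_Hom)

lemma comp_Id [simp]: "arr f \<Longrightarrow> src f = X \<Longrightarrow> f \<bullet> Id X = f"
  by (cases f) (auto simp: comp_def Id_def cmp_ident)

lemma Id_comp [simp]: "arr f \<Longrightarrow> trg f = X \<Longrightarrow> Id X \<bullet> f = f"
  by (cases f) (auto simp: comp_def Id_def ident_cmp)

lemma comp_assoc: "arr f \<Longrightarrow> arr g \<Longrightarrow> arr h \<Longrightarrow> src h = trg g \<Longrightarrow> src g = trg f \<Longrightarrow>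
    (h \<bullet> g) \<bullet> f = h \<bullet> g \<bullet> f"
  by (cases f, cases g, cases h) (auto simp: comp_def cmp_assoc)

lemma arrow_eqI: "src f = src g \<Longrightarrow> trg f = trg g \<Longrightarrow> mor f = mor g \<Longrightarrow> f = g"
  by (simp add: arrow.expand)

definition iso :: "('o, 'm) arrow \<Rightarrow> bool" where
  "iso f \<longleftrightarrow> iso_arr (src f) (trg f) (mor f)"

lemma src_inverse_arrow [simp]: "src (inverse_arrow f) = trg f"
  and trg_inverse_arrow [simp]: "trg (inverse_arrow f) = src f"
  by (simp_all add: inverse_arrow_def)

lemma iso_arr: "iso f \<Longrightarrow> arr f"
  by (auto simp: iso_def arr_def iso_arr_def is_inverse_def)

lemma arr_inverse_arrow: "iso f \<Longrightarrow> arr (inverse_arrow f)"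
  using inverse_arr_is_inverse by (auto simp: iso_def arr_def inverse_arrow_def is_inverse_def)

lemma inverse_arrow_comp: "iso f \<Longrightarrow> inverse_arrow f \<bullet> f = Id (src f)"
  using inverse_arr_is_inverse
  by (auto simp: iso_def comp_def Id_def inverse_arrow_def is_inverse_def)

lemma comp_inverse_arrow: "iso f \<Longrightarrow> f \<bullet> inverse_arrow f = Id (trg f)"
  using inverse_arr_is_inverse
  by (auto simp: iso_def comp_def Id_def inverse_arrow_def is_inverse_def)

lemma cancel_right:
  assumes "f \<bullet> h = g \<bullet> h" "h \<bullet> h' = Id X" "arr f" "arr g" "arr h" "arr h'"
    "src f = X" "src g = X" "trg h = X" "src h = trg h'"
  shows "f = g"
proof -
  have "f = f \<bullet> h \<bullet> h'" using assms by simp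
  also have "\<dots> = g \<bullet> h \<bullet> h'" using assms comp_assoc by metis
  also have "\<dots> = g" using assms by simp
  finally show ?thesis .
qed

lemma cancel_left:
  assumes "h \<bullet> f = h \<bullet> g" "h' \<bullet> h = Id X" "arr f" "arr g" "arr h" "arr h'"
    "trg f = X" "trg g = X" "src h = X" "trg h = src h'"
  shows "f = g"
proof -
  have "f = (h' \<bullet> h) \<bullet> f" using assms by simp
  also have "\<dots> = (h' \<bullet> h) \<bullet> g" using assms comp_assoc by metis
  also have "\<dots> = g" using assms by simp
  finally show ?thesis .
qed

lemma comp_reassoc:
  assumes "a \<bullet> b = c" "arr a" "arr b" "arr x" "src a = trg b" "src b = trg x"
  shows "a \<bullet> b \<bullet> x = c \<bullet> x"
  using assms comp_assoc by metis

end

context linear_monoidal_category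
begin

definition tens :: "('o, 'm) arrow \<Rightarrow> ('o, 'm) arrow \<Rightarrow> ('o, 'm) arrow"  (infixr "**" 75) where
  "f ** g = Arrow (src f \<odot> src g) (mor f \<star> mor g) (trg f \<odot> trg g)"

definition \<alpha> where "\<alpha> X Y Z = Arrow ((X \<odot> Y) \<odot> Z) (asc C X Y Z) (X \<odot> (Y \<odot> Z))"
definition lu where "lu X = Arrow (\<I> \<odot> X) (lun C X) X"
definition ru where "ru X = Arrow (X \<odot> \<I>) (run C X) X"
definition \<alpha>' where "\<alpha>' X Y Z = inverse_arrow (\<alpha> X Y Z)"
definition lu' where "lu' X = inverse_arrow (lu X)"
definition ru' where "ru' X = inverse_arrow (ru X)"

lemma src_tens [simp]: "src (f ** g) = src f \<odot> src g"
  and trg_tens [simp]: "trg (f ** g) = trg f \<odot> trg g"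
  and mor_tens: "mor (f ** g) = mor f \<star> mor g"
  by (simp_all add: tens_def)

lemma arr_tens [simp]: "arr f \<Longrightarrow> arr g \<Longrightarrow> arr (f ** g)"
  by (simp add: tens_def arr_def tensor_in_Hom)

lemma iso_\<alpha>: "iso (\<alpha> X Y Z)" and iso_lu: "iso (lu X)" and iso_ru: "iso (ru X)"
  by (simp_all add: iso_def \<alpha>_def lu_def ru_def asc_iso lun_iso run_iso)

lemma src_\<alpha> [simp]: "src (\<alpha> X Y Z) = (X \<odot> Y) \<odot> Z"
  and trg_\<alpha> [simp]: "trg (\<alpha> X Y Z) = X \<odot> (Y \<odot> Z)"
  and src_\<alpha>' [simp]: "src (\<alpha>' X Y Z) = X \<odot> (Y \<odot> Z)"
  and trg_\<alpha>' [simp]: "trg (\<alpha>' X Y Z) = (X \<odot> Y) \<odot> Z"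
  and src_lu [simp]: "src (lu X) = \<I> \<odot> X"
  and trg_lu [simp]: "trg (lu X) = X"
  and src_lu' [simp]: "src (lu' X) = X"
  and trg_lu' [simp]: "trg (lu' X) = \<I> \<odot> X"
  and src_ru [simp]: "src (ru X) = X \<odot> \<I>"
  and trg_ru [simp]: "trg (ru X) = X"
  and src_ru' [simp]: "src (ru' X) = X"
  and trg_ru' [simp]: "trg (ru' X) = X \<odot> \<I>"
  by (simp_all add: \<alpha>_def lu_def ru_def \<alpha>'_def lu'_def ru'_def)

lemma arr_\<alpha> [simp]: "arr (\<alpha> X Y Z)" and arr_\<alpha>' [simp]: "arr (\<alpha>' X Y Z)"
  and arr_lu [simp]: "arr (lu X)" and arr_lu' [simp]: "arr (lu' X)"
  and arr_ru [simp]: "arr (ru X)" and arr_ru' [simp]: "arr (ru' X)"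
  by (simp_all add: iso_arr iso_\<alpha> iso_lu iso_ru arr_inverse_arrow \<alpha>'_def lu'_def ru'_def)

lemma \<alpha>\<alpha>' [simp]: "\<alpha> X Y Z \<bullet> \<alpha>' X Y Z = Id (X \<odot> (Y \<odot> Z))"
  and \<alpha>'\<alpha> [simp]: "\<alpha>' X Y Z \<bullet> \<alpha> X Y Z = Id ((X \<odot> Y) \<odot> Z)"
  and lulu' [simp]: "lu X \<bullet> lu' X = Id X" and lu'lu [simp]: "lu' X \<bullet> lu X = Id (\<I> \<odot> X)"
  and ruru' [simp]: "ru X \<bullet> ru' X = Id X" and ru'ru [simp]: "ru' X \<bullet> ru X = Id (X \<odot> \<I>)"
  unfolding \<alpha>'_def lu'_def ru'_def
  by (simp_all add: inverse_arrow_comp comp_inverse_arrow iso_\<alpha> iso_lu iso_ru)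

lemma Id_tens_Id [simp]: "Id X ** Id Y = Id (X \<odot> Y)"
  by (simp add: Id_def tens_def tensor_ident)

lemma tens_comp_tens:
  "arr f \<Longrightarrow> arr g \<Longrightarrow> arr f' \<Longrightarrow> arr g' \<Longrightarrow> src g = trg f \<Longrightarrow> src g' = trg f' \<Longrightarrow>
    (g ** g') \<bullet> (f ** f') = (g \<bullet> f) ** (g' \<bullet> f')"
  by (cases f, cases g, cases f', cases g') (auto simp: comp_def tens_def tensor_cmp)

lemma \<alpha>_natural: "arr f \<Longrightarrow> arr g \<Longrightarrow> arr h \<Longrightarrow>
    \<alpha> (trg f) (trg g) (trg h) \<bullet> ((f ** g) ** h) = (f ** (g ** h)) \<bullet> \<alpha> (src f) (src g) (src h)"
  by (cases f, cases g, cases h) (auto simp: comp_def tens_def \<alpha>_def asc_natural)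

lemma lu_natural: "arr f \<Longrightarrow> lu (trg f) \<bullet> (Id \<I> ** f) = f \<bullet> lu (src f)"
  by (cases f) (auto simp: comp_def tens_def lu_def Id_def lun_natural)

lemma ru_natural: "arr f \<Longrightarrow> ru (trg f) \<bullet> (f ** Id \<I>) = f \<bullet> ru (src f)"
  by (cases f) (auto simp: comp_def tens_def ru_def Id_def run_natural)

lemma pent: "(Id W ** \<alpha> X Y Z) \<bullet> \<alpha> W (X \<odot> Y) Z \<bullet> (\<alpha> W X Y ** Id Z)
    = \<alpha> W X (Y \<odot> Z) \<bullet> \<alpha> (W \<odot> X) Y Z"
proof -
  have "((Id W ** \<alpha> X Y Z) \<bullet> \<alpha> W (X \<odot> Y) Z) \<bullet> (\<alpha> W X Y ** Id Z)
      = \<alpha> W X (Y \<odot> Z) \<bullet> \<alpha> (W \<odot> X) Y Z"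
    by (simp add: comp_def tens_def \<alpha>_def Id_def pentagon)
  then show ?thesis by (simp add: comp_assoc)
qed

lemma tri: "(Id X ** lu Y) \<bullet> \<alpha> X \<I> Y = ru X ** Id Y"
  by (simp add: comp_def tens_def \<alpha>_def Id_def lu_def ru_def triangle)

lemma tens_Id_comp: "arr f \<Longrightarrow> arr g \<Longrightarrow> src g = trg f \<Longrightarrow>
    (g \<bullet> f) ** Id X = (g ** Id X) \<bullet> (f ** Id X)"
  by (simp add: tens_comp_tens)

lemma Id_tens_comp: "arr f \<Longrightarrow> arr g \<Longrightarrow> src g = trg f \<Longrightarrow>
    Id X ** (g \<bullet> f) = (Id X ** g) \<bullet> (Id X ** f)"
  by (simp add: tens_comp_tens)

lemma slide: "arr f \<Longrightarrow> arr g \<Longrightarrow>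
    (Id (trg f) ** g) \<bullet> (f ** Id (src g)) = (f ** Id (trg g)) \<bullet> (Id (src f) ** g)"
  by (simp add: tens_comp_tens)

lemma tens_Id_unit_faithful:
  assumes "f ** Id \<I> = g ** Id \<I>" "arr f" "arr g" "src f = src g" "trg f = trg g"
  shows "f = g"
proof (rule cancel_right)
  show "f \<bullet> ru (src f) = g \<bullet> ru (src f)" using assms ru_natural by metis
  show "ru (src f) \<bullet> ru' (src f) = Id (src f)" by simp
qed (use assms in auto)

lemma Id_unit_tens_faithful:
  assumes "Id \<I> ** f = Id \<I> ** g" "arr f" "arr g" "src f = src g" "trg f = trg g"
  shows "f = g"
proof (rule cancel_right)
  show "f \<bullet> lu (src f) = g \<bullet> lu (src f)" using assms lu_natural by metis
  show "lu (src f) \<bullet> lu' (src f) = Id (src f)" by simp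
qed (use assms in auto)

lemma \<alpha>_natural1: "arr f \<Longrightarrow> \<alpha> (trg f) Y Z \<bullet> ((f ** Id Y) ** Id Z) = (f ** Id (Y \<odot> Z)) \<bullet> \<alpha> (src f) Y Z"
  using \<alpha>_natural[of f "Id Y" "Id Z"] by simp
lemma \<alpha>_natural2: "arr f \<Longrightarrow> \<alpha> X (trg f) Z \<bullet> ((Id X ** f) ** Id Z) = (Id X ** (f ** Id Z)) \<bullet> \<alpha> X (src f) Z"
  using \<alpha>_natural[of "Id X" f "Id Z"] by simp
lemma \<alpha>_natural3: "arr f \<Longrightarrow> \<alpha> X Y (trg f) \<bullet> (Id (X \<odot> Y) ** f) = (Id X ** (Id Y ** f)) \<bullet> \<alpha> X Y (src f)"
  using \<alpha>_natural[of "Id X" "Id Y" f] by simp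

lemma \<alpha>'_natural:
  assumes "arr f" "arr g" "arr h"
  shows "\<alpha>' (trg f) (trg g) (trg h) \<bullet> (f ** (g ** h))
      = ((f ** g) ** h) \<bullet> \<alpha>' (src f) (src g) (src h)" (is "?L = ?R")
proof (rule cancel_left[OF _ \<alpha>'\<alpha>])
  have "\<alpha> (trg f) (trg g) (trg h) \<bullet> ?L = f ** (g ** h)"
    using assms by (simp add: comp_reassoc[OF \<alpha>\<alpha>'])
  also have "\<dots> = \<alpha> (trg f) (trg g) (trg h) \<bullet> ?R"
    using assms by (simp add: comp_reassoc[OF \<alpha>_natural] comp_assoc)
  finally show "\<alpha> (trg f) (trg g) (trg h) \<bullet> ?L = \<alpha> (trg f) (trg g) (trg h) \<bullet> ?R" .
qed (use assms in auto)

lemma lu_tens: "lu (X \<odot> Y) \<bullet> \<alpha> \<I> X Y = lu X ** Id Y"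
proof -
  let ?p = "\<alpha> \<I> (\<I> \<odot> X) Y \<bullet> (\<alpha> \<I> \<I> X ** Id Y)"
  let ?q = "(\<alpha>' \<I> \<I> X ** Id Y) \<bullet> \<alpha>' \<I> (\<I> \<odot> X) Y"
  have "(Id \<I> ** (lu (X \<odot> Y) \<bullet> \<alpha> \<I> X Y)) \<bullet> ?p
      = (Id \<I> ** lu (X \<odot> Y)) \<bullet> (Id \<I> ** \<alpha> \<I> X Y) \<bullet> ?p"
    by (simp add: Id_tens_comp comp_assoc)
  also have "\<dots> = (Id \<I> ** lu (X \<odot> Y)) \<bullet> \<alpha> \<I> \<I> (X \<odot> Y) \<bullet> \<alpha> (\<I> \<odot> \<I>) X Y"
    by (simp add: pent)
  also have "\<dots> = (ru \<I> ** Id (X \<odot> Y)) \<bullet> \<alpha> (\<I> \<odot> \<I>) X Y"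
    by (simp add: comp_reassoc[OF tri])
  also have "\<dots> = \<alpha> \<I> X Y \<bullet> ((ru \<I> ** Id X) ** Id Y)"
    using \<alpha>_natural1[of "ru \<I>"] by simp
  also have "\<dots> = \<alpha> \<I> X Y \<bullet> ((Id \<I> ** lu X) ** Id Y) \<bullet> (\<alpha> \<I> \<I> X ** Id Y)"
    by (simp add: tri[symmetric] tens_Id_comp)
  also have "\<dots> = (Id \<I> ** (lu X ** Id Y)) \<bullet> ?p"
    using \<alpha>_natural2[of "lu X" \<I> Y] comp_reassoc[OF \<alpha>_natural2[of "lu X" \<I> Y]] by (simp add: comp_assoc)
  finally have *: "(Id \<I> ** (lu (X \<odot> Y) \<bullet> \<alpha> \<I> X Y)) \<bullet> ?p = (Id \<I> ** (lu X ** Id Y)) \<bullet> ?p" .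
  have inv: "?p \<bullet> ?q = Id (\<I> \<odot> ((\<I> \<odot> X) \<odot> Y))"
  proof -
    have "(\<alpha> \<I> \<I> X ** Id Y) \<bullet> (\<alpha>' \<I> \<I> X ** Id Y) = Id ((\<I> \<odot> (\<I> \<odot> X)) \<odot> Y)"
      by (simp add: tens_comp_tens)
    then show ?thesis by (simp add: comp_assoc comp_reassoc)
  qed
  have "Id \<I> ** (lu (X \<odot> Y) \<bullet> \<alpha> \<I> X Y) = Id \<I> ** (lu X ** Id Y)"
    by (rule cancel_right[OF * inv]) auto
  then show ?thesis by (rule Id_unit_tens_faithful) auto
qed

lemma ru_tens: "(Id X ** ru Y) \<bullet> \<alpha> X Y \<I> = ru (X \<odot> Y)"
proof -
  have "\<alpha> X Y \<I> \<bullet> (((Id X ** ru Y) \<bullet> \<alpha> X Y \<I>) ** Id \<I>)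
      = \<alpha> X Y \<I> \<bullet> ((Id X ** ru Y) ** Id \<I>) \<bullet> (\<alpha> X Y \<I> ** Id \<I>)"
    by (simp add: tens_Id_comp)
  also have "\<dots> = (Id X ** (ru Y ** Id \<I>)) \<bullet> \<alpha> X (Y \<odot> \<I>) \<I> \<bullet> (\<alpha> X Y \<I> ** Id \<I>)"
    using comp_reassoc[OF \<alpha>_natural2[of "ru Y" X \<I>]] by (simp add: comp_assoc)
  also have "\<dots> = (Id X ** (Id Y ** lu \<I>)) \<bullet> (Id X ** \<alpha> Y \<I> \<I>) \<bullet> \<alpha> X (Y \<odot> \<I>) \<I> \<bullet> (\<alpha> X Y \<I> ** Id \<I>)"
    by (simp add: tri[symmetric] Id_tens_comp comp_assoc)
  also have "\<dots> = (Id X ** (Id Y ** lu \<I>)) \<bullet> \<alpha> X Y (\<I> \<odot> \<I>) \<bullet> \<alpha> (X \<odot> Y) \<I> \<I>"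
    by (simp add: pent)
  also have "\<dots> = \<alpha> X Y \<I> \<bullet> (Id (X \<odot> Y) ** lu \<I>) \<bullet> \<alpha> (X \<odot> Y) \<I> \<I>"
    using comp_reassoc[OF \<alpha>_natural3[of "lu \<I>" X Y]] by (simp add: comp_assoc)
  also have "\<dots> = \<alpha> X Y \<I> \<bullet> (ru (X \<odot> Y) ** Id \<I>)"
    by (simp add: tri)
  finally have "((Id X ** ru Y) \<bullet> \<alpha> X Y \<I>) ** Id \<I> = ru (X \<odot> Y) ** Id \<I>"
    by (rule cancel_left[OF _ \<alpha>'\<alpha>]) auto
  then show ?thesis by (rule tens_Id_unit_faithful) auto
qed

lemma lu_unit: "lu \<I> = ru \<I>"
proof -
  have "lu \<I> \<bullet> (Id \<I> ** lu \<I>) = lu \<I> \<bullet> lu (\<I> \<odot> \<I>)"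
    using lu_natural[of "lu \<I>"] by simp
  then have "Id \<I> ** lu \<I> = lu (\<I> \<odot> \<I>)"
    by (rule cancel_left[OF _ lu'lu]) auto
  then have "lu \<I> ** Id \<I> = ru \<I> ** Id \<I>"
    using tri[of \<I> \<I>] lu_tens[of \<I> \<I>] by simp
  then show ?thesis by (rule tens_Id_unit_faithful) auto
qed

end

section \<open>Duals\<close>

context linear_monoidal_category
begin

definition cap where
  "cap R S e V = ru V \<bullet> (Id V ** e) \<bullet> \<alpha> V R S"

definition cup where
  "cup R S d A = \<alpha>' A R S \<bullet> (Id A ** d) \<bullet> ru' A"

lemma cap_simps [simp]:
  "src (cap R S e V) = (V \<odot> R) \<odot> S" "trg (cap R S e V) = V"
  "arr e \<Longrightarrow> src e = R \<odot> S \<Longrightarrow> trg e = \<I> \<Longrightarrow> arr (cap R S e V)"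
  by (simp_all add: cap_def)

lemma cup_simps [simp]:
  "src (cup R S d A) = A" "trg (cup R S d A) = (A \<odot> R) \<odot> S"
  "arr d \<Longrightarrow> src d = \<I> \<Longrightarrow> trg d = R \<odot> S \<Longrightarrow> arr (cup R S d A)"
  by (simp_all add: cup_def)

lemma ru'_natural: "arr f \<Longrightarrow> ru' (trg f) \<bullet> f = (f ** Id \<I>) \<bullet> ru' (src f)"
  by (rule cancel_left[OF _ ru'ru], simp_all add: comp_reassoc[OF ru_natural] comp_reassoc[OF ruru'])
     (simp add: comp_assoc)

lemma cap_natural:
  assumes "arr f" "arr e" "src e = R \<odot> S" "trg e = \<I>"
  shows "cap R S e (trg f) \<bullet> ((f ** Id R) ** Id S) = f \<bullet> cap R S e (src f)"
proof -
  have "cap R S e (trg f) \<bullet> ((f ** Id R) ** Id S)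
      = ru (trg f) \<bullet> (Id (trg f) ** e) \<bullet> (f ** Id (R \<odot> S)) \<bullet> \<alpha> (src f) R S"
    using assms by (simp add: cap_def comp_assoc \<alpha>_natural1)
  also have "\<dots> = ru (trg f) \<bullet> (f ** Id \<I>) \<bullet> (Id (src f) ** e) \<bullet> \<alpha> (src f) R S"
    using assms comp_reassoc[OF slide[of f e]] by (simp add: comp_assoc)
  also have "\<dots> = f \<bullet> cap R S e (src f)"
    using assms by (simp add: comp_reassoc[OF ru_natural] comp_assoc cap_def)
  finally show ?thesis .
qed

lemma cap_left:
  assumes "arr e" "src e = R \<odot> S" "trg e = \<I>"
  shows "cap R S e (X \<odot> W) = (Id X ** cap R S e W) \<bullet> \<alpha> X (W \<odot> R) S \<bullet> (\<alpha> X W R ** Id S)"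
proof -
  have "(Id X ** cap R S e W) \<bullet> \<alpha> X (W \<odot> R) S \<bullet> (\<alpha> X W R ** Id S)
      = (Id X ** ru W) \<bullet> (Id X ** (Id W ** e)) \<bullet> \<alpha> X W (R \<odot> S) \<bullet> \<alpha> (X \<odot> W) R S"
    using assms by (simp add: cap_def Id_tens_comp comp_assoc pent)
  also have "\<dots> = (Id X ** ru W) \<bullet> \<alpha> X W \<I> \<bullet> (Id (X \<odot> W) ** e) \<bullet> \<alpha> (X \<odot> W) R S"
    using assms comp_reassoc[OF \<alpha>_natural3[of e X W]] by (simp add: comp_assoc)
  also have "\<dots> = cap R S e (X \<odot> W)"
    using assms by (simp add: cap_def comp_reassoc[OF ru_tens])
  finally show ?thesis by simp
qed

lemma cap_right:
  assumes "arr e" "src e = Q \<odot> R" "trg e = \<I>"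
  shows "(cap Q R e P ** Id S) \<bullet> \<alpha>' (P \<odot> Q) R S
    = (Id P ** lu S) \<bullet> (Id P ** (e ** Id S)) \<bullet> (Id P ** \<alpha>' Q R S) \<bullet> \<alpha> P Q (R \<odot> S)"
    (is "?L = ?R")
proof (rule cancel_right[OF _ \<alpha>\<alpha>'])
  have inv: "(Id P ** \<alpha>' Q R S) \<bullet> (Id P ** \<alpha> Q R S) = Id (P \<odot> ((Q \<odot> R) \<odot> S))"
    by (simp add: tens_comp_tens)
  have "?R \<bullet> \<alpha> (P \<odot> Q) R S = (Id P ** lu S) \<bullet> (Id P ** (e ** Id S)) \<bullet> (Id P ** \<alpha>' Q R S)
      \<bullet> (Id P ** \<alpha> Q R S) \<bullet> \<alpha> P (Q \<odot> R) S \<bullet> (\<alpha> P Q R ** Id S)"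
    using assms by (simp add: comp_assoc pent)
  also have "\<dots> = (Id P ** lu S) \<bullet> (Id P ** (e ** Id S)) \<bullet> \<alpha> P (Q \<odot> R) S \<bullet> (\<alpha> P Q R ** Id S)"
    using assms by (simp add: comp_reassoc[OF inv])
  also have "\<dots> = (Id P ** lu S) \<bullet> \<alpha> P \<I> S \<bullet> ((Id P ** e) ** Id S) \<bullet> (\<alpha> P Q R ** Id S)"
    using assms comp_reassoc[OF \<alpha>_natural2[of e P S]] by (simp add: comp_assoc)
  also have "\<dots> = ?L \<bullet> \<alpha> (P \<odot> Q) R S"
    using assms by (simp add: comp_reassoc[OF tri] comp_assoc cap_def tens_Id_comp)
  finally show "?L \<bullet> \<alpha> (P \<odot> Q) R S = ?R \<bullet> \<alpha> (P \<odot> Q) R S" by simp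
qed (use assms in auto)

lemma cup_natural:
  assumes "arr f" "arr d" "src d = \<I>" "trg d = R \<odot> S"
  shows "cup R S d (trg f) \<bullet> f = ((f ** Id R) ** Id S) \<bullet> cup R S d (src f)"
proof -
  have "cup R S d (trg f) \<bullet> f
      = \<alpha>' (trg f) R S \<bullet> (Id (trg f) ** d) \<bullet> (f ** Id \<I>) \<bullet> ru' (src f)"
    using assms by (simp add: cup_def comp_assoc ru'_natural)
  also have "\<dots> = \<alpha>' (trg f) R S \<bullet> (f ** Id (R \<odot> S)) \<bullet> (Id (src f) ** d) \<bullet> ru' (src f)"
    using assms comp_reassoc[OF slide[of f d]] by (simp add: comp_assoc)
  also have "\<dots> = ((f ** Id R) ** Id S) \<bullet> cup R S d (src f)"
    using assms comp_reassoc[OF \<alpha>'_natural[of f "Id R" "Id S"]] by (simp add: comp_assoc cup_def)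
  finally show ?thesis .
qed

lemma pent': "(\<alpha>' W X Y ** Id Z) \<bullet> \<alpha>' W (X \<odot> Y) Z \<bullet> (Id W ** \<alpha>' X Y Z)
    = \<alpha>' (W \<odot> X) Y Z \<bullet> \<alpha>' W X (Y \<odot> Z)" (is "?L = ?R")
proof -
  let ?p = "\<alpha> W X (Y \<odot> Z) \<bullet> \<alpha> (W \<odot> X) Y Z"
  have i1: "(Id W ** \<alpha>' X Y Z) \<bullet> (Id W ** \<alpha> X Y Z) = Id (W \<odot> ((X \<odot> Y) \<odot> Z))"
    and i2: "(\<alpha>' W X Y ** Id Z) \<bullet> (\<alpha> W X Y ** Id Z) = Id (((W \<odot> X) \<odot> Y) \<odot> Z)"
    by (simp_all add: tens_comp_tens)
  have "?L \<bullet> ?p = (\<alpha>' W X Y ** Id Z) \<bullet> \<alpha>' W (X \<odot> Y) Z \<bullet> (Id W ** \<alpha>' X Y Z) \<bullet>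
      (Id W ** \<alpha> X Y Z) \<bullet> \<alpha> W (X \<odot> Y) Z \<bullet> (\<alpha> W X Y ** Id Z)"
    by (simp add: pent comp_assoc)
  also have "\<dots> = Id (((W \<odot> X) \<odot> Y) \<odot> Z)"
    by (simp add: comp_reassoc[OF i1] comp_reassoc[OF \<alpha>'\<alpha>] i2)
  also have "\<dots> = ?R \<bullet> ?p"
    by (simp add: comp_assoc comp_reassoc[OF \<alpha>'\<alpha>])
  finally have *: "?L \<bullet> ?p = ?R \<bullet> ?p" .
  have "?p \<bullet> ?R = Id (W \<odot> (X \<odot> (Y \<odot> Z)))"
    by (simp add: comp_assoc comp_reassoc[OF \<alpha>\<alpha>'])
  from cancel_right[OF * this] show ?thesis by simp
qed

lemma ru'_tens: "\<alpha>' X Y \<I> \<bullet> (Id X ** ru' Y) = ru' (X \<odot> Y)"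
proof (rule cancel_left[OF _ ru'ru])
  have "(Id X ** ru Y) \<bullet> (Id X ** ru' Y) = Id (X \<odot> Y)" by (simp add: tens_comp_tens)
  then have "((Id X ** ru Y) \<bullet> \<alpha> X Y \<I>) \<bullet> \<alpha>' X Y \<I> \<bullet> (Id X ** ru' Y) = Id (X \<odot> Y)"
    by (simp add: comp_assoc comp_reassoc[OF \<alpha>\<alpha>'])
  then show "ru (X \<odot> Y) \<bullet> \<alpha>' X Y \<I> \<bullet> (Id X ** ru' Y) = ru (X \<odot> Y) \<bullet> ru' (X \<odot> Y)"
    by (simp add: ru_tens)
qed auto

lemma cup_left:
  assumes "arr d" "src d = \<I>" "trg d = R \<odot> S"
  shows "cup R S d (X \<odot> A) = (\<alpha>' X A R ** Id S) \<bullet> \<alpha>' X (A \<odot> R) S \<bullet> (Id X ** cup R S d A)"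
proof -
  have "(\<alpha>' X A R ** Id S) \<bullet> \<alpha>' X (A \<odot> R) S \<bullet> (Id X ** cup R S d A)
      = \<alpha>' (X \<odot> A) R S \<bullet> \<alpha>' X A (R \<odot> S) \<bullet> (Id X ** (Id A ** d)) \<bullet> (Id X ** ru' A)"
    using assms comp_reassoc[OF pent'[of X A R S]]
    by (simp add: cup_def Id_tens_comp comp_assoc)
  also have "\<dots> = \<alpha>' (X \<odot> A) R S \<bullet> (Id (X \<odot> A) ** d) \<bullet> \<alpha>' X A \<I> \<bullet> (Id X ** ru' A)"
    using assms comp_reassoc[OF \<alpha>'_natural[of "Id X" "Id A" d]] by (simp add: comp_assoc)
  also have "\<dots> = cup R S d (X \<odot> A)"
    by (simp add: ru'_tens cup_def)
  finally show ?thesis by simp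
qed

end

context fusion_category
begin

abbreviation D :: "'o \<Rightarrow> 'o" where "D \<equiv> dual C"

definition Ev where "Ev X = Arrow (D X \<odot> X) (ev C X) \<I>"
definition Coev where "Coev X = Arrow \<I> (coev C X) (X \<odot> D X)"

lemma Ev_simps [simp]: "src (Ev X) = D X \<odot> X" "trg (Ev X) = \<I>" "arr (Ev X)"
  using left_dual[of X] by (auto simp: Ev_def is_left_dual_def)

lemma Coev_simps [simp]: "src (Coev X) = \<I>" "trg (Coev X) = X \<odot> D X" "arr (Coev X)"
  using left_dual[of X] by (auto simp: Coev_def is_left_dual_def)

lemma zigzag1: "ru X \<bullet> (Id X ** Ev X) \<bullet> \<alpha> X (D X) X \<bullet> (Coev X ** Id X) = lu X"
proof -
  have "((ru X \<bullet> (Id X ** Ev X)) \<bullet> \<alpha> X (D X) X) \<bullet> (Coev X ** Id X) = lu X"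
    using left_dual[of X]
    by (simp add: comp_def tens_def \<alpha>_def Id_def ru_def lu_def Ev_def Coev_def is_left_dual_def)
  then show ?thesis by (simp add: comp_assoc)
qed

lemma zigzag2:
  "lu (D X) \<bullet> (Ev X ** Id (D X)) \<bullet> \<alpha>' (D X) X (D X) \<bullet> (Id (D X) ** Coev X) = ru (D X)"
proof -
  have "((lu (D X) \<bullet> (Ev X ** Id (D X))) \<bullet> \<alpha>' (D X) X (D X)) \<bullet> (Id (D X) ** Coev X) = ru (D X)"
    using left_dual[of X]
    by (simp add: comp_def tens_def \<alpha>_def \<alpha>'_def inverse_arrow_def Id_def ru_def lu_def
        Ev_def Coev_def is_left_dual_def)
  then show ?thesis by (simp add: comp_assoc)
qed

abbreviation eps where "eps B V \<equiv> cap (D B) B (Ev B) V"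
abbreviation eta where "eta B A \<equiv> cup B (D B) (Coev B) A"

lemma eps_eta: "eps B (A \<odot> B) \<bullet> (eta B A ** Id B) = Id (A \<odot> B)"
proof -
  have z: "eps B B \<bullet> (Coev B ** Id B) = lu B"
    using zigzag1[of B] by (simp add: cap_def comp_assoc)
  have i: "(\<alpha> A B (D B) ** Id B) \<bullet> (\<alpha>' A B (D B) ** Id B) = Id ((A \<odot> (B \<odot> D B)) \<odot> B)"
    and j: "(ru A ** Id B) \<bullet> (ru' A ** Id B) = Id (A \<odot> B)"
    by (simp_all add: tens_comp_tens)
  have "eps B (A \<odot> B) \<bullet> (eta B A ** Id B)
      = (Id A ** eps B B) \<bullet> \<alpha> A (B \<odot> D B) B \<bullet> ((Id A ** Coev B) ** Id B) \<bullet> (ru' A ** Id B)"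
    by (simp add: cap_left comp_assoc cup_def tens_Id_comp comp_reassoc[OF i])
  also have "\<dots> = (Id A ** eps B B) \<bullet> (Id A ** (Coev B ** Id B)) \<bullet> \<alpha> A \<I> B \<bullet> (ru' A ** Id B)"
    using comp_reassoc[OF \<alpha>_natural2[of "Coev B" A B]] by (simp add: comp_assoc)
  also have "\<dots> = (Id A ** lu B) \<bullet> \<alpha> A \<I> B \<bullet> (ru' A ** Id B)"
    by (subst comp_assoc[symmetric]) (simp_all add: Id_tens_comp[symmetric] z)
  also have "\<dots> = Id (A \<odot> B)"
    by (simp add: comp_reassoc[OF tri] j)
  finally show ?thesis .
qed

lemma eta_eps: "(eps B A ** Id (D B)) \<bullet> eta B (A \<odot> D B) = Id (A \<odot> D B)"
proof -
  have "(eps B A ** Id (D B)) \<bullet> eta B (A \<odot> D B)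
     = ((eps B A ** Id (D B)) \<bullet> \<alpha>' (A \<odot> D B) B (D B)) \<bullet> (Id (A \<odot> D B) ** Coev B) \<bullet> ru' (A \<odot> D B)"
    by (simp add: cup_def comp_assoc)
  also have "\<dots> = (Id A ** lu (D B)) \<bullet> (Id A ** (Ev B ** Id (D B))) \<bullet> (Id A ** \<alpha>' (D B) B (D B)) \<bullet>
      \<alpha> A (D B) (B \<odot> D B) \<bullet> (Id (A \<odot> D B) ** Coev B) \<bullet> ru' (A \<odot> D B)"
    by (simp add: cap_right comp_assoc)
  also have "\<dots> = (Id A ** (lu (D B) \<bullet> (Ev B ** Id (D B)) \<bullet> \<alpha>' (D B) B (D B) \<bullet> (Id (D B) ** Coev B)))
      \<bullet> \<alpha> A (D B) \<I> \<bullet> ru' (A \<odot> D B)"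
    using comp_reassoc[OF \<alpha>_natural3[of "Coev B" A "D B"]] by (simp add: comp_assoc Id_tens_comp)
  also have "\<dots> = Id (A \<odot> D B)"
    by (simp add: zigzag2 comp_reassoc[OF ru_tens])
  finally show ?thesis .
qed

lemma eps_injective:
  assumes "eps B W \<bullet> (s ** Id B) = eps B W \<bullet> (t ** Id B)"
    "arr s" "arr t" "src s = src t" "trg s = W \<odot> D B" "trg t = W \<odot> D B"
  shows "s = t"
proof -
  have *: "((eps B W \<bullet> (s ** Id B)) ** Id (D B)) \<bullet> eta B (src s) = s"
    if "arr s" "trg s = W \<odot> D B" for s
  proof -
    have "((eps B W \<bullet> (s ** Id B)) ** Id (D B)) \<bullet> eta B (src s)
        = (eps B W ** Id (D B)) \<bullet> eta B (trg s) \<bullet> s"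
      using that cup_natural[of s "Coev B" B "D B"] by (simp add: tens_Id_comp comp_assoc)
    also have "\<dots> = s" using that by (simp add: comp_reassoc[OF eta_eps])
    finally show ?thesis .
  qed
  show ?thesis using *[OF assms(2,5)] *[OF assms(3,6)] assms(1,4) by metis
qed

definition Mate where
  "Mate A B q = lu (D B) \<bullet> (q ** Id (D B)) \<bullet> eta B A"

lemma Mate_simps [simp]:
  "src (Mate A B q) = A" "trg (Mate A B q) = D B"
  "arr q \<Longrightarrow> src q = A \<odot> B \<Longrightarrow> trg q = \<I> \<Longrightarrow> arr (Mate A B q)"
  by (simp_all add: Mate_def)

lemma mor_Mate: "arr q \<Longrightarrow> src q = A \<odot> B \<Longrightarrow> trg q = \<I> \<Longrightarrow> mor (Mate A B q) = mate A B (mor q)"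
proof -
  assume a: "arr q" "src q = A \<odot> B" "trg q = \<I>"
  then have "Mate A B q = (((lu (D B) \<bullet> (q ** Id (D B))) \<bullet> \<alpha>' A B (D B)) \<bullet> (Id A ** Coev B)) \<bullet> ru' A"
    by (simp add: Mate_def cup_def comp_assoc)
  then show ?thesis
    using a by (simp add: mate_def comp_def tens_def \<alpha>_def \<alpha>'_def inverse_arrow_def Id_def ru_def ru'_def lu_def
        Ev_def Coev_def)
qed

lemma Ev_Mate:
  assumes "arr q" "src q = A \<odot> B" "trg q = \<I>"
  shows "Ev B \<bullet> (Mate A B q ** Id B) = q"
proof -
  have "Ev B \<bullet> (lu (D B) ** Id B) = Ev B \<bullet> lu (D B \<odot> B) \<bullet> \<alpha> \<I> (D B) B"
    by (simp add: lu_tens)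
  also have "\<dots> = eps B \<I>"
    using comp_reassoc[OF lu_natural[of "Ev B", symmetric]] by (simp add: cap_def lu_unit comp_assoc)
  finally have *: "Ev B \<bullet> (lu (D B) ** Id B) = eps B \<I>" .
  have "Ev B \<bullet> (Mate A B q ** Id B) = eps B \<I> \<bullet> ((q ** Id (D B)) ** Id B) \<bullet> (eta B A ** Id B)"
    using assms by (simp add: Mate_def tens_Id_comp comp_reassoc[OF *])
  also have "\<dots> = q \<bullet> eps B (A \<odot> B) \<bullet> (eta B A ** Id B)"
    using assms comp_reassoc[OF cap_natural[of q "Ev B" "D B" B]] by (simp add: comp_assoc)
  also have "\<dots> = q" using assms by (simp add: eps_eta)
  finally show ?thesis .
qed

definition dm where
  "dm f = Mate (D (trg f)) (src f) (Ev (trg f) \<bullet> (Id (D (trg f)) ** f))"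

lemma dm_simps [simp]: "src (dm f) = D (trg f)" "trg (dm f) = D (src f)" "arr f \<Longrightarrow> arr (dm f)"
  by (simp_all add: dm_def)

lemma mor_dm: "arr f \<Longrightarrow> mor (dm f) = dual_mor (src f) (trg f) (mor f)"
  by (simp add: dm_def mor_Mate dual_mor_def) (simp add: comp_def Ev_def tens_def Id_def)

lemma Ev_dm: "arr f \<Longrightarrow> Ev (src f) \<bullet> (dm f ** Id (src f)) = Ev (trg f) \<bullet> (Id (D (trg f)) ** f)"
  by (simp add: dm_def Ev_Mate)

lemma eps_Coev: "eps X X \<bullet> (Coev X ** Id X) = lu X"
  using zigzag1[of X] by (simp add: cap_def comp_assoc)

lemma Coev_dm:
  assumes "arr f"
  shows "(f ** Id (D (src f))) \<bullet> Coev (src f) = (Id (trg f) ** dm f) \<bullet> Coev (trg f)"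
proof (rule eps_injective[of "src f" "trg f"])
  let ?X = "src f" and ?Y = "trg f"
  have "eps ?X ?Y \<bullet> (((f ** Id (D ?X)) \<bullet> Coev ?X) ** Id ?X)
      = f \<bullet> eps ?X ?X \<bullet> (Coev ?X ** Id ?X)"
    using assms comp_reassoc[OF cap_natural[of f "Ev ?X" "D ?X" ?X]]
    by (simp add: tens_Id_comp comp_assoc)
  also have "\<dots> = f \<bullet> lu ?X" by (simp add: eps_Coev)
  also have "\<dots> = lu ?Y \<bullet> (Id \<I> ** f)" using assms by (simp add: lu_natural)
  also have "\<dots> = eps ?Y ?Y \<bullet> (Coev ?Y ** Id ?Y) \<bullet> (Id \<I> ** f)"
    using assms by (simp add: comp_reassoc[OF eps_Coev])
  also have "\<dots> = eps ?Y ?Y \<bullet> (Id (?Y \<odot> D ?Y) ** f) \<bullet> (Coev ?Y ** Id ?X)"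
    using assms slide[of "Coev ?Y" f] by simp
  also have "\<dots> = ru ?Y \<bullet> (Id ?Y ** Ev ?Y) \<bullet> (Id ?Y ** (Id (D ?Y) ** f)) \<bullet> \<alpha> ?Y (D ?Y) ?X \<bullet> (Coev ?Y ** Id ?X)"
    using assms comp_reassoc[OF \<alpha>_natural3[of f ?Y "D ?Y"]] by (simp add: cap_def comp_assoc)
  also have "\<dots> = ru ?Y \<bullet> (Id ?Y ** (Ev ?Y \<bullet> (Id (D ?Y) ** f))) \<bullet> \<alpha> ?Y (D ?Y) ?X \<bullet> (Coev ?Y ** Id ?X)"
    using assms by (simp add: Id_tens_comp comp_assoc)
  also have "\<dots> = ru ?Y \<bullet> (Id ?Y ** Ev ?X) \<bullet> (Id ?Y ** (dm f ** Id ?X)) \<bullet> \<alpha> ?Y (D ?Y) ?X \<bullet> (Coev ?Y ** Id ?X)"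
    using assms by (simp add: Ev_dm[symmetric] Id_tens_comp comp_assoc)
  also have "\<dots> = eps ?X ?Y \<bullet> (((Id ?Y ** dm f) \<bullet> Coev ?Y) ** Id ?X)"
    using assms comp_reassoc[OF \<alpha>_natural2[of "dm f" ?Y ?X]] by (simp add: cap_def comp_assoc tens_Id_comp)
  finally show "eps ?X ?Y \<bullet> (((f ** Id (D ?X)) \<bullet> Coev ?X) ** Id ?X)
      = eps ?X ?Y \<bullet> (((Id ?Y ** dm f) \<bullet> Coev ?Y) ** Id ?X)" .
qed (use assms in auto)

definition nested_ev where
  "nested_ev X Y = Ev Y \<bullet> (eps X (D Y) ** Id Y) \<bullet> \<alpha>' (D Y \<odot> D X) X Y"

definition nested_coev where
  "nested_coev X Y = \<alpha> (X \<odot> Y) (D Y) (D X) \<bullet> (eta Y X ** Id (D X)) \<bullet> Coev X"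

lemma nested_simps [simp]:
  "src (nested_ev X Y) = (D Y \<odot> D X) \<odot> (X \<odot> Y)" "trg (nested_ev X Y) = \<I>" "arr (nested_ev X Y)"
  "src (nested_coev X Y) = \<I>" "trg (nested_coev X Y) = (X \<odot> Y) \<odot> (D Y \<odot> D X)" "arr (nested_coev X Y)"
  by (simp_all add: nested_ev_def nested_coev_def)

definition du where "du X Y = Mate (D Y \<odot> D X) (X \<odot> Y) (nested_ev X Y)"

lemma du_simps [simp]: "src (du X Y) = D Y \<odot> D X" "trg (du X Y) = D (X \<odot> Y)" "arr (du X Y)"
  by (simp_all add: du_def)

lemma mor_du: "mor (du X Y) = dual_tensor X Y"
proof -
  have "nested_ev X Y = (((Ev Y \<bullet> (Id (D Y) ** lu Y)) \<bullet> (Id (D Y) ** (Ev X ** Id Y))) \<bullet>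
      (Id (D Y) ** \<alpha>' (D X) X Y)) \<bullet> \<alpha> (D Y) (D X) (X \<odot> Y)"
    by (simp add: nested_ev_def cap_right comp_assoc)
  then show ?thesis
    by (simp add: du_def mor_Mate dual_tensor_def)
       (simp add: comp_def tens_def \<alpha>_def \<alpha>'_def inverse_arrow_def Id_def lu_def Ev_def)
qed

lemma nested_zigzag:
  "ru (X \<odot> Y) \<bullet> (Id (X \<odot> Y) ** nested_ev X Y) \<bullet> \<alpha> (X \<odot> Y) (D Y \<odot> D X) (X \<odot> Y) \<bullet>
     (nested_coev X Y ** Id (X \<odot> Y)) = lu (X \<odot> Y)"
proof -
  let ?V = "X \<odot> Y" and ?W = "D Y \<odot> D X"
  have capV: "ru ?V \<bullet> (Id ?V ** Ev Y) = eps Y ?V \<bullet> \<alpha>' ?V (D Y) Y"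
    by (simp add: cap_def comp_assoc)
  have p: "\<alpha>' ?V (?W \<odot> X) Y \<bullet> (Id ?V ** \<alpha>' ?W X Y) \<bullet> \<alpha> ?V ?W (X \<odot> Y)
      = (\<alpha> ?V ?W X ** Id Y) \<bullet> \<alpha>' (?V \<odot> ?W) X Y"
  proof -
    have j: "(\<alpha> ?V ?W X ** Id Y) \<bullet> (\<alpha>' ?V ?W X ** Id Y) = Id ((?V \<odot> (?W \<odot> X)) \<odot> Y)"
      by (simp add: tens_comp_tens)
    have "(\<alpha> ?V ?W X ** Id Y) \<bullet> \<alpha>' (?V \<odot> ?W) X Y
        = (\<alpha> ?V ?W X ** Id Y) \<bullet> (\<alpha>' (?V \<odot> ?W) X Y \<bullet> \<alpha>' ?V ?W (X \<odot> Y)) \<bullet> \<alpha> ?V ?W (X \<odot> Y)"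
      by (simp add: comp_assoc)
    also have "\<dots> = (\<alpha> ?V ?W X ** Id Y) \<bullet> (\<alpha>' ?V ?W X ** Id Y) \<bullet> \<alpha>' ?V (?W \<odot> X) Y \<bullet>
        (Id ?V ** \<alpha>' ?W X Y) \<bullet> \<alpha> ?V ?W (X \<odot> Y)"
      by (simp add: pent'[symmetric] comp_assoc)
    also have "\<dots> = \<alpha>' ?V (?W \<odot> X) Y \<bullet> (Id ?V ** \<alpha>' ?W X Y) \<bullet> \<alpha> ?V ?W (X \<odot> Y)"
      by (simp add: comp_reassoc[OF j])
    finally show ?thesis by simp
  qed
  have inner: "(Id ?V ** eps X (D Y)) \<bullet> \<alpha> ?V ?W X \<bullet> (nested_coev X Y ** Id X) = eta Y X \<bullet> lu X"
  proof -
    have "(Id ?V ** eps X (D Y)) \<bullet> \<alpha> ?V ?W X \<bullet> (nested_coev X Y ** Id X)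
        = ((Id ?V ** eps X (D Y)) \<bullet> \<alpha> ?V ?W X \<bullet> (\<alpha> ?V (D Y) (D X) ** Id X)) \<bullet>
          ((eta Y X ** Id (D X)) ** Id X) \<bullet> (Coev X ** Id X)"
      by (simp add: nested_coev_def tens_Id_comp comp_assoc)
    also have "\<dots> = eps X (?V \<odot> D Y) \<bullet> ((eta Y X ** Id (D X)) ** Id X) \<bullet> (Coev X ** Id X)"
      by (simp add: cap_left)
    also have "\<dots> = eta Y X \<bullet> eps X X \<bullet> (Coev X ** Id X)"
      using comp_reassoc[OF cap_natural[of "eta Y X" "Ev X" "D X" X]] by (simp add: comp_assoc)
    also have "\<dots> = eta Y X \<bullet> lu X" by (simp add: eps_Coev)
    finally show ?thesis .
  qed
  have "ru ?V \<bullet> (Id ?V ** nested_ev X Y) \<bullet> \<alpha> ?V ?W ?V \<bullet> (nested_coev X Y ** Id ?V)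
      = (ru ?V \<bullet> (Id ?V ** Ev Y)) \<bullet> (Id ?V ** (eps X (D Y) ** Id Y)) \<bullet> (Id ?V ** \<alpha>' ?W X Y) \<bullet>
        \<alpha> ?V ?W ?V \<bullet> (nested_coev X Y ** Id ?V)"
    by (simp add: nested_ev_def Id_tens_comp comp_assoc)
  also have "\<dots> = eps Y ?V \<bullet> \<alpha>' ?V (D Y) Y \<bullet> (Id ?V ** (eps X (D Y) ** Id Y)) \<bullet> (Id ?V ** \<alpha>' ?W X Y) \<bullet>
        \<alpha> ?V ?W ?V \<bullet> (nested_coev X Y ** Id ?V)"
    by (simp add: capV comp_assoc)
  also have "\<dots> = eps Y ?V \<bullet> ((Id ?V ** eps X (D Y)) ** Id Y) \<bullet>
      (\<alpha>' ?V (?W \<odot> X) Y \<bullet> (Id ?V ** \<alpha>' ?W X Y) \<bullet> \<alpha> ?V ?W ?V) \<bullet> (nested_coev X Y ** Id ?V)"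
    using comp_reassoc[OF \<alpha>'_natural[of "Id ?V" "eps X (D Y)" "Id Y"]] by (simp add: comp_assoc)
  also have "\<dots> = eps Y ?V \<bullet> ((Id ?V ** eps X (D Y)) ** Id Y) \<bullet>
      (\<alpha> ?V ?W X ** Id Y) \<bullet> \<alpha>' (?V \<odot> ?W) X Y \<bullet> (nested_coev X Y ** Id ?V)"
    unfolding p by (simp add: comp_assoc)
  also have "\<dots> = eps Y ?V \<bullet> (((Id ?V ** eps X (D Y)) \<bullet> \<alpha> ?V ?W X \<bullet> (nested_coev X Y ** Id X)) ** Id Y) \<bullet> \<alpha>' \<I> X Y"
    using \<alpha>'_natural[of "nested_coev X Y" "Id X" "Id Y"] by (simp add: comp_assoc tens_Id_comp)
  also have "\<dots> = (eps Y ?V \<bullet> (eta Y X ** Id Y)) \<bullet> (lu X ** Id Y) \<bullet> \<alpha>' \<I> X Y"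
    unfolding inner by (simp add: comp_assoc tens_Id_comp)
  also have "\<dots> = lu ?V"
    by (simp add: eps_eta lu_tens[symmetric] comp_assoc)
  finally show ?thesis .
qed

lemma du_nested_coev: "(Id (X \<odot> Y) ** du X Y) \<bullet> nested_coev X Y = Coev (X \<odot> Y)"
proof (rule eps_injective[of "X \<odot> Y" "X \<odot> Y"])
  let ?V = "X \<odot> Y" and ?W = "D Y \<odot> D X"
  have "eps ?V ?V \<bullet> (((Id ?V ** du X Y) \<bullet> nested_coev X Y) ** Id ?V)
      = ru ?V \<bullet> (Id ?V ** Ev ?V) \<bullet> (Id ?V ** (du X Y ** Id ?V)) \<bullet> \<alpha> ?V ?W ?V \<bullet> (nested_coev X Y ** Id ?V)"
    using comp_reassoc[OF \<alpha>_natural2[of "du X Y" ?V ?V]] by (simp add: cap_def tens_Id_comp comp_assoc)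
  also have "\<dots> = ru ?V \<bullet> (Id ?V ** (Ev ?V \<bullet> (du X Y ** Id ?V))) \<bullet> \<alpha> ?V ?W ?V \<bullet> (nested_coev X Y ** Id ?V)"
    by (simp add: Id_tens_comp comp_assoc)
  also have "\<dots> = lu ?V"
    unfolding du_def by (simp add: Ev_Mate nested_zigzag)
  finally show "eps ?V ?V \<bullet> (((Id ?V ** du X Y) \<bullet> nested_coev X Y) ** Id ?V)
      = eps ?V ?V \<bullet> (Coev ?V ** Id ?V)" by (simp add: eps_Coev)
qed auto

end

section \<open>Traces and the double braiding\<close>

context pivotal_fusion_category
begin

definition Piv where "Piv X = Arrow X (piv X) (D (D X))"

lemma Piv_simps [simp]: "src (Piv X) = X" "trg (Piv X) = D (D X)" "arr (Piv X)"
  using piv_iso[of X] by (auto simp: Piv_def iso_arr_def is_inverse_def)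

lemma Piv_natural: "arr f \<Longrightarrow> Piv (trg f) \<bullet> f = dm (dm f) \<bullet> Piv (src f)"
  using piv_natural[of "mor f" "src f" "trg f"]
  by (intro arrow_eqI) (simp_all add: mor_comp mor_dm Piv_def arr_def[symmetric])

lemma Piv_monoidal: "dm (du X Y) \<bullet> Piv (X \<odot> Y) = du (D Y) (D X) \<bullet> (Piv X ** Piv Y)"
  by (rule arrow_eqI) (simp_all add: mor_comp mor_dm mor_du mor_tens Piv_def piv_monoidal)

definition Evp where "Evp X = Ev (D X) \<bullet> (Piv X ** Id (D X))"

lemma Evp_simps [simp]: "src (Evp X) = X \<odot> D X" "trg (Evp X) = \<I>" "arr (Evp X)"
  by (simp_all add: Evp_def)

definition Tr where "Tr f = Evp (src f) \<bullet> (f ** Id (D (src f))) \<bullet> Coev (src f)"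

lemma Tr_simps [simp]: "src (Tr f) = \<I>" "trg (Tr f) = \<I>" "arr f \<Longrightarrow> trg f = src f \<Longrightarrow> arr (Tr f)"
  by (simp_all add: Tr_def)

lemma Evp_dm:
  assumes "arr g"
  shows "Evp (trg g) \<bullet> (g ** Id (D (trg g))) = Evp (src g) \<bullet> (Id (src g) ** dm g)"
proof -
  have "Evp (trg g) \<bullet> (g ** Id (D (trg g))) = Ev (D (trg g)) \<bullet> ((Piv (trg g) \<bullet> g) ** Id (D (trg g)))"
    using assms by (simp add: Evp_def comp_assoc tens_Id_comp)
  also have "\<dots> = Ev (D (trg g)) \<bullet> (dm (dm g) ** Id (D (trg g))) \<bullet> (Piv (src g) ** Id (D (trg g)))"
    using assms by (simp add: Piv_natural tens_Id_comp)
  also have "\<dots> = Ev (D (src g)) \<bullet> (Id (D (D (src g))) ** dm g) \<bullet> (Piv (src g) ** Id (D (trg g)))"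
    using assms comp_reassoc[OF Ev_dm[of "dm g"]] by (simp add: comp_assoc)
  also have "\<dots> = Evp (src g) \<bullet> (Id (src g) ** dm g)"
    using assms slide[of "Piv (src g)" "dm g"] by (simp add: Evp_def comp_assoc)
  finally show ?thesis .
qed

lemma Tr_commute:
  assumes "arr f" "arr g" "src g = trg f" "trg g = src f"
  shows "Tr (g \<bullet> f) = Tr (f \<bullet> g)"
proof -
  let ?X = "src f" and ?Y = "trg f"
  have "Tr (g \<bullet> f) = Evp ?X \<bullet> (g ** Id (D ?X)) \<bullet> (f ** Id (D ?X)) \<bullet> Coev ?X"
    using assms by (simp add: Tr_def tens_Id_comp comp_assoc)
  also have "\<dots> = Evp ?Y \<bullet> (Id ?Y ** dm g) \<bullet> (f ** Id (D ?X)) \<bullet> Coev ?X"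
    using assms comp_reassoc[OF Evp_dm[of g]] by (simp add: comp_assoc)
  also have "\<dots> = Evp ?Y \<bullet> (f ** Id (D ?Y)) \<bullet> (Id ?X ** dm g) \<bullet> Coev ?X"
    using assms comp_reassoc[OF slide[of f "dm g"]] by (simp add: comp_assoc)
  also have "\<dots> = Evp ?Y \<bullet> (f ** Id (D ?Y)) \<bullet> (g ** Id (D ?Y)) \<bullet> Coev ?Y"
    using assms Coev_dm[of g] by simp
  also have "\<dots> = Tr (f \<bullet> g)"
    using assms by (simp add: Tr_def tens_Id_comp comp_assoc)
  finally show ?thesis .
qed

text \<open>The partial trace over \<open>B\<close> of a morphism \<open>A \<odot> B \<rightarrow> A' \<odot> B\<close>.\<close>

definition ptr where
  "ptr A A' B f = cap B (D B) (Evp B) A' \<bullet> (f ** Id (D B)) \<bullet> eta B A"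

lemma ptr_simps [simp]: "src (ptr A A' B f) = A" "trg (ptr A A' B f) = A'"
  "arr f \<Longrightarrow> src f = A \<odot> B \<Longrightarrow> trg f = A' \<odot> B \<Longrightarrow> arr (ptr A A' B f)"
  by (simp_all add: ptr_def)

lemma ptr_natural:
  assumes "arr f" "src f = A \<odot> B" "trg f = A' \<odot> B" "arr g" "trg g = A" "arr h" "src h = A'"
  shows "ptr (src g) (trg h) B ((h ** Id B) \<bullet> f \<bullet> (g ** Id B)) = h \<bullet> ptr A A' B f \<bullet> g"
proof -
  have "ptr (src g) (trg h) B ((h ** Id B) \<bullet> f \<bullet> (g ** Id B)) =
     cap B (D B) (Evp B) (trg h) \<bullet> ((h ** Id B) ** Id (D B)) \<bullet> (f ** Id (D B)) \<bullet>
       ((g ** Id B) ** Id (D B)) \<bullet> eta B (src g)"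
    using assms by (simp add: ptr_def tens_Id_comp comp_assoc)
  also have "\<dots> = h \<bullet> cap B (D B) (Evp B) A' \<bullet> (f ** Id (D B)) \<bullet> eta B A \<bullet> g"
    using assms comp_reassoc[OF cap_natural[of h "Evp B" B "D B"]] cup_natural[of g "Coev B" B "D B"]
    by (simp add: comp_assoc)
  also have "\<dots> = h \<bullet> ptr A A' B f \<bullet> g"
    using assms by (simp add: ptr_def comp_assoc)
  finally show ?thesis .
qed

lemma ptr_left:
  assumes "arr f" "src f = A \<odot> B" "trg f = A' \<odot> B"
  shows "ptr (X \<odot> A) (X \<odot> A') B (\<alpha>' X A' B \<bullet> (Id X ** f) \<bullet> \<alpha> X A B) = Id X ** ptr A A' B f"
proof -
  have i: "(\<alpha> X A' B ** Id (D B)) \<bullet> (\<alpha>' X A' B ** Id (D B)) = Id ((X \<odot> (A' \<odot> B)) \<odot> D B)"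
    and j: "(\<alpha> X A B ** Id (D B)) \<bullet> (\<alpha>' X A B ** Id (D B)) = Id ((X \<odot> (A \<odot> B)) \<odot> D B)"
    by (simp_all add: tens_comp_tens)
  have "ptr (X \<odot> A) (X \<odot> A') B (\<alpha>' X A' B \<bullet> (Id X ** f) \<bullet> \<alpha> X A B)
      = (Id X ** cap B (D B) (Evp B) A') \<bullet> \<alpha> X (A' \<odot> B) (D B) \<bullet> ((Id X ** f) ** Id (D B)) \<bullet>
        \<alpha>' X (A \<odot> B) (D B) \<bullet> (Id X ** eta B A)"
    using assms by (simp add: ptr_def cap_left cup_left tens_Id_comp comp_assoc
        comp_reassoc[OF i] comp_reassoc[OF j])
  also have "\<dots> = (Id X ** cap B (D B) (Evp B) A') \<bullet> (Id X ** (f ** Id (D B))) \<bullet> (Id X ** eta B A)"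
    using assms comp_reassoc[OF \<alpha>_natural2[of f X "D B"]]
    by (simp add: comp_assoc comp_reassoc[OF \<alpha>\<alpha>'])
  also have "\<dots> = Id X ** ptr A A' B f"
    using assms by (simp add: ptr_def Id_tens_comp comp_assoc)
  finally show ?thesis .
qed

lemma cap_change_left:
  assumes "arr e" "src e = R' \<odot> S" "trg e = \<I>" "arr g" "trg g = R'"
  shows "cap R' S e V \<bullet> ((Id V ** g) ** Id S) = cap (src g) S (e \<bullet> (g ** Id S)) V"
  using assms \<alpha>_natural2[of g V S] by (simp add: cap_def comp_assoc Id_tens_comp)

lemma Evp_tens:
  "Evp (A \<odot> B) \<bullet> (Id (A \<odot> B) ** du A B)
    = Evp A \<bullet> (cap B (D B) (Evp B) A ** Id (D A)) \<bullet> \<alpha>' (A \<odot> B) (D B) (D A)"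
proof -
  let ?W = "D B \<odot> D A"
  have "Evp (A \<odot> B) \<bullet> (Id (A \<odot> B) ** du A B)
      = Ev (D (A \<odot> B)) \<bullet> (Id (D (D (A \<odot> B))) ** du A B) \<bullet> (Piv (A \<odot> B) ** Id ?W)"
    using slide[of "Piv (A \<odot> B)" "du A B"] by (simp add: Evp_def comp_assoc)
  also have "\<dots> = Ev ?W \<bullet> (dm (du A B) ** Id ?W) \<bullet> (Piv (A \<odot> B) ** Id ?W)"
    using comp_reassoc[OF Ev_dm[of "du A B", symmetric]] by (simp add: comp_assoc)
  also have "\<dots> = Ev ?W \<bullet> ((dm (du A B) \<bullet> Piv (A \<odot> B)) ** Id ?W)"
    by (simp add: tens_Id_comp)
  also have "\<dots> = (Ev ?W \<bullet> (du (D B) (D A) ** Id ?W)) \<bullet> ((Piv A ** Piv B) ** Id ?W)"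
    by (simp add: Piv_monoidal tens_Id_comp comp_assoc)
  also have "\<dots> = nested_ev (D B) (D A) \<bullet> ((Piv A ** Piv B) ** Id ?W)"
    unfolding du_def by (simp add: Ev_Mate)
  also have "\<dots> = Ev (D A) \<bullet> ((eps (D B) (D (D A)) \<bullet> ((Piv A ** Piv B) ** Id (D B))) ** Id (D A)) \<bullet>
      \<alpha>' (A \<odot> B) (D B) (D A)"
    using \<alpha>'_natural[of "Piv A ** Piv B" "Id (D B)" "Id (D A)"]
    by (simp add: nested_ev_def comp_assoc tens_Id_comp)
  also have "eps (D B) (D (D A)) \<bullet> ((Piv A ** Piv B) ** Id (D B)) = Piv A \<bullet> cap B (D B) (Evp B) A"
  proof -
    have "(Piv A ** Piv B) = (Piv A ** Id (D (D B))) \<bullet> (Id A ** Piv B)"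
      by (simp add: tens_comp_tens)
    then have "eps (D B) (D (D A)) \<bullet> ((Piv A ** Piv B) ** Id (D B))
        = eps (D B) (D (D A)) \<bullet> ((Piv A ** Id (D (D B))) ** Id (D B)) \<bullet> ((Id A ** Piv B) ** Id (D B))"
      by (simp add: tens_Id_comp)
    also have "\<dots> = Piv A \<bullet> eps (D B) A \<bullet> ((Id A ** Piv B) ** Id (D B))"
      using comp_reassoc[OF cap_natural[of "Piv A" "Ev (D B)" "D (D B)" "D B"]] by (simp add: comp_assoc)
    also have "\<dots> = Piv A \<bullet> cap B (D B) (Evp B) A"
      using cap_change_left[of "Ev (D B)" "D (D B)" "D B" "Piv B"] by (simp add: Evp_def)
    finally show ?thesis .
  qed
  finally show ?thesis
    by (simp add: Evp_def tens_Id_comp comp_assoc)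
qed

lemma Tr_ptr:
  assumes "arr f" "src f = A \<odot> B" "trg f = A \<odot> B"
  shows "Tr f = Tr (ptr A A B f)"
proof -
  let ?W = "D B \<odot> D A"
  have "Tr f = Evp (A \<odot> B) \<bullet> (f ** Id (D (A \<odot> B))) \<bullet> (Id (A \<odot> B) ** du A B) \<bullet> nested_coev A B"
    using assms by (simp add: Tr_def du_nested_coev)
  also have "\<dots> = (Evp (A \<odot> B) \<bullet> (Id (A \<odot> B) ** du A B)) \<bullet> (f ** Id ?W) \<bullet> nested_coev A B"
    using assms comp_reassoc[OF slide[of f "du A B"]] by (simp add: comp_assoc)
  also have "\<dots> = Evp A \<bullet> (cap B (D B) (Evp B) A ** Id (D A)) \<bullet> \<alpha>' (A \<odot> B) (D B) (D A) \<bullet>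
      (f ** Id ?W) \<bullet> \<alpha> (A \<odot> B) (D B) (D A) \<bullet> (eta B A ** Id (D A)) \<bullet> Coev A"
    using assms by (simp add: Evp_tens nested_coev_def comp_assoc)
  also have "\<dots> = Evp A \<bullet> (cap B (D B) (Evp B) A ** Id (D A)) \<bullet> ((f ** Id (D B)) ** Id (D A)) \<bullet>
      (eta B A ** Id (D A)) \<bullet> Coev A"
    using assms comp_reassoc[OF \<alpha>'_natural[of f "Id (D B)" "Id (D A)"]]
    by (simp add: comp_assoc comp_reassoc[OF \<alpha>'\<alpha>])
  also have "\<dots> = Tr (ptr A A B f)"
    using assms by (simp add: Tr_def ptr_def tens_Id_comp comp_assoc)
  finally show ?thesis .
qed

end

context braided_fusion_category
begin

definition Br where "Br X Y = Arrow (X \<odot> Y) (braid X Y) (Y \<odot> X)"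

lemma Br_simps [simp]: "src (Br X Y) = X \<odot> Y" "trg (Br X Y) = Y \<odot> X" "arr (Br X Y)"
  using braid_iso[of X Y] by (auto simp: Br_def iso_arr_def is_inverse_def)

lemma Br_natural: "arr f \<Longrightarrow> arr g \<Longrightarrow>
    Br (trg f) (trg g) \<bullet> (f ** g) = (g ** f) \<bullet> Br (src f) (src g)"
  using braid_natural[of "mor f" "src f" "trg f" "mor g" "src g" "trg g"]
  by (intro arrow_eqI) (simp_all add: mor_comp mor_tens Br_def arr_def[symmetric])

definition Mon where "Mon X Y = Br Y X \<bullet> Br X Y"

lemma Mon_simps [simp]: "src (Mon X Y) = X \<odot> Y" "trg (Mon X Y) = X \<odot> Y" "arr (Mon X Y)"
  by (simp_all add: Mon_def)

lemma Mon_natural: "arr f \<Longrightarrow> arr g \<Longrightarrow>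
    Mon (trg f) (trg g) \<bullet> (f ** g) = (f ** g) \<bullet> Mon (src f) (src g)"
  by (simp add: Mon_def comp_assoc Br_natural comp_reassoc[OF Br_natural])

lemma hex: "\<alpha> Y Z X \<bullet> Br X (Y \<odot> Z) \<bullet> \<alpha> X Y Z
    = (Id Y ** Br X Z) \<bullet> \<alpha> Y X Z \<bullet> (Br X Y ** Id Z)"
proof -
  have "(\<alpha> Y Z X \<bullet> Br X (Y \<odot> Z)) \<bullet> \<alpha> X Y Z
      = ((Id Y ** Br X Z) \<bullet> \<alpha> Y X Z) \<bullet> (Br X Y ** Id Z)"
    by (simp add: comp_def tens_def \<alpha>_def Id_def Br_def hexagon)
  then show ?thesis by (simp add: comp_assoc)
qed

lemma hex_inv: "\<alpha>' Z X Y \<bullet> Br (X \<odot> Y) Z \<bullet> \<alpha>' X Y Z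
    = (Br X Z ** Id Y) \<bullet> \<alpha>' X Z Y \<bullet> (Id X ** Br Y Z)"
proof -
  have "(\<alpha>' Z X Y \<bullet> Br (X \<odot> Y) Z) \<bullet> \<alpha>' X Y Z
      = ((Br X Z ** Id Y) \<bullet> \<alpha>' X Z Y) \<bullet> (Id X ** Br Y Z)"
    by (simp add: comp_def tens_def \<alpha>_def \<alpha>'_def inverse_arrow_def Id_def Br_def hexagon_inv)
  then show ?thesis by (simp add: comp_assoc)
qed

lemma Mon_tens:
  "\<alpha>' Y X Z \<bullet> Mon Y (X \<odot> Z) \<bullet> \<alpha> Y X Z
    = (Br X Y ** Id Z) \<bullet> (\<alpha>' X Y Z \<bullet> (Id X ** Mon Y Z) \<bullet> \<alpha> X Y Z) \<bullet> (Br Y X ** Id Z)"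
proof -
  have "\<alpha>' Y X Z \<bullet> Mon Y (X \<odot> Z) \<bullet> \<alpha> Y X Z
      = (\<alpha>' Y X Z \<bullet> Br (X \<odot> Z) Y \<bullet> \<alpha>' X Z Y) \<bullet> (\<alpha> X Z Y \<bullet> Br Y (X \<odot> Z) \<bullet> \<alpha> Y X Z)"
    by (simp add: Mon_def comp_assoc comp_reassoc[OF \<alpha>'\<alpha>])
  also have "\<dots> = (Br X Y ** Id Z) \<bullet> (\<alpha>' X Y Z \<bullet> (Id X ** Mon Y Z) \<bullet> \<alpha> X Y Z) \<bullet> (Br Y X ** Id Z)"
    unfolding hex hex_inv by (simp add: comp_assoc Mon_def Id_tens_comp)
  finally show ?thesis .
qed

end

context premodular_category
begin

lemma Tr_Mon_tens:
  "Tr (Mon Y (X \<odot> Z)) = Tr (Br X Y \<bullet> (Id X ** ptr Y Y Z (Mon Y Z)) \<bullet> Br Y X)"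
proof -
  have "Tr (Mon Y (X \<odot> Z)) = Tr (\<alpha>' Y X Z \<bullet> Mon Y (X \<odot> Z) \<bullet> \<alpha> Y X Z)"
    using Tr_commute[of "Mon Y (X \<odot> Z) \<bullet> \<alpha> Y X Z" "\<alpha>' Y X Z"] by (simp add: comp_assoc)
  also have "\<dots> = Tr (ptr (Y \<odot> X) (Y \<odot> X) Z
      ((Br X Y ** Id Z) \<bullet> (\<alpha>' X Y Z \<bullet> (Id X ** Mon Y Z) \<bullet> \<alpha> X Y Z) \<bullet> (Br Y X ** Id Z)))"
    unfolding Mon_tens by (rule Tr_ptr) auto
  also have "\<dots> = Tr (Br X Y \<bullet> (Id X ** ptr Y Y Z (Mon Y Z)) \<bullet> Br Y X)"
    using ptr_natural[of "\<alpha>' X Y Z \<bullet> (Id X ** Mon Y Z) \<bullet> \<alpha> X Y Z" "X \<odot> Y" Z "X \<odot> Y" "Br Y X" "Br X Y"]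
    by (simp add: ptr_left)
  finally show ?thesis .
qed

end

section \<open>Semisimplicity\<close>

context linear_category
begin

lemma add_in_Hom: "f \<in> Hom C X Y \<Longrightarrow> g \<in> Hom C X Y \<Longrightarrow> f + g \<in> Hom C X Y"
  using subspace_Hom subspace_add by blast

lemma diff_in_Hom: "f \<in> Hom C X Y \<Longrightarrow> g \<in> Hom C X Y \<Longrightarrow> f - g \<in> Hom C X Y"
  using subspace_Hom subspace_diff by blast

lemma scl_in_Hom: "f \<in> Hom C X Y \<Longrightarrow> scl C c f \<in> Hom C X Y"
  using subspace_Hom subspace_scale by blast

lemma sum_in_Hom: "(\<And>j. j \<in> J \<Longrightarrow> f j \<in> Hom C X Y) \<Longrightarrow> sum f J \<in> Hom C X Y"
  using subspace_Hom subspace_sum by blast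

lemma zero_cmp: "f \<in> Hom C X Y \<Longrightarrow> 0 \<cdot> f = 0"
  using cmp_scl_left[of f X Y 0 undefined 0] zero_in_Hom by simp

lemma cmp_zero: "g \<in> Hom C Y Z \<Longrightarrow> g \<cdot> 0 = 0"
  using cmp_scl_right[of 0 undefined Y g Z 0] zero_in_Hom by simp

lemma sum_cmp:
  assumes "f \<in> Hom C X Y" "\<And>j. j \<in> J \<Longrightarrow> g j \<in> Hom C Y Z"
  shows "sum g J \<cdot> f = (\<Sum>j\<in>J. g j \<cdot> f)"
  using assms(2)
proof (induction J rule: infinite_finite_induct)
  case (insert x F)
  then show ?case
    using cmp_add_left[OF assms(1), of "g x" Z "sum g F"] sum_in_Hom[of F g Y Z] by auto
qed (simp_all add: zero_cmp[OF assms(1)])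

lemma cmp_sum:
  assumes "g \<in> Hom C Y Z" "\<And>j. j \<in> J \<Longrightarrow> f j \<in> Hom C X Y"
  shows "g \<cdot> sum f J = (\<Sum>j\<in>J. g \<cdot> f j)"
  using assms(2)
proof (induction J rule: infinite_finite_induct)
  case (insert x F)
  then show ?case
    using cmp_add_right[OF _ _ assms(1), of "f x" X "sum f F"] sum_in_Hom[of F f X Y] by auto
qed (simp_all add: cmp_zero[OF assms(1)])

lemma cmp_diff_right:
  assumes "f \<in> Hom C X Y" "f' \<in> Hom C X Y" "g \<in> Hom C Y Z"
  shows "g \<cdot> (f - f') = g \<cdot> f - g \<cdot> f'"
  using cmp_add_right[OF diff_in_Hom[OF assms(1,2)] assms(2,3)] by (simp add: algebra_simps)

lemma isomorphicI:
  assumes "arr f" "arr g" "src f = X" "trg f = Y" "src g = Y" "trg g = X"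
    "g \<bullet> f = Id X" "f \<bullet> g = Id Y"
  shows "isomorphic X Y"
  unfolding isomorphic_def iso_arr_def is_inverse_def
  using assms arr_def mor_comp mor_Id by metis

lemma isomorphicE:
  assumes "isomorphic X Y"
  obtains f g where "arr f" "arr g" "src f = X" "trg f = Y" "src g = Y" "trg g = X"
    "g \<bullet> f = Id X" "f \<bullet> g = Id Y"
proof -
  obtain f g where "is_inverse X Y f g"
    using assms by (auto simp: isomorphic_def iso_arr_def)
  then show thesis
    by (intro that[of "Arrow X f Y" "Arrow Y g X"]) (auto simp: is_inverse_def comp_def Id_def)
qed

lemma isomorphic_refl [simp]: "isomorphic X X"
  by (rule isomorphicI[of "Id X" "Id X"]) auto

lemma isomorphic_sym: "isomorphic X Y \<Longrightarrow> isomorphic Y X"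
  by (erule isomorphicE, rule isomorphicI) auto

lemma isomorphic_trans:
  assumes "isomorphic X Y" "isomorphic Y Z"
  shows "isomorphic X Z"
proof -
  from assms obtain f g h k where *: "arr f" "arr g" "src f = X" "trg f = Y" "src g = Y" "trg g = X"
    "g \<bullet> f = Id X" "f \<bullet> g = Id Y" "arr h" "arr k" "src h = Y" "trg h = Z" "src k = Z" "trg k = Y"
    "k \<bullet> h = Id Y" "h \<bullet> k = Id Z" by (metis isomorphicE)
  then show ?thesis
    by (intro isomorphicI[of "h \<bullet> f" "g \<bullet> k"])
       (simp_all add: comp_assoc comp_reassoc[of k h] comp_reassoc[of f g])
qed

lemma iso_class_eq: "iso_class X = iso_class Y \<longleftrightarrow> isomorphic X Y"
  unfolding iso_class_def using isomorphic_refl isomorphic_sym isomorphic_trans by blast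

lemma iso_class_mem: "Y \<in> iso_class X \<longleftrightarrow> isomorphic X Y"
  by (simp add: iso_class_def)

lemma direct_sumE:
  assumes "direct_sum X Ys"
  obtains i p where
    "\<And>j. j < length Ys \<Longrightarrow> i j \<in> Hom C (Ys ! j) X" "\<And>j. j < length Ys \<Longrightarrow> p j \<in> Hom C X (Ys ! j)"
    "\<And>j l. j < length Ys \<Longrightarrow> l < length Ys \<Longrightarrow> p j \<cdot> i l = (if j = l then ident C (Ys ! j) else 0)"
    "(\<Sum>j<length Ys. i j \<cdot> p j) = ident C X"
proof -
  from assms[unfolded direct_sum_def] obtain i p where
    "(\<forall>j<length Ys. i j \<in> Hom C (Ys ! j) X \<and> p j \<in> Hom C X (Ys ! j)) \<and>
     (\<forall>j<length Ys. \<forall>l<length Ys. p j \<cdot> i l = (if j = l then ident C (Ys ! j) else 0)) \<and>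
     (\<Sum>j<length Ys. i j \<cdot> p j) = ident C X" by (elim exE)
  then show thesis by (intro that[of i p]) blast+
qed

lemma direct_sum_single: "direct_sum X [Y] \<longleftrightarrow> isomorphic X Y"
proof
  assume "direct_sum X [Y]"
  then show "isomorphic X Y"
    unfolding direct_sum_def isomorphic_def iso_arr_def is_inverse_def by fastforce
next
  assume "isomorphic X Y"
  then obtain p i where "is_inverse X Y p i" by (auto simp: isomorphic_def iso_arr_def)
  then show "direct_sum X [Y]"
    unfolding direct_sum_def is_inverse_def
    by (intro exI[of _ "\<lambda>_. i"] exI[of _ "\<lambda>_. p"]) auto
qed

lemma direct_sum_cong:
  assumes "direct_sum X Ys" "length Zs = length Ys"
    and "\<And>j. j < length Ys \<Longrightarrow> isomorphic (Ys ! j) (Zs ! j)"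
  shows "direct_sum X Zs"
proof -
  from assms(1) obtain i p where ip:
    "\<And>j. j < length Ys \<Longrightarrow> i j \<in> Hom C (Ys ! j) X" "\<And>j. j < length Ys \<Longrightarrow> p j \<in> Hom C X (Ys ! j)"
    "\<And>j l. j < length Ys \<Longrightarrow> l < length Ys \<Longrightarrow> p j \<cdot> i l = (if j = l then ident C (Ys ! j) else 0)"
    "(\<Sum>j<length Ys. i j \<cdot> p j) = ident C X"
    by (elim direct_sumE) blast
  have "\<forall>j. \<exists>u v. j < length Ys \<longrightarrow> is_inverse (Ys ! j) (Zs ! j) u v"
    using assms(3) by (auto simp: isomorphic_def iso_arr_def)
  then obtain u v where uv: "\<And>j. j < length Ys \<Longrightarrow> is_inverse (Ys ! j) (Zs ! j) (u j) (v j)"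
    by metis
  have u: "u j \<in> Hom C (Ys ! j) (Zs ! j)" and v: "v j \<in> Hom C (Zs ! j) (Ys ! j)"
    and vu: "v j \<cdot> u j = ident C (Ys ! j)" and uv': "u j \<cdot> v j = ident C (Zs ! j)"
    if "j < length Ys" for j
    using uv[OF that] unfolding is_inverse_def by blast+
  have A: "(i j \<cdot> v j) \<cdot> (u j \<cdot> p j) = i j \<cdot> p j" if j: "j < length Ys" for j
    using cmp_assoc[OF cmp_in_Hom[OF ip(2) u] v ip(1), OF j j j j]
      cmp_assoc[OF ip(2) u v, OF j j j] vu[OF j] ident_cmp[OF ip(2)[OF j]] by simp
  have B: "(u j \<cdot> p j) \<cdot> (i l \<cdot> v l) = (if j = l then ident C (Zs ! j) else 0)"
    if j: "j < length Ys" and l: "l < length Ys" for j l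
  proof -
    have "(u j \<cdot> p j) \<cdot> (i l \<cdot> v l) = u j \<cdot> ((p j \<cdot> i l) \<cdot> v l)"
      using cmp_assoc[OF cmp_in_Hom[OF v ip(1)] ip(2) u, OF l l j j]
        cmp_assoc[OF v ip(1) ip(2), OF l l j] by simp
    also have "\<dots> = (if j = l then ident C (Zs ! j) else 0)"
      using ip(3)[OF j l] ident_cmp[OF v[OF l]] zero_cmp[OF v[OF l]] cmp_zero[OF u[OF j]] uv'[OF j]
      by (cases "j = l") simp_all
    finally show ?thesis .
  qed
  have "i j \<cdot> v j \<in> Hom C (Zs ! j) X" "u j \<cdot> p j \<in> Hom C X (Zs ! j)" if "j < length Ys" for j
    using cmp_in_Hom[OF v[OF that] ip(1)[OF that]] cmp_in_Hom[OF ip(2)[OF that] u[OF that]] by auto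
  moreover have "(\<Sum>j<length Ys. (i j \<cdot> v j) \<cdot> (u j \<cdot> p j)) = ident C X"
    using ip(4) A by simp
  ultimately show ?thesis
    unfolding direct_sum_def assms(2)
    by (intro exI[of _ "\<lambda>j. i j \<cdot> v j"] exI[of _ "\<lambda>j. u j \<cdot> p j"]) (simp add: B)
qed

lemma direct_sum_component_nonzero:
  assumes "direct_sum X Ys" "f \<in> Hom C W X" "f \<noteq> 0"
  obtains j p where "j < length Ys" "p \<in> Hom C X (Ys ! j)" "p \<cdot> f \<noteq> 0"
proof -
  from assms(1) obtain i p where ip:
    "\<And>j. j < length Ys \<Longrightarrow> i j \<in> Hom C (Ys ! j) X" "\<And>j. j < length Ys \<Longrightarrow> p j \<in> Hom C X (Ys ! j)"
    "(\<Sum>j<length Ys. i j \<cdot> p j) = ident C X"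
    by (elim direct_sumE) blast
  have "f = (\<Sum>j<length Ys. i j \<cdot> p j) \<cdot> f" using assms ip(3) ident_cmp by metis
  also have "\<dots> = (\<Sum>j<length Ys. (i j \<cdot> p j) \<cdot> f)"
    by (intro sum_cmp[OF assms(2), where Z = X]) (simp add: cmp_in_Hom[OF ip(2) ip(1)])
  also have "\<dots> = (\<Sum>j<length Ys. i j \<cdot> (p j \<cdot> f))"
    by (intro sum.cong refl) (simp add: cmp_assoc[OF assms(2) ip(2) ip(1)])
  finally have "\<exists>j<length Ys. i j \<cdot> (p j \<cdot> f) \<noteq> 0"
    using assms(3) by (metis (no_types, lifting) lessThan_iff sum.neutral)
  then obtain j where "j < length Ys" "i j \<cdot> (p j \<cdot> f) \<noteq> 0" by blast
  then show thesis using that[of j "p j"] ip(2)[of j] cmp_zero[OF ip(1)[of j]] by metis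
qed

lemma direct_sum_incl:
  assumes "direct_sum X Ys" "j < length Ys"
  obtains i p where "i \<in> Hom C (Ys ! j) X" "p \<in> Hom C X (Ys ! j)" "p \<cdot> i = ident C (Ys ! j)"
  using assms by (elim direct_sumE) (metis (full_types))

definition peval :: "'o \<Rightarrow> 'm \<Rightarrow> 'k poly \<Rightarrow> 'm" where
  "peval X f q = fold_coeffs (\<lambda>a r. scl C a (ident C X) + f \<cdot> r) q 0"

context
  fixes X f assumes f: "f \<in> Hom C X X"
begin

lemma peval_0 [simp]: "peval X f 0 = 0"
  by (simp add: peval_def)

lemma peval_pCons: "peval X f (pCons a q) = scl C a (ident C X) + f \<cdot> peval X f q"
  by (cases "a = 0 \<and> q = 0") (auto simp: peval_def cmp_zero[OF f])

lemma peval_in_Hom: "peval X f q \<in> Hom C X X"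
  by (induction q) (auto simp: peval_pCons zero_in_Hom
      intro!: add_in_Hom scl_in_Hom ident_in_Hom cmp_in_Hom[OF _ f])

lemma peval_add: "peval X f (p + q) = peval X f p + peval X f q"
proof (induction p q rule: poly_induct2)
  case (pCons a p b q)
  then show ?case
    using cmp_add_right[OF peval_in_Hom peval_in_Hom f, of p q]
    by (simp add: peval_pCons scale_left_distrib algebra_simps)
qed simp

lemma peval_smult: "peval X f (smult c p) = scl C c (peval X f p)"
proof (induction p)
  case (pCons a p)
  then show ?case
    using cmp_scl_right[OF peval_in_Hom f, of c p]
    by (simp add: peval_pCons scale_right_distrib)
qed simp

lemma peval_linear_mult:
  "peval X f ([:- c, 1:] * q) = (f - scl C c (ident C X)) \<cdot> peval X f q"
proof -
  have "(f - scl C c (ident C X)) \<cdot> peval X f q + scl C c (ident C X) \<cdot> peval X f q = f \<cdot> peval X f q"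
    using cmp_add_left[of "peval X f q" X X "f - scl C c (ident C X)" X "scl C c (ident C X)"]
    by (simp add: peval_in_Hom diff_in_Hom f scl_in_Hom ident_in_Hom)
  moreover have "scl C c (ident C X) \<cdot> peval X f q = scl C c (peval X f q)"
    using cmp_scl_left[OF peval_in_Hom ident_in_Hom] ident_cmp[OF peval_in_Hom] by simp
  ultimately show ?thesis
    using peval_add[of "pCons 0 q" "smult (- c) q"] peval_smult[of "- c" q]
    by (simp add: peval_pCons algebra_simps) (metis add_left_cancel)
qed

lemma peval_sum: "peval X f (sum q J) = (\<Sum>j\<in>J. peval X f (q j))"
  by (induction J rule: infinite_finite_induct) (auto simp: peval_add)

lemma peval_annihilator:
  assumes "finite B" "span B = Hom C X X"
  obtains q where "q \<noteq> 0" "peval X f q = 0"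
proof -
  let ?n = "card B"
  let ?w = "\<lambda>i. peval X f (monom 1 i)"
  show thesis
  proof (cases "inj_on ?w {..?n}")
    case True
    have "\<not> independent (?w ` {..?n})"
      using independent_span_bound[OF assms(1), of "?w ` {..?n}"] card_image[OF True]
        peval_in_Hom assms(2) by auto
    then obtain u v where u: "v \<in> ?w ` {..?n}" "u v \<noteq> 0" "(\<Sum>v\<in>?w ` {..?n}. scl C (u v) v) = 0"
      by (auto simp: dependent_finite)
    let ?q = "\<Sum>i\<le>?n. monom (u (?w i)) i"
    have "peval X f ?q = (\<Sum>i\<le>?n. scl C (u (?w i)) (?w i))"
      by (simp add: peval_sum flip: peval_smult) (simp add: smult_monom)
    also have "\<dots> = 0" using u(3) by (simp add: sum.reindex[OF True])
    finally have "peval X f ?q = 0" .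
    moreover from u obtain i where "i \<le> ?n" "u (?w i) \<noteq> 0" by auto
    then have "coeff ?q i \<noteq> 0" by (simp add: coeff_sum)
    then have "?q \<noteq> 0" by auto
    ultimately show thesis using that by blast
  next
    case False
    then obtain i j where ij: "i \<noteq> j" "?w i = ?w j" unfolding inj_on_def by blast
    have "peval X f (monom 1 i + smult (-1) (monom 1 j)) = 0"
      using ij by (simp only: peval_add peval_smult) simp
    moreover have "coeff (monom 1 i + smult (-1) (monom 1 j) :: 'k poly) i \<noteq> coeff 0 i" using ij(1) by simp
    then have "monom 1 i + smult (-1) (monom 1 j) \<noteq> (0 :: 'k poly)" by metis
    ultimately show thesis using that by blast
  qed
qed

end

end

context abelian_linear_category
begin

lemma simple_monic:
  assumes "simple X" "f \<in> Hom C X Y" "f \<noteq> 0"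
  shows "monic X Y f"
proof -
  obtain K k where k: "is_kernel X Y f K k" using kernels[OF assms(2)] by blast
  then have kH: "k \<in> Hom C K X" "f \<cdot> k = 0" by (auto simp: is_kernel_def)
  have "monic K X k"
    unfolding monic_def
  proof (intro conjI kH allI ballI impI)
    fix W g h assume gh: "g \<in> Hom C W K" "h \<in> Hom C W K" "k \<cdot> g = k \<cdot> h"
    have "k \<cdot> h \<in> Hom C W X" "f \<cdot> (k \<cdot> h) = 0"
      using gh kH cmp_in_Hom assms(2) cmp_assoc[OF gh(2) kH(1) assms(2)] zero_cmp by auto
    then have "\<exists>!l. l \<in> Hom C W K \<and> k \<cdot> l = k \<cdot> h"
      using k unfolding is_kernel_def by blast
    then show "g = h" using gh by blast
  qed
  then consider "k = 0" | "iso_arr K X k" using assms(1) unfolding simple_def by blast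
  then have k0: "k = 0"
  proof cases
    case 2
    then obtain l where l: "l \<in> Hom C X K" "k \<cdot> l = ident C X"
      unfolding iso_arr_def is_inverse_def by blast
    have "f = f \<cdot> (k \<cdot> l)" using l assms(2) cmp_ident by simp
    also have "\<dots> = 0" using cmp_assoc[OF l(1) kH(1) assms(2)] kH(2) zero_cmp[OF l(1)] by simp
    finally show ?thesis using assms(3) by simp
  qed
  show ?thesis
    unfolding monic_def
  proof (intro conjI assms allI ballI impI)
    fix W g h assume gh: "g \<in> Hom C W X" "h \<in> Hom C W X" "f \<cdot> g = f \<cdot> h"
    have "f \<cdot> (g - h) = 0" using cmp_diff_right[OF gh(1,2) assms(2)] gh(3) by simp
    then obtain l where "l \<in> Hom C W K" "k \<cdot> l = g - h"
      using k gh diff_in_Hom unfolding is_kernel_def by meson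
    then show "g = h" using k0 zero_cmp by simp
  qed
qed

lemma schur_iso:
  assumes "simple X" "simple Y" "f \<in> Hom C X Y" "f \<noteq> 0"
  shows "iso_arr X Y f"
  using simple_monic[OF assms(1,3,4)] assms(2,4) unfolding simple_def by blast

lemma schur_isomorphic:
  assumes "simple X" "simple Y" "f \<in> Hom C X Y" "f \<noteq> 0"
  shows "isomorphic X Y"
  using schur_iso[OF assms] isomorphic_def by blast

lemma simple_isomorphic:
  assumes "simple X" "isomorphic X Y"
  shows "simple Y"
  unfolding simple_def
proof (intro conjI allI impI)
  obtain u v where uv: "u \<in> Hom C X Y" "v \<in> Hom C Y X" "v \<cdot> u = ident C X" "u \<cdot> v = ident C Y"
    using assms(2) unfolding isomorphic_def iso_arr_def is_inverse_def by blast
  show "ident C Y \<noteq> 0"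
  proof
    assume "ident C Y = 0"
    then have "v = 0" using cmp_ident[OF uv(2)] cmp_zero[OF uv(2)] by simp
    then show False using uv(1,3) zero_cmp assms(1) simple_def by metis
  qed
  fix Z f assume m: "monic Z Y f"
  then have f: "f \<in> Hom C Z Y" by (simp add: monic_def)
  have *: "u \<cdot> (v \<cdot> f \<cdot> g) = f \<cdot> g" if "g \<in> Hom C W Z" for W g
    using cmp_assoc[OF that f uv(2)] cmp_assoc[OF cmp_in_Hom[OF that f] uv(2,1)]
      ident_cmp[OF cmp_in_Hom[OF that f]] uv(4) by simp
  have "monic Z X (v \<cdot> f)"
    unfolding monic_def
  proof (intro conjI allI ballI impI)
    fix W g h assume gh: "g \<in> Hom C W Z" "h \<in> Hom C W Z" "v \<cdot> f \<cdot> g = v \<cdot> f \<cdot> h"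
    have "f \<cdot> g = f \<cdot> h" using *[OF gh(1)] *[OF gh(2)] gh(3) by simp
    then show "g = h" using m gh unfolding monic_def by blast
  qed (use uv f cmp_in_Hom in blast)
  then consider "v \<cdot> f = 0" | "iso_arr Z X (v \<cdot> f)" using assms(1) unfolding simple_def by blast
  then show "f = 0 \<or> iso_arr Z Y f"
  proof cases
    case 1
    have "f = u \<cdot> (v \<cdot> f)"
      using cmp_assoc[OF f uv(2,1)] uv(4) ident_cmp[OF f] by simp
    then show ?thesis using 1 cmp_zero[OF uv(1)] by simp
  next
    case 2
    then obtain w where w: "w \<in> Hom C X Z" "w \<cdot> (v \<cdot> f) = ident C Z" "(v \<cdot> f) \<cdot> w = ident C X"
      unfolding iso_arr_def is_inverse_def by blast
    have "is_inverse Z Y f (w \<cdot> v)"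
      unfolding is_inverse_def
    proof (intro conjI f)
      show "w \<cdot> v \<in> Hom C Y Z" using w uv cmp_in_Hom by blast
      show "w \<cdot> v \<cdot> f = ident C Z" using w(2) cmp_assoc[OF f uv(2) w(1)] by simp
      have "f \<cdot> w = u \<cdot> (v \<cdot> f \<cdot> w)" using *[OF w(1)] by simp
      also have "\<dots> = u" using w(3) uv cmp_ident by simp
      finally show "f \<cdot> (w \<cdot> v) = ident C Y" using cmp_assoc[OF uv(2) w(1) f] uv(4) by simp
    qed
    then show ?thesis unfolding iso_arr_def by blast
  qed
qed

lemma split_mono_simple:
  assumes "simple X" "i \<in> Hom C Y X" "p \<in> Hom C X Y" "p \<cdot> i = ident C Y" "ident C Y \<noteq> 0"
  shows "isomorphic Y X"
proof -
  have "monic Y X i"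
    unfolding monic_def
  proof (intro conjI assms(2) allI ballI impI)
    fix W g h assume gh: "g \<in> Hom C W Y" "h \<in> Hom C W Y" "i \<cdot> g = i \<cdot> h"
    have "g = p \<cdot> (i \<cdot> g)" using cmp_assoc[OF gh(1) assms(2,3)] assms(4) ident_cmp[OF gh(1)] by simp
    also have "\<dots> = h" using gh(3) cmp_assoc[OF gh(2) assms(2,3)] assms(4) ident_cmp[OF gh(2)] by simp
    finally show "g = h" .
  qed
  moreover have "i \<noteq> 0" using assms(4,5) cmp_zero[OF assms(3)] by metis
  ultimately show ?thesis using assms(1) unfolding simple_def isomorphic_def by blast
qed

end

context fusion_category
begin

lemma End_simple:
  assumes "simple X" "f \<in> Hom C X X"
  obtains c where "f = scl C c (ident C X)"
proof -
  have "\<exists>c. f = scl C c (ident C X)"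
  proof (rule ccontr)
    assume no: "\<nexists>c. f = scl C c (ident C X)"
    have iso: "q = 0" if "q \<in> Hom C X X" "(f - scl C c (ident C X)) \<cdot> q = 0" for c q
    proof -
      have g: "f - scl C c (ident C X) \<in> Hom C X X"
        using assms(2) scl_in_Hom[OF ident_in_Hom] diff_in_Hom by blast
      moreover have "f - scl C c (ident C X) \<noteq> 0" using no by auto
      ultimately have "monic X X (f - scl C c (ident C X))" by (rule simple_monic[OF assms(1)])
      then show "q = 0"
        using that zero_in_Hom[of X X] cmp_zero[OF g] unfolding monic_def by metis
    qed
    obtain B where "finite B" "span B = Hom C X X" using finite_dim_Hom by blast
    then obtain q where q: "q \<noteq> 0" "peval X f q = 0"
      using peval_annihilator[OF assms(2)] by blast
    then show False
    proof (induction "degree q" arbitrary: q rule: less_induct)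
      case less
      show False
      proof (cases "degree q = 0")
        case True
        then obtain a where a: "q = [:a:]" using degree_eq_zeroE by blast
        then have "scl C a (ident C X) = 0"
          using less.prems by (simp add: peval_pCons[OF assms(2)] peval_0[OF assms(2)] cmp_zero[OF assms(2)])
        moreover have "ident C X \<noteq> 0" using assms(1) by (simp add: simple_def)
        ultimately show False using a less.prems(1) by simp
      next
        case False
        then obtain c where "poly q c = 0" using alg_closed_imp_poly_has_root by blast
        then obtain r where r: "q = [:- c, 1:] * r" by (metis poly_eq_0_iff_dvd dvdE)
        then have "r \<noteq> 0" using less.prems(1) by auto
        have "degree q = Suc (degree r)" unfolding r using \<open>r \<noteq> 0\<close> by (subst degree_mult_eq) auto
        moreover have "peval X f r = 0"
          using iso[OF peval_in_Hom[OF assms(2)]] less.prems(2) r peval_linear_mult[OF assms(2)] by metis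
        ultimately show False using less.hyps[of r] \<open>r \<noteq> 0\<close> by simp
      qed
    qed
  qed
  then show thesis using that by blast
qed

lemma Hom_simple:
  assumes "simple X" "f \<in> Hom C X Y" "iso_arr X Y u"
  obtains c where "f = scl C c u"
proof -
  obtain v where v: "v \<in> Hom C Y X" "u \<cdot> v = ident C Y" "u \<in> Hom C X Y"
    using assms(3) unfolding iso_arr_def is_inverse_def by blast
  obtain c where c: "v \<cdot> f = scl C c (ident C X)"
    using End_simple[OF assms(1) cmp_in_Hom[OF assms(2) v(1)]] by blast
  have "f = u \<cdot> (v \<cdot> f)" using cmp_assoc[OF assms(2) v(1,3)] v(2) ident_cmp[OF assms(2)] by simp
  also have "\<dots> = scl C c u" using c cmp_scl_right[OF ident_in_Hom v(3)] cmp_ident[OF v(3)] by simp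
  finally show thesis using that by blast
qed

lemma dim_Hom_simple:
  assumes "simple X" "simple Y"
  shows "dim (Hom C X Y) = (if isomorphic X Y then 1 else 0)"
proof (cases "isomorphic X Y")
  case True
  then obtain u where u: "iso_arr X Y u" by (auto simp: isomorphic_def)
  then obtain v where v: "u \<in> Hom C X Y" "v \<in> Hom C Y X" "v \<cdot> u = ident C X"
    unfolding iso_arr_def is_inverse_def by blast
  then have u0: "u \<noteq> 0" using assms(1) cmp_zero[OF v(2)] by (auto simp: simple_def)
  have "Hom C X Y = span {u}"
  proof
    show "Hom C X Y \<subseteq> span {u}"
      using Hom_simple[OF assms(1) _ u] by (metis insertI1 span_base span_scale subsetI)
    show "span {u} \<subseteq> Hom C X Y" using v(1) subspace_Hom by (simp add: span_minimal)
  qed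
  then show ?thesis using True u0 by (simp add: dim_eq_card_independent)
next
  case False
  then have "Hom C X Y = {0}"
    using schur_isomorphic[OF assms] zero_in_Hom by blast
  then have "Hom C X Y \<subseteq> span {}" by simp
  then have "dim (Hom C X Y) \<le> card ({} :: 'm set)" by (rule dim_le_card) simp
  then show ?thesis using False by simp
qed

end

context linear_monoidal_category
begin

lemma zero_tensor: "g \<in> Hom C X Y \<Longrightarrow> 0 \<star> g = 0"
  using tensor_scl_left[of 0 undefined undefined g X Y 0] zero_in_Hom by simp

lemma tensor_zero: "f \<in> Hom C X Y \<Longrightarrow> f \<star> 0 = 0"
  using tensor_scl_right[of f X Y 0 undefined undefined 0] zero_in_Hom by simp

lemma sum_tensor:
  assumes "g \<in> Hom C X' Y'" "\<And>j. j \<in> J \<Longrightarrow> f j \<in> Hom C X Y"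
  shows "sum f J \<star> g = (\<Sum>j\<in>J. f j \<star> g)"
  using assms(2)
proof (induction J rule: infinite_finite_induct)
  case (insert x F)
  then show ?case
    using tensor_add_left[OF _ _ assms(1), of "f x" X Y "sum f F"] sum_in_Hom[of F f X Y] by auto
qed (simp_all add: zero_tensor[OF assms(1)])

lemma tensor_sum:
  assumes "f \<in> Hom C X Y" "\<And>j. j \<in> J \<Longrightarrow> g j \<in> Hom C X' Y'"
  shows "f \<star> sum g J = (\<Sum>j\<in>J. f \<star> g j)"
  using assms(2)
proof (induction J rule: infinite_finite_induct)
  case (insert x F)
  then show ?case
    using tensor_add_right[OF assms(1), of "g x" X' Y' "sum g F"] sum_in_Hom[of F g X' Y'] by auto
qed (simp_all add: tensor_zero[OF assms(1)])

lemma direct_sum_tensorE: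
  assumes "direct_sum X Xs"
  obtains i p where
    "\<And>j. j < length Xs \<Longrightarrow> i j \<in> Hom C (Xs ! j) X" "\<And>j. j < length Xs \<Longrightarrow> p j \<in> Hom C X (Xs ! j)"
    "\<And>j l. j < length Xs \<Longrightarrow> l < length Xs \<Longrightarrow>
      (ident C Z \<star> p j) \<cdot> (ident C Z \<star> i l) = (if j = l then ident C (Z \<odot> Xs ! j) else 0)"
    "(\<Sum>j<length Xs. (ident C Z \<star> i j) \<cdot> (ident C Z \<star> p j)) = ident C (Z \<odot> X)"
proof -
  from assms obtain i p where i: "\<And>j. j < length Xs \<Longrightarrow> i j \<in> Hom C (Xs ! j) X"
    and p: "\<And>j. j < length Xs \<Longrightarrow> p j \<in> Hom C X (Xs ! j)"
    and pi: "\<And>j l. j < length Xs \<Longrightarrow> l < length Xs \<Longrightarrow> p j \<cdot> i l = (if j = l then ident C (Xs ! j) else 0)"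
    and s: "(\<Sum>j<length Xs. i j \<cdot> p j) = ident C X"
    by (elim direct_sumE) blast
  note I = ident_in_Hom[of Z] and II = cmp_ident[OF ident_in_Hom[of Z]]
  have "(\<Sum>j<length Xs. (ident C Z \<star> i j) \<cdot> (ident C Z \<star> p j)) = (\<Sum>j<length Xs. ident C Z \<star> (i j \<cdot> p j))"
    by (intro sum.cong refl) (simp add: tensor_cmp[OF I I p i, symmetric] II)
  also have "\<dots> = ident C (Z \<odot> X)"
    using tensor_sum[OF I, of "{..<length Xs}" "\<lambda>j. i j \<cdot> p j" X X] cmp_in_Hom[OF p i]
    by (simp add: s tensor_ident)
  finally show thesis
    by (intro that[of i p] i p)
       (auto simp: tensor_cmp[OF I I i p, symmetric] II pi tensor_ident tensor_zero[OF I])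
qed

lemma direct_sum_tensor:
  assumes "direct_sum X Xs"
  shows "direct_sum (Z \<odot> X) (map (\<lambda>Y. Z \<odot> Y) Xs)"
proof -
  obtain i p where i: "\<And>j. j < length Xs \<Longrightarrow> i j \<in> Hom C (Xs ! j) X"
    and p: "\<And>j. j < length Xs \<Longrightarrow> p j \<in> Hom C X (Xs ! j)"
    and "\<And>j l. j < length Xs \<Longrightarrow> l < length Xs \<Longrightarrow>
      (ident C Z \<star> p j) \<cdot> (ident C Z \<star> i l) = (if j = l then ident C (Z \<odot> Xs ! j) else 0)"
    and "(\<Sum>j<length Xs. (ident C Z \<star> i j) \<cdot> (ident C Z \<star> p j)) = ident C (Z \<odot> X)"
    using direct_sum_tensorE[OF assms, of Z] by blast
  then show ?thesis
    unfolding direct_sum_def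
    by (intro exI[of _ "\<lambda>j. ident C Z \<star> i j"] exI[of _ "\<lambda>j. ident C Z \<star> p j"])
       (simp add: tensor_in_Hom[OF ident_in_Hom i] tensor_in_Hom[OF ident_in_Hom p])
qed

lemma isomorphic_tensor:
  assumes "isomorphic X X'" "isomorphic Y Y'"
  shows "isomorphic (X \<odot> Y) (X' \<odot> Y')"
proof -
  from assms obtain f g h k where "arr f" "arr g" "src f = X" "trg f = X'" "src g = X'" "trg g = X"
    "g \<bullet> f = Id X" "f \<bullet> g = Id X'" "arr h" "arr k" "src h = Y" "trg h = Y'" "src k = Y'" "trg k = Y"
    "k \<bullet> h = Id Y" "h \<bullet> k = Id Y'" by (metis isomorphicE)
  then show ?thesis
    by (intro isomorphicI[of "f ** h" "g ** k"]) (simp_all add: tens_comp_tens)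
qed

lemma isomorphic_assoc: "isomorphic ((X \<odot> Y) \<odot> Z) (X \<odot> (Y \<odot> Z))"
  by (rule isomorphicI[of "\<alpha> X Y Z" "\<alpha>' X Y Z"]) auto

lemma isomorphic_left_unit: "isomorphic (\<I> \<odot> X) X"
  by (rule isomorphicI[of "lu X" "lu' X"]) auto

lemma isomorphic_right_unit: "isomorphic (X \<odot> \<I>) X"
  by (rule isomorphicI[of "ru X" "ru' X"]) auto

lemma mor_zero_simps:
  "arr g \<Longrightarrow> mor f = 0 \<Longrightarrow> mor (g \<bullet> f) = 0" "arr g \<Longrightarrow> mor f = 0 \<Longrightarrow> mor (f \<bullet> g) = 0"
  "arr g \<Longrightarrow> mor f = 0 \<Longrightarrow> mor (f ** g) = 0" "arr g \<Longrightarrow> mor f = 0 \<Longrightarrow> mor (g ** f) = 0"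
  unfolding arr_def mor_comp mor_tens using cmp_zero zero_cmp zero_tensor tensor_zero by metis+

lemma ident_zero_isomorphic:
  assumes "isomorphic X Y" "ident C Y = 0"
  shows "ident C X = 0"
proof -
  obtain u v where uv: "u \<in> Hom C X Y" "v \<in> Hom C Y X" "v \<cdot> u = ident C X"
    using assms(1) unfolding isomorphic_def iso_arr_def is_inverse_def by blast
  have "u = 0" using ident_cmp[OF uv(1)] zero_cmp[OF uv(1)] assms(2) by simp
  then show ?thesis using uv(3) cmp_zero[OF uv(2)] by simp
qed

end

context fusion_category
begin

lemma Mate_Ev:
  assumes "arr m" "trg m = D B"
  shows "Mate (src m) B (Ev B \<bullet> (m ** Id B)) = m"
proof -
  have "Mate (src m) B (Ev B \<bullet> (m ** Id B))
      = lu (D B) \<bullet> (Ev B ** Id (D B)) \<bullet> ((m ** Id B) ** Id (D B)) \<bullet> eta B (src m)"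
    using assms by (simp add: Mate_def tens_Id_comp comp_assoc)
  also have "\<dots> = (lu (D B) \<bullet> (Ev B ** Id (D B)) \<bullet> eta B (D B)) \<bullet> m"
    using assms cup_natural[of m "Coev B" B "D B"] by (simp add: comp_assoc)
  also have "lu (D B) \<bullet> (Ev B ** Id (D B)) \<bullet> eta B (D B)
      = (lu (D B) \<bullet> (Ev B ** Id (D B)) \<bullet> \<alpha>' (D B) B (D B) \<bullet> (Id (D B) ** Coev B)) \<bullet> ru' (D B)"
    by (simp add: cup_def comp_assoc)
  also have "\<dots> = Id (D B)" by (simp add: zigzag2)
  finally show ?thesis using assms by simp
qed

lemma mate_unique:
  assumes "arr m" "arr m'" "src m = src m'" "trg m = D B" "trg m' = D B"
    "Ev B \<bullet> (m ** Id B) = Ev B \<bullet> (m' ** Id B)"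
  shows "m = m'"
  using Mate_Ev[OF assms(1,4)] Mate_Ev[OF assms(2,5)] assms(3,6) by metis

lemma dm_comp:
  assumes "arr f" "arr g" "src g = trg f"
  shows "dm (g \<bullet> f) = dm f \<bullet> dm g"
proof (rule mate_unique[of _ _ "src f"])
  let ?X = "src f" and ?Y = "trg f" and ?Z = "trg g"
  have "Ev ?X \<bullet> ((dm f \<bullet> dm g) ** Id ?X) = Ev ?Y \<bullet> (Id (D ?Y) ** f) \<bullet> (dm g ** Id ?X)"
    using assms comp_reassoc[OF Ev_dm[of f]] by (simp add: tens_Id_comp comp_assoc)
  also have "\<dots> = Ev ?Y \<bullet> (dm g ** Id ?Y) \<bullet> (Id (D ?Z) ** f)"
    using assms slide[of "dm g" f] by simp
  also have "\<dots> = Ev ?Z \<bullet> (Id (D ?Z) ** g) \<bullet> (Id (D ?Z) ** f)"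
    using assms comp_reassoc[OF Ev_dm[of g]] by (simp add: comp_assoc)
  also have "\<dots> = Ev ?X \<bullet> (dm (g \<bullet> f) ** Id ?X)"
    using assms Ev_dm[of "g \<bullet> f"] by (simp add: Id_tens_comp)
  finally show "Ev ?X \<bullet> (dm (g \<bullet> f) ** Id ?X) = Ev ?X \<bullet> ((dm f \<bullet> dm g) ** Id ?X)" by simp
qed (use assms in auto)

lemma dm_Id [simp]: "dm (Id X) = Id (D X)"
  by (rule mate_unique[of _ _ X]) (use Ev_dm[of "Id X"] in auto)

lemma dm_injective:
  assumes "dm f = dm g" "arr f" "arr g" "src f = src g" "trg f = trg g"
  shows "f = g"
proof -
  have *: "eps (src f) (trg f) \<bullet> (((Id (trg f) ** dm f) \<bullet> Coev (trg f)) ** Id (src f)) = f \<bullet> lu (src f)"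
    if "arr f" for f
    using that comp_reassoc[OF cap_natural[of f "Ev (src f)" "D (src f)" "src f"]]
    by (simp add: Coev_dm[symmetric] tens_Id_comp comp_assoc eps_Coev)
  have "f \<bullet> lu (src f) = g \<bullet> lu (src f)"
    using *[OF assms(2)] *[OF assms(3)] assms by metis
  then show ?thesis by (rule cancel_right[OF _ lulu']) (use assms in auto)
qed

lemma dual_mor_in_Hom: "f \<in> Hom C X Y \<Longrightarrow> dual_mor X Y f \<in> Hom C (D Y) (D X)"
  using dm_simps[of "Arrow X f Y"] mor_dm[of "Arrow X f Y"] unfolding arr_def by auto

lemma dual_mor_cmp:
  assumes "f \<in> Hom C X Y" "g \<in> Hom C Y Z"
  shows "dual_mor X Z (g \<cdot> f) = dual_mor X Y f \<cdot> dual_mor Y Z g"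
  using arg_cong[OF dm_comp[of "Arrow X f Y" "Arrow Y g Z"], of mor] assms
  by (simp add: mor_comp mor_dm cmp_in_Hom)

lemma dual_mor_ident: "dual_mor X X (ident C X) = ident C (D X)"
  using mor_dm[of "Id X"] by (simp add: mor_Id)

lemma ev_dual_mor:
  assumes "f \<in> Hom C X Y"
  shows "ev C X \<cdot> (dual_mor X Y f \<star> ident C X) = ev C Y \<cdot> (ident C (D Y) \<star> f)"
  using arg_cong[OF Ev_dm[of "Arrow X f Y"], of mor] assms
  by (simp add: mor_comp mor_tens mor_dm mor_Id Ev_def)

lemma ev_in_Hom: "ev C X \<in> Hom C (D X \<odot> X) \<I>"
  using left_dual by (simp add: is_left_dual_def)

lemma ev_tensor_injective:
  assumes "m \<in> Hom C A (D B)" "m' \<in> Hom C A (D B)"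
    "ev C B \<cdot> (m \<star> ident C B) = ev C B \<cdot> (m' \<star> ident C B)"
  shows "m = m'"
proof -
  have "Arrow A m (D B) = Arrow A m' (D B)"
    by (rule mate_unique[of _ _ B]) (use assms in \<open>auto simp: comp_def tens_def Ev_def Id_def\<close>)
  then show ?thesis by simp
qed

lemma dual_mor_zero: "dual_mor X Y 0 = 0"
proof (rule ev_tensor_injective)
  show "ev C X \<cdot> (dual_mor X Y 0 \<star> ident C X) = ev C X \<cdot> (0 \<star> ident C X)"
    unfolding ev_dual_mor[OF zero_in_Hom] tensor_zero[OF ident_in_Hom] zero_tensor[OF ident_in_Hom]
      cmp_zero[OF ev_in_Hom] ..
qed (auto intro: dual_mor_in_Hom zero_in_Hom)

lemma direct_sum_dual:
  assumes "direct_sum X Xs"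
  shows "direct_sum (D X) (map D Xs)"
proof -
  from assms obtain i p where i: "\<And>j. j < length Xs \<Longrightarrow> i j \<in> Hom C (Xs ! j) X"
    and p: "\<And>j. j < length Xs \<Longrightarrow> p j \<in> Hom C X (Xs ! j)"
    and pi: "\<And>j l. j < length Xs \<Longrightarrow> l < length Xs \<Longrightarrow> p j \<cdot> i l = (if j = l then ident C (Xs ! j) else 0)"
    and s: "(\<Sum>j<length Xs. i j \<cdot> p j) = ident C X"
    by (elim direct_sumE) blast
  let ?i = "\<lambda>j. dual_mor X (Xs ! j) (p j)" and ?p = "\<lambda>j. dual_mor (Xs ! j) X (i j)"
  let ?J = "{..<length Xs}"
  have ip: "i j \<cdot> p j \<in> Hom C X X" if "j < length Xs" for j
    using cmp_in_Hom[OF p i] that by blast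
  have ipd: "dual_mor X X (i j \<cdot> p j) \<in> Hom C (D X) (D X)" if "j < length Xs" for j
    using dual_mor_in_Hom[OF ip[OF that]] .
  have "(\<Sum>j\<in>?J. ?i j \<cdot> ?p j) = (\<Sum>j\<in>?J. dual_mor X X (i j \<cdot> p j))"
    by (intro sum.cong refl) (simp add: dual_mor_cmp[OF p i])
  also have "\<dots> = ident C (D X)"
  proof (rule ev_tensor_injective)
    have "ev C X \<cdot> ((\<Sum>j\<in>?J. dual_mor X X (i j \<cdot> p j)) \<star> ident C X)
        = ev C X \<cdot> (\<Sum>j\<in>?J. dual_mor X X (i j \<cdot> p j) \<star> ident C X)"
      by (subst sum_tensor[OF ident_in_Hom, where X = "D X" and Y = "D X"]) (use ipd in auto)
    also have "\<dots> = (\<Sum>j\<in>?J. ev C X \<cdot> (dual_mor X X (i j \<cdot> p j) \<star> ident C X))"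
      by (rule cmp_sum[OF ev_in_Hom, where X = "D X \<odot> X"]) (simp add: tensor_in_Hom[OF ipd ident_in_Hom])
    also have "\<dots> = (\<Sum>j\<in>?J. ev C X \<cdot> (ident C (D X) \<star> (i j \<cdot> p j)))"
      by (intro sum.cong refl) (simp add: ev_dual_mor[OF ip])
    also have "\<dots> = ev C X \<cdot> (\<Sum>j\<in>?J. ident C (D X) \<star> (i j \<cdot> p j))"
      by (rule cmp_sum[OF ev_in_Hom, where X = "D X \<odot> X", symmetric])
         (simp add: tensor_in_Hom[OF ident_in_Hom ip])
    also have "\<dots> = ev C X \<cdot> (ident C (D X) \<star> ident C X)"
      by (subst tensor_sum[OF ident_in_Hom, where X' = X and Y' = X, symmetric]) (use ip s in auto)
    finally show "ev C X \<cdot> ((\<Sum>j\<in>?J. dual_mor X X (i j \<cdot> p j)) \<star> ident C X)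
        = ev C X \<cdot> (ident C (D X) \<star> ident C X)" .
  qed (auto intro: sum_in_Hom ipd ident_in_Hom)
  finally have S: "(\<Sum>j\<in>?J. ?i j \<cdot> ?p j) = ident C (D X)" .
  show ?thesis
    unfolding direct_sum_def
    by (intro exI[of _ ?i] exI[of _ ?p])
       (auto simp: S dual_mor_in_Hom[OF i] dual_mor_in_Hom[OF p] dual_mor_cmp[OF i p, symmetric] pi
         dual_mor_ident dual_mor_zero)
qed

lemma Hom_tensor_nonzero:
  assumes "f \<in> Hom C (A \<odot> B) W" "f \<noteq> 0"
  obtains g where "g \<in> Hom C A (W \<odot> D B)" "g \<noteq> 0"
proof -
  let ?F = "Arrow (A \<odot> B) f W"
  let ?G = "(?F ** Id (D B)) \<bullet> eta B A"
  have "eps B W \<bullet> (?G ** Id B) = ?F \<bullet> eps B (A \<odot> B) \<bullet> (eta B A ** Id B)"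
    using assms comp_reassoc[OF cap_natural[of ?F "Ev B" "D B" B]]
    by (simp add: tens_Id_comp comp_assoc)
  also have "\<dots> = ?F" using assms by (simp add: eps_eta)
  finally have *: "eps B W \<bullet> (?G ** Id B) = ?F" .
  have "mor ?G \<noteq> 0"
  proof
    assume "mor ?G = 0"
    then have "mor (eps B W \<bullet> (?G ** Id B)) = 0" by (simp add: mor_zero_simps)
    then show False using * assms(2) by simp
  qed
  moreover have "arr ?G" using assms(1) by simp
  ultimately show thesis using that[of "mor ?G"] unfolding arr_def by simp
qed

lemma fusion_subcategory_isomorphic:
  "fusion_subcategory K \<Longrightarrow> X \<in> K \<Longrightarrow> isomorphic X Y \<Longrightarrow> Y \<in> K"
  using direct_sum_single[of Y X] isomorphic_sym unfolding fusion_subcategory_def by fastforce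

lemma fusion_subcategory_summand:
  assumes "fusion_subcategory K" "X \<in> K" "simple W" "f \<in> Hom C W X" "f \<noteq> 0"
  shows "W \<in> K"
proof -
  obtain Ys where Ys: "\<forall>Y\<in>set Ys. simple Y" "direct_sum X Ys" using semisimple by blast
  obtain j p where j: "j < length Ys" "p \<in> Hom C X (Ys ! j)" "p \<cdot> f \<noteq> 0"
    using direct_sum_component_nonzero[OF Ys(2) assms(4,5)] .
  have "isomorphic W (Ys ! j)"
    using schur_isomorphic[OF assms(3) _ cmp_in_Hom[OF assms(4) j(2)] j(3)] Ys(1) j(1) by simp
  moreover have "Ys ! j \<in> K"
    using assms(1,2) Ys(2) j(1) unfolding fusion_subcategory_def by (metis nth_mem subsetD)
  ultimately show ?thesis
    using fusion_subcategory_isomorphic[OF assms(1)] isomorphic_sym by blast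
qed

lemma fusion_subcategory_adjoint: "fusion_subcategory adjoint_subcategory"
  unfolding adjoint_subcategory_def fusion_subcategory_def by blast

lemma tensor_dual_in_adjoint: "simple X \<Longrightarrow> X \<odot> D X \<in> adjoint_subcategory"
  unfolding adjoint_subcategory_def by blast

lemma invertible_simple:
  assumes "isomorphic (X \<odot> Y) \<I>" "isomorphic (Y \<odot> X) \<I>"
  shows "simple X"
proof -
  obtain Xs where Xs: "\<forall>Y\<in>set Xs. simple Y" "direct_sum X Xs" using semisimple by blast
  have zero: "ident C (V \<odot> W) = 0" if "ident C W = 0" for V W
    using that tensor_ident[of V W] tensor_zero[OF ident_in_Hom] by metis
  have YX: "simple (Y \<odot> X)" by (rule simple_isomorphic[OF unit_simple isomorphic_sym[OF assms(2)]])
  then have "ident C X \<noteq> 0" using zero by (auto simp: simple_def)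
  then have n: "0 < length Xs"
    using Xs(2) unfolding direct_sum_def by (cases "length Xs") auto
  let ?Z = "Xs ! 0"
  have Z: "simple ?Z" using Xs(1) n by simp
  have ret: "isomorphic (X \<odot> (Y \<odot> ?Z)) ?Z"
    using isomorphic_trans[OF isomorphic_sym[OF isomorphic_assoc]
      isomorphic_trans[OF isomorphic_tensor[OF assms(1) isomorphic_refl] isomorphic_left_unit]] .
  have YZ: "ident C (Y \<odot> ?Z) \<noteq> 0"
    using zero[of "Y \<odot> ?Z" X] ident_zero_isomorphic[OF isomorphic_sym[OF ret]] Z by (auto simp: simple_def)
  obtain i p where "i \<in> Hom C (Y \<odot> ?Z) (Y \<odot> X)" "p \<in> Hom C (Y \<odot> X) (Y \<odot> ?Z)" "p \<cdot> i = ident C (Y \<odot> ?Z)"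
    using direct_sum_incl[OF direct_sum_tensor[OF Xs(2)], of 0 Y] n by auto
  then have "isomorphic (Y \<odot> ?Z) \<I>"
    using split_mono_simple[OF YX _ _ _ YZ] isomorphic_trans[OF _ assms(2)] by blast
  then have "isomorphic (X \<odot> (Y \<odot> ?Z)) X"
    using isomorphic_trans[OF isomorphic_tensor[OF isomorphic_refl] isomorphic_right_unit] by blast
  then show ?thesis
    using simple_isomorphic[OF Z] isomorphic_trans[OF isomorphic_sym[OF ret]] by blast
qed

lemma ident_dual_nonzero:
  assumes "ident C X \<noteq> 0"
  shows "ident C (D X) \<noteq> 0"
proof
  assume z: "ident C (D X) = 0"
  have "mor (Ev X) = mor (Ev X \<bullet> (Id (D X) ** Id X))" by simp
  also have "\<dots> = 0" using z by (simp add: mor_zero_simps mor_Id del: Id_tens_Id)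
  finally have "mor (ru X \<bullet> (Id X ** Ev X) \<bullet> \<alpha> X (D X) X \<bullet> (Coev X ** Id X)) = 0"
    by (simp add: mor_zero_simps)
  then have "mor (lu X \<bullet> lu' X) = 0" by (simp add: zigzag1 mor_zero_simps del: lulu')
  then show False using assms by (simp add: mor_Id)
qed

lemma isomorphic_dual: "isomorphic X Y \<Longrightarrow> isomorphic (D X) (D Y)"
  using direct_sum_dual[of X "[Y]"] by (simp add: direct_sum_single)

end

context pivotal_fusion_category
begin

lemma iso_Piv: "iso (Piv X)"
  by (simp add: iso_def Piv_def piv_iso)

lemma isomorphic_bidual: "isomorphic X (D (D X))"
  using piv_iso isomorphic_def by blast

lemma simple_dual:
  assumes "simple X"
  shows "simple (D X)"
proof -
  obtain Ys where Ys: "\<forall>Y\<in>set Ys. simple Y" "direct_sum (D X) Ys" using semisimple by blast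
  have "ident C (D X) \<noteq> 0" using assms ident_dual_nonzero by (simp add: simple_def)
  then have n: "0 < length Ys"
    using Ys(2) unfolding direct_sum_def by (cases "length Ys") auto
  let ?Y = "Ys ! 0"
  have Y: "simple ?Y" using Ys(1) n by simp
  obtain i p where "i \<in> Hom C (D ?Y) (D (D X))" "p \<in> Hom C (D (D X)) (D ?Y)" "p \<cdot> i = ident C (D ?Y)"
    using direct_sum_incl[OF direct_sum_dual[OF Ys(2)], of 0] n by auto
  moreover have "ident C (D ?Y) \<noteq> 0" using Y ident_dual_nonzero by (simp add: simple_def)
  ultimately have "isomorphic (D ?Y) X"
    using split_mono_simple[OF simple_isomorphic[OF assms isomorphic_bidual]]
      isomorphic_trans[OF _ isomorphic_sym[OF isomorphic_bidual]] by blast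
  then have "isomorphic ?Y (D X)"
    using isomorphic_trans[OF isomorphic_bidual isomorphic_dual] by blast
  then show ?thesis using simple_isomorphic[OF Y] by blast
qed

lemma isomorphic_dual_unit: "isomorphic (D \<I>) \<I>"
proof -
  have "Ev \<I> \<bullet> ru' (D \<I>) \<bullet> ru (D \<I>) = Ev \<I>" by simp
  moreover have "mor (Ev \<I>) \<noteq> 0"
  proof
    assume "mor (Ev \<I>) = 0"
    then have "mor (ru \<I> \<bullet> (Id \<I> ** Ev \<I>) \<bullet> \<alpha> \<I> (D \<I>) \<I> \<bullet> (Coev \<I> ** Id \<I>)) = 0"
      by (simp add: mor_zero_simps)
    then have "mor (lu \<I> \<bullet> lu' \<I>) = 0" by (simp add: zigzag1 mor_zero_simps del: lulu')
    then show False using unit_simple by (simp add: mor_Id simple_def)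
  qed
  ultimately have "mor (Ev \<I> \<bullet> ru' (D \<I>)) \<noteq> 0"
    using mor_zero_simps(2)[of "ru (D \<I>)" "Ev \<I> \<bullet> ru' (D \<I>)"] by (auto simp: comp_assoc)
  moreover have "arr (Ev \<I> \<bullet> ru' (D \<I>))" by simp
  ultimately show ?thesis
    using schur_isomorphic[OF simple_dual[OF unit_simple] unit_simple] unfolding arr_def by simp
qed

text \<open>The canonical morphism \<open>du\<close> has a right inverse by the zigzag identity for the nested
  pairing; applying the same to duals and using that the pivotal structure is monoidal, its dual is
  invertible.\<close>

lemma du_right_inverse:
  obtains w where "arr w" "src w = D (X \<odot> Y)" "trg w = D Y \<odot> D X" "du X Y \<bullet> w = Id (D (X \<odot> Y))"
proof
  let ?V = "X \<odot> Y" and ?W = "D Y \<odot> D X"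
  let ?w = "lu ?W \<bullet> (Ev ?V ** Id ?W) \<bullet> \<alpha>' (D ?V) ?V ?W \<bullet> (Id (D ?V) ** nested_coev X Y) \<bullet> ru' (D ?V)"
  have "du X Y \<bullet> ?w = lu (D ?V) \<bullet> (Id \<I> ** du X Y) \<bullet> (Ev ?V ** Id ?W) \<bullet> \<alpha>' (D ?V) ?V ?W \<bullet>
      (Id (D ?V) ** nested_coev X Y) \<bullet> ru' (D ?V)"
    using comp_reassoc[OF lu_natural[of "du X Y", symmetric]] by (simp add: comp_assoc)
  also have "\<dots> = lu (D ?V) \<bullet> (Ev ?V ** Id (D ?V)) \<bullet> (Id (D ?V \<odot> ?V) ** du X Y) \<bullet> \<alpha>' (D ?V) ?V ?W \<bullet>
      (Id (D ?V) ** nested_coev X Y) \<bullet> ru' (D ?V)"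
    using comp_reassoc[OF slide[of "Ev ?V" "du X Y"]] by (simp add: comp_assoc)
  also have "\<dots> = lu (D ?V) \<bullet> (Ev ?V ** Id (D ?V)) \<bullet> \<alpha>' (D ?V) ?V (D ?V) \<bullet>
      (Id (D ?V) ** ((Id ?V ** du X Y) \<bullet> nested_coev X Y)) \<bullet> ru' (D ?V)"
    using comp_reassoc[OF \<alpha>'_natural[of "Id (D ?V)" "Id ?V" "du X Y", symmetric]]
    by (simp add: comp_assoc Id_tens_comp)
  also have "\<dots> = (lu (D ?V) \<bullet> (Ev ?V ** Id (D ?V)) \<bullet> \<alpha>' (D ?V) ?V (D ?V) \<bullet>
      (Id (D ?V) ** Coev ?V)) \<bullet> ru' (D ?V)"
    by (simp add: du_nested_coev comp_assoc)
  also have "\<dots> = Id (D ?V)" by (simp add: zigzag2)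
  finally show "du X Y \<bullet> ?w = Id (D ?V)" .
qed auto

lemma isomorphic_dual_tensor: "isomorphic (D (X \<odot> Y)) (D Y \<odot> D X)"
proof -
  let ?V = "X \<odot> Y" and ?W = "D Y \<odot> D X"
  obtain w where w: "arr w" "src w = D ?V" "trg w = ?W" "du X Y \<bullet> w = Id (D ?V)"
    by (rule du_right_inverse)
  obtain w' where w': "arr w'" "src w' = D (D Y \<odot> D X)" "trg w' = D (D X) \<odot> D (D Y)"
      "du (D Y) (D X) \<bullet> w' = Id (D (D Y \<odot> D X))"
    by (rule du_right_inverse)
  let ?q = "inverse_arrow (Piv X) ** inverse_arrow (Piv Y)"
  have q: "arr ?q" "(Piv X ** Piv Y) \<bullet> ?q = Id (D (D X) \<odot> D (D Y))"
    using arr_inverse_arrow[OF iso_Piv] comp_inverse_arrow[OF iso_Piv] by (auto simp: tens_comp_tens)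
  have "dm (du X Y) \<bullet> Piv ?V \<bullet> ?q \<bullet> w' = Id (D ?W)"
  proof -
    have "dm (du X Y) \<bullet> Piv ?V \<bullet> ?q \<bullet> w' = (dm (du X Y) \<bullet> Piv ?V) \<bullet> ?q \<bullet> w'"
      using q w' by (simp add: comp_assoc)
    also have "\<dots> = du (D Y) (D X) \<bullet> ((Piv X ** Piv Y) \<bullet> ?q) \<bullet> w'"
      using q(1) w' by (simp add: Piv_monoidal comp_assoc)
    also have "\<dots> = Id (D ?W)" using w' by (simp add: q(2))
    finally show ?thesis .
  qed
  moreover have l: "dm w \<bullet> dm (du X Y) = Id (D (D ?V))"
    using w by (simp add: dm_comp[symmetric])
  ultimately have "dm w = Piv ?V \<bullet> ?q \<bullet> w'"
    using w q w' comp_reassoc[OF l, of "Piv ?V \<bullet> ?q \<bullet> w'"] by simp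
  then have "dm (w \<bullet> du X Y) = dm (Id ?W)"
    using w q w' \<open>dm (du X Y) \<bullet> Piv ?V \<bullet> ?q \<bullet> w' = Id (D ?W)\<close> by (simp add: dm_comp)
  then have "w \<bullet> du X Y = Id ?W"
    by (rule dm_injective) (use w in auto)
  then show ?thesis
    using w by (intro isomorphicI[of w "du X Y"]) auto
qed

end

section \<open>The S-matrix on objects\<close>

context pivotal_fusion_category
begin

lemma mor_Tr:
  assumes "f \<in> Hom C X X"
  shows "mor (Tr (Arrow X f X)) = ev C (D X) \<cdot> ((piv X \<cdot> f) \<star> ident C (D X)) \<cdot> coev C X"
proof -
  have "Tr (Arrow X f X) = (Ev (D X) \<bullet> ((Piv X \<bullet> Arrow X f X) ** Id (D X))) \<bullet> Coev X"
    using assms by (simp add: Tr_def Evp_def tens_Id_comp comp_assoc)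
  then show ?thesis by (simp add: comp_def tens_def Ev_def Piv_def Coev_def Id_def)
qed

lemma unit_scalar_eq: "scl C a (ident C \<I>) = scl C b (ident C \<I>) \<longleftrightarrow> a = b"
  using unit_simple by (simp add: simple_def)

lemma trace_eqI:
  assumes "f \<in> Hom C X X" "mor (Tr (Arrow X f X)) = scl C c (ident C \<I>)"
  shows "trace X f = c"
  unfolding trace_def using assms
  by (simp add: mor_Tr unit_scalar_eq del: scale_cancel_right)

lemma mor_Tr_trace:
  assumes "f \<in> Hom C X X"
  shows "mor (Tr (Arrow X f X)) = scl C (trace X f) (ident C \<I>)"
proof -
  have "arr (Tr (Arrow X f X))" using assms by simp
  then obtain c where "mor (Tr (Arrow X f X)) = scl C c (ident C \<I>)"
    using End_simple[OF unit_simple] unfolding arr_def by auto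
  then show ?thesis using trace_eqI[OF assms] by metis
qed

lemma piv_in_Hom: "piv X \<in> Hom C X (D (D X))"
  using Piv_simps(3)[of X] by (simp add: Piv_def del: Piv_simps)

lemma coev_in_Hom: "coev C X \<in> Hom C \<I> (X \<odot> D X)"
  using left_dual by (simp add: is_left_dual_def)

lemma trace_add:
  assumes f: "f \<in> Hom C X X" and g: "g \<in> Hom C X X"
  shows "trace X (f + g) = trace X f + trace X g"
proof (rule trace_eqI[OF add_in_Hom[OF f g]])
  note pf = cmp_in_Hom[OF f piv_in_Hom] and pg = cmp_in_Hom[OF g piv_in_Hom]
  note I = ident_in_Hom[of "D X"]
  have "mor (Tr (Arrow X (f + g) X)) = mor (Tr (Arrow X f X)) + mor (Tr (Arrow X g X))"
    unfolding mor_Tr[OF f] mor_Tr[OF g] mor_Tr[OF add_in_Hom[OF f g]]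
      cmp_add_right[OF f g piv_in_Hom] tensor_add_left[OF pf pg I]
      cmp_add_right[OF tensor_in_Hom[OF pf I] tensor_in_Hom[OF pg I] ev_in_Hom]
      cmp_add_left[OF coev_in_Hom cmp_in_Hom[OF tensor_in_Hom[OF pf I] ev_in_Hom]
        cmp_in_Hom[OF tensor_in_Hom[OF pg I] ev_in_Hom]] ..
  then show "mor (Tr (Arrow X (f + g) X)) = scl C (trace X f + trace X g) (ident C \<I>)"
    by (simp add: mor_Tr_trace f g scale_left_distrib)
qed

lemma trace_scl:
  assumes f: "f \<in> Hom C X X"
  shows "trace X (scl C a f) = a * trace X f"
proof (rule trace_eqI[OF scl_in_Hom[OF f]])
  note pf = cmp_in_Hom[OF f piv_in_Hom]
  note I = ident_in_Hom[of "D X"]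
  have "mor (Tr (Arrow X (scl C a f) X)) = scl C a (mor (Tr (Arrow X f X)))"
    unfolding mor_Tr[OF f] mor_Tr[OF scl_in_Hom[OF f]]
      cmp_scl_right[OF f piv_in_Hom] tensor_scl_left[OF pf I]
      cmp_scl_right[OF tensor_in_Hom[OF pf I] ev_in_Hom]
      cmp_scl_left[OF coev_in_Hom cmp_in_Hom[OF tensor_in_Hom[OF pf I] ev_in_Hom]] ..
  then show "mor (Tr (Arrow X (scl C a f) X)) = scl C (a * trace X f) (ident C \<I>)"
    by (simp add: mor_Tr_trace f)
qed

lemma trace_sum:
  assumes "\<And>j. j \<in> J \<Longrightarrow> f j \<in> Hom C X X"
  shows "trace X (sum f J) = (\<Sum>j\<in>J. trace X (f j))"
  using assms
proof (induction J rule: infinite_finite_induct)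
  case (insert x F)
  then show ?case using trace_add[of "f x" X "sum f F"] sum_in_Hom[of F f X X] by simp
qed (use trace_scl[OF zero_in_Hom, of _ 0] in auto)

lemma trace_commute:
  assumes "f \<in> Hom C X Y" "g \<in> Hom C Y X"
  shows "trace X (g \<cdot> f) = trace Y (f \<cdot> g)"
proof (rule trace_eqI[OF cmp_in_Hom[OF assms]])
  have "Tr (Arrow X (g \<cdot> f) X) = Tr (Arrow Y (f \<cdot> g) Y)"
    using Tr_commute[of "Arrow X f Y" "Arrow Y g X"] assms by (simp add: comp_def)
  then show "mor (Tr (Arrow X (g \<cdot> f) X)) = scl C (trace Y (f \<cdot> g)) (ident C \<I>)"
    using mor_Tr_trace[OF cmp_in_Hom[OF assms(2,1)]] by simp
qed

end

context braided_fusion_category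
begin

lemma braid_in_Hom: "braid X Y \<in> Hom C (X \<odot> Y) (Y \<odot> X)"
  using braid_iso[of X Y] by (auto simp: iso_arr_def is_inverse_def)

lemma monodromy_in_Hom: "braid Y X \<cdot> braid X Y \<in> Hom C (X \<odot> Y) (X \<odot> Y)"
  using cmp_in_Hom[OF braid_in_Hom braid_in_Hom] .

lemma monodromy_natural:
  assumes "f \<in> Hom C X X'" "g \<in> Hom C Y Y'"
  shows "(braid Y' X' \<cdot> braid X' Y') \<cdot> (f \<star> g) = (f \<star> g) \<cdot> (braid Y X \<cdot> braid X Y)"
  using arg_cong[OF Mon_natural[of "Arrow X f X'" "Arrow Y g Y'"], of mor] assms
  by (simp add: Mon_def comp_def tens_def Br_def)

definition scalar_monodromy :: "'o \<Rightarrow> 'o \<Rightarrow> 'k \<Rightarrow> bool" where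
  "scalar_monodromy X Y c \<longleftrightarrow> braid Y X \<cdot> braid X Y = scl C c (ident C (X \<odot> Y))"

lemma scalar_monodromy_unique:
  assumes "simple (X \<odot> Y)" "scalar_monodromy X Y c" "scalar_monodromy X Y d"
  shows "c = d"
  using assms unfolding scalar_monodromy_def simple_def by (metis scale_cancel_right)

lemma scalar_monodromy_sym:
  assumes "scalar_monodromy X Y c"
  shows "scalar_monodromy Y X c"
proof -
  obtain w where w: "w \<in> Hom C (Y \<odot> X) (X \<odot> Y)" "braid X Y \<cdot> w = ident C (Y \<odot> X)"
    using braid_iso[of X Y] unfolding iso_arr_def is_inverse_def by blast
  have "braid X Y \<cdot> braid Y X = (braid X Y \<cdot> braid Y X) \<cdot> (braid X Y \<cdot> w)"
    using w cmp_ident[OF monodromy_in_Hom] by simp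
  also have "\<dots> = braid X Y \<cdot> ((braid Y X \<cdot> braid X Y) \<cdot> w)"
    using cmp_assoc[OF cmp_in_Hom[OF w(1) braid_in_Hom] braid_in_Hom braid_in_Hom]
      cmp_assoc[OF w(1) braid_in_Hom braid_in_Hom] by simp
  also have "(braid Y X \<cdot> braid X Y) \<cdot> w = scl C c w"
    using assms cmp_scl_left[OF w(1) ident_in_Hom] ident_cmp[OF w(1)] by (simp add: scalar_monodromy_def)
  also have "braid X Y \<cdot> scl C c w = scl C c (ident C (Y \<odot> X))"
    using cmp_scl_right[OF w(1) braid_in_Hom] w(2) by simp
  finally show ?thesis by (simp add: scalar_monodromy_def)
qed

lemma scalar_monodromy_isomorphic:
  assumes "scalar_monodromy X Y c" "isomorphic Y Y'"
  shows "scalar_monodromy X Y' c"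
proof -
  obtain u v where uv: "u \<in> Hom C Y Y'" "v \<in> Hom C Y' Y" "u \<cdot> v = ident C Y'"
    using assms(2) unfolding isomorphic_def iso_arr_def is_inverse_def by blast
  let ?u = "ident C X \<star> u" and ?v = "ident C X \<star> v"
  have U: "?u \<in> Hom C (X \<odot> Y) (X \<odot> Y')" and V: "?v \<in> Hom C (X \<odot> Y') (X \<odot> Y)"
    using uv tensor_in_Hom ident_in_Hom by blast+
  have UV: "?u \<cdot> ?v = ident C (X \<odot> Y')"
    using tensor_cmp[OF ident_in_Hom ident_in_Hom uv(2,1), of X] uv(3)
      cmp_ident[OF ident_in_Hom[of X]] by (simp add: tensor_ident)
  let ?m = "braid Y' X \<cdot> braid X Y'"
  have "?m = ?m \<cdot> (?u \<cdot> ?v)" using UV cmp_ident[OF monodromy_in_Hom] by simp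
  also have "\<dots> = (?m \<cdot> ?u) \<cdot> ?v" using cmp_assoc[OF V U monodromy_in_Hom] by simp
  also have "?m \<cdot> ?u = ?u \<cdot> (braid Y X \<cdot> braid X Y)" by (rule monodromy_natural[OF ident_in_Hom uv(1)])
  also have "\<dots> = scl C c ?u"
    using assms(1) cmp_scl_right[OF ident_in_Hom U] cmp_ident[OF U] by (simp add: scalar_monodromy_def)
  also have "scl C c ?u \<cdot> ?v = scl C c (ident C (X \<odot> Y'))" using cmp_scl_left[OF V U] UV by simp
  finally show ?thesis by (simp add: scalar_monodromy_def)
qed

lemma scalar_monodromy_tensor:
  assumes a: "scalar_monodromy Y X a" and b: "scalar_monodromy Y Z b"
  shows "scalar_monodromy Y (X \<odot> Z) (a * b)"
proof -
  define sc where "sc c f = Arrow (src f) (scl C c (mor f)) (trg f)" for c and f :: "('o, 'm) arrow"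
  have sc [simp]: "src (sc c f) = src f" "trg (sc c f) = trg f" "arr f \<Longrightarrow> arr (sc c f)" for c f
    by (auto simp: sc_def arr_def scl_in_Hom)
  have sc_comp: "sc c g \<bullet> f = sc c (g \<bullet> f)" "g \<bullet> sc c f = sc c (g \<bullet> f)"
    if "arr f" "arr g" "src g = trg f" for c f g
    using that cmp_scl_left[of "mor f" "src f" "trg f" "mor g" "trg g"]
      cmp_scl_right[of "mor f" "src f" "trg f" "mor g" "trg g"]
    by (auto simp: sc_def comp_def arr_def)
  have sc_tens: "sc c f ** g = sc c (f ** g)" "f ** sc c g = sc c (f ** g)" if "arr f" "arr g" for c f g
    using that tensor_scl_left[of "mor f" "src f" "trg f" "mor g" "src g" "trg g"]
      tensor_scl_right[of "mor f" "src f" "trg f" "mor g" "src g" "trg g"]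
    by (auto simp: sc_def tens_def arr_def)
  have sc_sc: "sc c (sc d f) = sc (c * d) f" for c d f by (simp add: sc_def)
  have M: "scalar_monodromy U V c \<longleftrightarrow> Mon U V = sc c (Id (U \<odot> V))" for U V c
    by (simp add: scalar_monodromy_def Mon_def comp_def Br_def sc_def Id_def)
  have MX: "Br X Y \<bullet> Br Y X = sc a (Id (Y \<odot> X))" using a unfolding M by (simp add: Mon_def)
  have MZ: "Mon Y Z = sc b (Id (Y \<odot> Z))" using b unfolding M .
  have "\<alpha>' Y X Z \<bullet> Mon Y (X \<odot> Z) \<bullet> \<alpha> Y X Z = sc b ((Br X Y \<bullet> Br Y X) ** Id Z)"
    unfolding Mon_tens MZ by (simp add: sc_comp sc_tens comp_assoc tens_Id_comp)
  also have "\<dots> = sc (a * b) (Id ((Y \<odot> X) \<odot> Z))"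
    unfolding MX by (simp add: sc_tens sc_sc mult.commute)
  finally have *: "\<alpha>' Y X Z \<bullet> Mon Y (X \<odot> Z) \<bullet> \<alpha> Y X Z = sc (a * b) (Id ((Y \<odot> X) \<odot> Z))" .
  have "Mon Y (X \<odot> Z) = \<alpha> Y X Z \<bullet> (\<alpha>' Y X Z \<bullet> Mon Y (X \<odot> Z) \<bullet> \<alpha> Y X Z) \<bullet> \<alpha>' Y X Z"
    by (simp add: comp_assoc comp_reassoc[OF \<alpha>\<alpha>'])
  also have "\<dots> = sc (a * b) (Id (Y \<odot> (X \<odot> Z)))"
    unfolding * by (simp add: sc_comp)
  finally show ?thesis unfolding M .
qed

lemma transparent_direct_sum_iff:
  assumes "direct_sum X Xs"
  shows "braid X Z \<cdot> braid Z X = ident C (Z \<odot> X) \<longleftrightarrow>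
    (\<forall>j<length Xs. braid (Xs ! j) Z \<cdot> braid Z (Xs ! j) = ident C (Z \<odot> Xs ! j))"
proof -
  let ?m = "\<lambda>X. braid X Z \<cdot> braid Z X" and ?I = "ident C Z"
  obtain i p where
    i': "\<And>j. j < length Xs \<Longrightarrow> i j \<in> Hom C (Xs ! j) X" and
    p': "\<And>j. j < length Xs \<Longrightarrow> p j \<in> Hom C X (Xs ! j)" and
    pi: "\<And>j l. j < length Xs \<Longrightarrow> l < length Xs \<Longrightarrow>
      (?I \<star> p j) \<cdot> (?I \<star> i l) = (if j = l then ident C (Z \<odot> Xs ! j) else 0)" and
    one: "(\<Sum>j<length Xs. (?I \<star> i j) \<cdot> (?I \<star> p j)) = ident C (Z \<odot> X)"
    using direct_sum_tensorE[OF assms, of Z] by blast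
  note i = tensor_in_Hom[OF ident_in_Hom[of Z] i'] and p = tensor_in_Hom[OF ident_in_Hom[of Z] p']
  note m = monodromy_in_Hom
  have ip: "(?I \<star> i j) \<cdot> (?I \<star> p j) \<in> Hom C (Z \<odot> X) (Z \<odot> X)" if "j < length Xs" for j
    using cmp_in_Hom[OF p i, OF that that] .
  have nat: "?m X \<cdot> (?I \<star> i j) = (?I \<star> i j) \<cdot> ?m (Xs ! j)" if "j < length Xs" for j
    by (rule monodromy_natural[OF ident_in_Hom i'[OF that]])
  show ?thesis
  proof
    assume mX: "?m X = ident C (Z \<odot> X)"
    show "\<forall>j<length Xs. ?m (Xs ! j) = ident C (Z \<odot> Xs ! j)"
    proof (intro allI impI)
      fix j assume j: "j < length Xs"
      have pij: "(?I \<star> p j) \<cdot> (?I \<star> i j) = ident C (Z \<odot> Xs ! j)" using pi[OF j j] by simp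
      have "?m (Xs ! j) = ((?I \<star> p j) \<cdot> (?I \<star> i j)) \<cdot> ?m (Xs ! j)"
        using pij ident_cmp[OF m] by simp
      also have "\<dots> = (?I \<star> p j) \<cdot> (?m X \<cdot> (?I \<star> i j))"
        using cmp_assoc[OF m i p, OF j j] nat[OF j] by simp
      also have "\<dots> = ident C (Z \<odot> Xs ! j)"
        using mX ident_cmp[OF i[OF j]] pij by simp
      finally show "?m (Xs ! j) = ident C (Z \<odot> Xs ! j)" .
    qed
  next
    assume mj: "\<forall>j<length Xs. ?m (Xs ! j) = ident C (Z \<odot> Xs ! j)"
    have "?m X = ?m X \<cdot> (\<Sum>j<length Xs. (?I \<star> i j) \<cdot> (?I \<star> p j))"
      by (simp add: one cmp_ident[OF m])
    also have "\<dots> = (\<Sum>j<length Xs. ?m X \<cdot> ((?I \<star> i j) \<cdot> (?I \<star> p j)))"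
      by (rule cmp_sum[OF m, where X = "Z \<odot> X"]) (use ip in auto)
    also have "\<dots> = (\<Sum>j<length Xs. (?I \<star> i j) \<cdot> (?I \<star> p j))"
    proof (intro sum.cong refl)
      fix j assume "j \<in> {..<length Xs}"
      then have j: "j < length Xs" by simp
      have "?m X \<cdot> ((?I \<star> i j) \<cdot> (?I \<star> p j)) = (?m X \<cdot> (?I \<star> i j)) \<cdot> (?I \<star> p j)"
        by (simp add: cmp_assoc[OF p i m, OF j j])
      also have "?m X \<cdot> (?I \<star> i j) = ?I \<star> i j"
        using nat[OF j] mj j cmp_ident[OF i[OF j]] by simp
      finally show "?m X \<cdot> ((?I \<star> i j) \<cdot> (?I \<star> p j)) = (?I \<star> i j) \<cdot> (?I \<star> p j)" .
    qed
    finally show "?m X = ident C (Z \<odot> X)" using one by simp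
  qed
qed

text \<open>For simple \<open>X\<close> the double braiding with the unit is a scalar \<open>c\<close>, and the hexagons give \<open>c\<^sup>2 = c\<close>.\<close>

lemma monodromy_unit: "braid \<I> X \<cdot> braid X \<I> = ident C (X \<odot> \<I>)"
proof -
  have sim: "scalar_monodromy Y \<I> 1" if "simple Y" for Y
  proof -
    have Y: "simple (Y \<odot> \<I>)"
      using simple_isomorphic[OF that] isomorphic_right_unit isomorphic_sym by blast
    obtain c where c: "scalar_monodromy Y \<I> c"
      using End_simple[OF Y monodromy_in_Hom] unfolding scalar_monodromy_def by blast
    have "scalar_monodromy Y \<I> (c * c)"
      using scalar_monodromy_isomorphic[OF scalar_monodromy_tensor[OF c c]] isomorphic_left_unit by blast
    then have cc: "c = c * c" by (rule scalar_monodromy_unique[OF Y c])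
    have "c \<noteq> 0"
    proof
      assume "c = 0"
      then have 0: "braid \<I> Y \<cdot> braid Y \<I> = 0" using c by (simp add: scalar_monodromy_def)
      obtain u where u: "u \<in> Hom C (Y \<odot> \<I>) (\<I> \<odot> Y)" "u \<cdot> braid \<I> Y = ident C (\<I> \<odot> Y)"
        using braid_iso[of \<I> Y] unfolding iso_arr_def is_inverse_def by blast
      obtain v where v: "v \<in> Hom C (\<I> \<odot> Y) (Y \<odot> \<I>)" "v \<cdot> braid Y \<I> = ident C (Y \<odot> \<I>)"
        using braid_iso[of Y \<I>] unfolding iso_arr_def is_inverse_def by blast
      have "braid Y \<I> = u \<cdot> (braid \<I> Y \<cdot> braid Y \<I>)"
        using cmp_assoc[OF braid_in_Hom braid_in_Hom u(1)] u(2) ident_cmp[OF braid_in_Hom] by simp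
      then have "braid Y \<I> = 0" using 0 cmp_zero[OF u(1)] by simp
      then show False using v(2) cmp_zero[OF v(1)] Y by (simp add: simple_def)
    qed
    then have "c = 1" using cc by simp
    then show ?thesis using c by simp
  qed
  obtain Ys where Ys: "\<forall>Y\<in>set Ys. simple Y" "direct_sum X Ys" using semisimple by blast
  have "braid (Ys ! j) \<I> \<cdot> braid \<I> (Ys ! j) = ident C (\<I> \<odot> Ys ! j)" if "j < length Ys" for j
    using scalar_monodromy_sym[OF sim[of "Ys ! j"]] Ys(1) that by (simp add: scalar_monodromy_def)
  then have "scalar_monodromy \<I> X 1"
    using transparent_direct_sum_iff[OF Ys(2)] by (simp add: scalar_monodromy_def)
  then have "scalar_monodromy X \<I> 1" by (rule scalar_monodromy_sym)
  then show ?thesis by (simp add: scalar_monodromy_def)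
qed

end

context premodular_category
begin

definition S_ob :: "'o \<Rightarrow> 'o \<Rightarrow> 'k" where
  "S_ob X Y = trace (X \<odot> Y) (braid Y X \<cdot> braid X Y)"

lemma S_matrix_S_ob: "S_matrix A B = S_ob (rep A) (rep B)"
  by (simp add: S_matrix_def S_ob_def)

lemma S_ob_sym: "S_ob X Y = S_ob Y X"
  unfolding S_ob_def by (rule trace_commute[OF braid_in_Hom braid_in_Hom])

lemma S_ob_direct_sum:
  assumes "direct_sum X Xs"
  shows "S_ob Y X = (\<Sum>j<length Xs. S_ob Y (Xs ! j))"
proof -
  let ?m = "\<lambda>X. braid X Y \<cdot> braid Y X" and ?I = "ident C Y"
  obtain i p where
    i': "\<And>j. j < length Xs \<Longrightarrow> i j \<in> Hom C (Xs ! j) X" and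
    p': "\<And>j. j < length Xs \<Longrightarrow> p j \<in> Hom C X (Xs ! j)" and
    pi: "\<And>j l. j < length Xs \<Longrightarrow> l < length Xs \<Longrightarrow>
      (?I \<star> p j) \<cdot> (?I \<star> i l) = (if j = l then ident C (Y \<odot> Xs ! j) else 0)" and
    one: "(\<Sum>j<length Xs. (?I \<star> i j) \<cdot> (?I \<star> p j)) = ident C (Y \<odot> X)"
    using direct_sum_tensorE[OF assms, of Y] by blast
  note i = tensor_in_Hom[OF ident_in_Hom[of Y] i'] and p = tensor_in_Hom[OF ident_in_Hom[of Y] p']
  note m = monodromy_in_Hom
  have ip: "(?I \<star> i j) \<cdot> (?I \<star> p j) \<in> Hom C (Y \<odot> X) (Y \<odot> X)" if "j < length Xs" for j
    using cmp_in_Hom[OF p i, OF that that] .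
  have "S_ob Y X = trace (Y \<odot> X) (?m X \<cdot> (\<Sum>j<length Xs. (?I \<star> i j) \<cdot> (?I \<star> p j)))"
    by (simp add: one cmp_ident[OF m] S_ob_def)
  also have "\<dots> = trace (Y \<odot> X) (\<Sum>j<length Xs. ?m X \<cdot> ((?I \<star> i j) \<cdot> (?I \<star> p j)))"
    by (subst cmp_sum[OF m, where X = "Y \<odot> X"]) (use ip in auto)
  also have "\<dots> = (\<Sum>j<length Xs. trace (Y \<odot> X) (?m X \<cdot> ((?I \<star> i j) \<cdot> (?I \<star> p j))))"
    by (rule trace_sum) (use cmp_in_Hom[OF ip m] in auto)
  also have "\<dots> = (\<Sum>j<length Xs. S_ob Y (Xs ! j))"
  proof (intro sum.cong refl)
    fix j assume "j \<in> {..<length Xs}"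
    then have j: "j < length Xs" by simp
    have "trace (Y \<odot> X) (?m X \<cdot> ((?I \<star> i j) \<cdot> (?I \<star> p j)))
        = trace (Y \<odot> X) ((?m X \<cdot> (?I \<star> i j)) \<cdot> (?I \<star> p j))"
      by (simp add: cmp_assoc[OF p i m, OF j j])
    also have "\<dots> = trace (Y \<odot> Xs ! j) ((?I \<star> p j) \<cdot> (?m X \<cdot> (?I \<star> i j)))"
      by (rule trace_commute[OF p cmp_in_Hom[OF i m], OF j j])
    also have "?m X \<cdot> (?I \<star> i j) = (?I \<star> i j) \<cdot> ?m (Xs ! j)"
      by (rule monodromy_natural[OF ident_in_Hom i'[OF j]])
    also have "(?I \<star> p j) \<cdot> \<dots> = ((?I \<star> p j) \<cdot> (?I \<star> i j)) \<cdot> ?m (Xs ! j)"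
      by (simp add: cmp_assoc[OF m i p, OF j j])
    also have "(?I \<star> p j) \<cdot> (?I \<star> i j) = ident C (Y \<odot> Xs ! j)"
      using pi[OF j j] by simp
    finally show "trace (Y \<odot> X) (?m X \<cdot> ((?I \<star> i j) \<cdot> (?I \<star> p j))) = S_ob Y (Xs ! j)"
      by (simp add: ident_cmp[OF m] S_ob_def)
  qed
  finally show ?thesis .
qed

lemma S_ob_isomorphic: "isomorphic X X' \<Longrightarrow> S_ob Y X = S_ob Y X'"
  using S_ob_direct_sum[of X "[X']" Y] by (simp add: direct_sum_single)

lemma S_ob_unit: "S_ob X \<I> = trace X (ident C X)"
proof -
  have r: "run C X \<in> Hom C (X \<odot> \<I>) X" "run_inv X \<in> Hom C X (X \<odot> \<I>)"
    "run_inv X \<cdot> run C X = ident C (X \<odot> \<I>)" "run C X \<cdot> run_inv X = ident C X"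
    using inverse_arr_is_inverse[OF run_iso[of X]] unfolding is_inverse_def by blast+
  then show ?thesis
    unfolding S_ob_def monodromy_unit using trace_commute[OF r(1,2)] by simp
qed

lemma S_ob_unit_dual: "S_ob \<I> (D X) = S_ob \<I> X"
  using spherical by (simp add: S_ob_sym[of \<I>] S_ob_unit)

lemma S_ob_tensor:
  assumes "simple Y"
  shows "S_ob Y (X \<odot> Z) * S_ob Y \<I> = S_ob Y X * S_ob Y Z"
proof -
  let ?P = "ptr Y Y Z (Mon Y Z)"
  have P: "arr ?P" by simp
  then obtain c where c: "mor ?P = scl C c (ident C Y)"
    using End_simple[OF assms] unfolding arr_def by (metis ptr_simps(1,2))
  have Pc: "?P = Arrow Y (scl C c (ident C Y)) Y"
    by (rule arrow_eqI) (simp_all add: c)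
  have Mon_Arrow: "Mon Y X = Arrow (Y \<odot> X) (braid X Y \<cdot> braid Y X) (Y \<odot> X)" for X
    by (simp add: Mon_def comp_def Br_def)
  have 1: "S_ob Y Z = c * S_ob Y \<I>"
  proof -
    have "trace (Y \<odot> Z) (braid Z Y \<cdot> braid Y Z) = trace Y (scl C c (ident C Y))"
      using Tr_ptr[of "Mon Y Z" Y Z] mor_Tr_trace[OF scl_in_Hom[OF ident_in_Hom], of Y c]
      by (intro trace_eqI monodromy_in_Hom) (simp add: Mon_Arrow[symmetric] Pc)
    then show ?thesis by (simp add: S_ob_unit trace_scl[OF ident_in_Hom] S_ob_def[of Y Z])
  qed
  have 2: "S_ob Y (X \<odot> Z) = c * S_ob Y X"
  proof -
    have "ident C X \<star> scl C c (ident C Y) = scl C c (ident C (X \<odot> Y))"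
      using tensor_scl_right[OF ident_in_Hom ident_in_Hom] by (simp add: tensor_ident)
    then have "Br X Y \<bullet> (Id X ** ?P) \<bullet> Br Y X
        = Arrow (Y \<odot> X) (braid X Y \<cdot> (scl C c (ident C (X \<odot> Y)) \<cdot> braid Y X)) (Y \<odot> X)"
      unfolding Pc by (simp add: comp_def tens_def Br_def Id_def)
    also have "scl C c (ident C (X \<odot> Y)) \<cdot> braid Y X = scl C c (braid Y X)"
      using cmp_scl_left[OF braid_in_Hom ident_in_Hom] ident_cmp[OF braid_in_Hom] by simp
    also have "braid X Y \<cdot> scl C c (braid Y X) = scl C c (braid X Y \<cdot> braid Y X)"
      by (rule cmp_scl_right[OF braid_in_Hom braid_in_Hom])
    finally have "Tr (Mon Y (X \<odot> Z)) = Tr (Arrow (Y \<odot> X) (scl C c (braid X Y \<cdot> braid Y X)) (Y \<odot> X))"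
      unfolding Tr_Mon_tens by simp
    then have "trace (Y \<odot> (X \<odot> Z)) (braid (X \<odot> Z) Y \<cdot> braid Y (X \<odot> Z))
        = trace (Y \<odot> X) (scl C c (braid X Y \<cdot> braid Y X))"
      using mor_Tr_trace[OF scl_in_Hom[OF monodromy_in_Hom]]
      by (intro trace_eqI monodromy_in_Hom) (simp add: Mon_Arrow[symmetric])
    then show ?thesis by (simp add: S_ob_def trace_scl[OF monodromy_in_Hom])
  qed
  show ?thesis unfolding 1 2 by simp
qed

end

section \<open>Characters of the Grothendieck ring\<close>

context fusion_category
begin

lemma rep_iso_class: "isomorphic X (rep (iso_class X))"
  using someI[of "\<lambda>Y. Y \<in> iso_class X" X] by (simp add: rep_def iso_class_mem)

lemma Irr_rep:
  assumes "A \<in> Irr UNIV"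
  shows "simple (rep A)" "iso_class (rep A) = A"
proof -
  obtain X where "simple X" "A = iso_class X" using assms by (auto simp: Irr_def)
  then show "simple (rep A)" "iso_class (rep A) = A"
    using rep_iso_class[of X] simple_isomorphic iso_class_eq isomorphic_sym by blast+
qed

lemma iso_class_in_Irr: "simple X \<Longrightarrow> iso_class X \<in> Irr UNIV"
  by (auto simp: Irr_def)

lemma finite_Irr: "finite (Irr UNIV)"
  using finite_simples by (simp add: Irr_def)

definition additive :: "('o \<Rightarrow> 'k) \<Rightarrow> bool" where
  "additive \<phi> \<longleftrightarrow> (\<forall>X Xs. direct_sum X Xs \<longrightarrow> \<phi> X = (\<Sum>j<length Xs. \<phi> (Xs ! j)))"

lemma additive_isomorphic: "additive \<phi> \<Longrightarrow> isomorphic X Y \<Longrightarrow> \<phi> X = \<phi> Y"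
  using direct_sum_single[of X Y] unfolding additive_def by fastforce

definition decomposition :: "'o \<Rightarrow> 'o list" where
  "decomposition X = (SOME Ys. (\<forall>Y\<in>set Ys. simple Y) \<and> direct_sum X Ys)"

lemma decomposition: "Y \<in> set (decomposition X) \<Longrightarrow> simple Y" "direct_sum X (decomposition X)"
  using someI_ex[OF semisimple[of X]] unfolding decomposition_def by blast+

definition multiplicity :: "'o \<Rightarrow> 'o set \<Rightarrow> nat" where
  "multiplicity X B = card {j. j < length (decomposition X) \<and> iso_class (decomposition X ! j) = B}"

lemma additive_multiplicity:
  assumes "additive \<phi>"
  shows "\<phi> X = (\<Sum>B\<in>Irr UNIV. of_nat (multiplicity X B) * \<phi> (rep B))"
proof -
  let ?Y = "decomposition X" and ?J = "{..<length (decomposition X)}"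
  have cl: "iso_class (?Y ! j) \<in> Irr UNIV" if "j \<in> ?J" for j
    using that iso_class_in_Irr[OF decomposition(1)[OF nth_mem]] by simp
  have "\<phi> X = (\<Sum>j\<in>?J. \<phi> (?Y ! j))"
    using assms decomposition(2) unfolding additive_def by blast
  also have "\<dots> = (\<Sum>j\<in>?J. \<phi> (rep (iso_class (?Y ! j))))"
    using additive_isomorphic[OF assms rep_iso_class] by (intro sum.cong) auto
  also have "\<dots> = (\<Sum>B\<in>Irr UNIV. \<Sum>j\<in>{j\<in>?J. iso_class (?Y ! j) = B}. \<phi> (rep (iso_class (?Y ! j))))"
    using cl by (intro sum.group[symmetric] finite_Irr) auto
  also have "\<dots> = (\<Sum>B\<in>Irr UNIV. of_nat (multiplicity X B) * \<phi> (rep B))"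
    by (intro sum.cong refl) (simp add: multiplicity_def)
  finally show ?thesis .
qed

lemma multiplicity_nonzero:
  assumes "multiplicity X B \<noteq> 0"
  obtains i p where "B \<in> Irr UNIV" "i \<in> Hom C (rep B) X" "i \<noteq> 0" "p \<in> Hom C X (rep B)" "p \<noteq> 0"
proof -
  have "{j. j < length (decomposition X) \<and> iso_class (decomposition X ! j) = B} \<noteq> {}"
    using assms unfolding multiplicity_def by (metis card.empty)
  then obtain j where j: "j < length (decomposition X)" and B: "iso_class (decomposition X ! j) = B"
    by blast
  let ?Y = "decomposition X ! j"
  have sY: "simple ?Y" by (rule decomposition(1)[OF nth_mem[OF j]])
  obtain i p where ip: "i \<in> Hom C ?Y X" "p \<in> Hom C X ?Y" "p \<cdot> i = ident C ?Y"
    using direct_sum_incl[OF decomposition(2) j] .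
  obtain u v where uv: "u \<in> Hom C ?Y (rep B)" "v \<in> Hom C (rep B) ?Y" "v \<cdot> u = ident C ?Y"
    using rep_iso_class[of ?Y] B unfolding isomorphic_def iso_arr_def is_inverse_def by blast
  have "p \<cdot> (i \<cdot> v) = v"
    using cmp_assoc[OF uv(2) ip(1,2)] ip(3) ident_cmp[OF uv(2)] by simp
  moreover have "v \<noteq> 0" using uv(3) zero_cmp[OF uv(1)] sY by (auto simp: simple_def)
  ultimately have 1: "i \<cdot> v \<noteq> 0" using cmp_zero[OF ip(2)] by metis
  have "(u \<cdot> p) \<cdot> i = u"
    using cmp_assoc[OF ip(1,2) uv(1)] ip(3) cmp_ident[OF uv(1)] by simp
  moreover have "u \<noteq> 0" using uv(3) cmp_zero[OF uv(2)] sY by (auto simp: simple_def)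
  ultimately have 2: "u \<cdot> p \<noteq> 0" using zero_cmp[OF ip(1)] by metis
  show thesis
    using that[OF _ cmp_in_Hom[OF uv(2) ip(1)] 1 cmp_in_Hom[OF ip(2) uv(1)] 2]
      iso_class_in_Irr[OF sY] B by simp
qed

lemma isomorphic_unit_if_simples:
  assumes A: "simple A" and B: "simple (D B)" and W: "direct_sum (A \<odot> B) (replicate n \<I>)" and n: "n \<noteq> 0"
  shows "isomorphic (A \<odot> B) \<I>"
proof -
  let ?r = "replicate n \<I>"
  obtain i p where ip: "\<And>j. j < length ?r \<Longrightarrow> i j \<in> Hom C (?r ! j) (A \<odot> B)"
    "\<And>j. j < length ?r \<Longrightarrow> p j \<in> Hom C (A \<odot> B) (?r ! j)"
    "\<And>j l. j < length ?r \<Longrightarrow> l < length ?r \<Longrightarrow> p j \<cdot> i l = (if j = l then ident C (?r ! j) else 0)"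
    using W by (elim direct_sumE) blast
  have i: "i j \<in> Hom C \<I> (A \<odot> B)" and p: "p j \<in> Hom C (A \<odot> B) \<I>" if "j < n" for j
    using ip(1,2)[of j] that by auto
  have pi: "p j \<cdot> i l = (if j = l then ident C \<I> else 0)" if "j < n" "l < n" for j l
    using ip(3)[of j l] that by simp
  have uns: "ident C \<I> \<noteq> 0" using unit_simple by (simp add: simple_def)
  have "n = 1"
  proof (rule ccontr)
    assume "n \<noteq> 1"
    then have n01: "0 < n" "1 < n" using n by auto
    have mate: "\<exists>m\<in>Hom C A (D B). ev C B \<cdot> (m \<star> ident C B) = q" if "q \<in> Hom C (A \<odot> B) \<I>" for q
    proof -
      let ?Q = "Arrow (A \<odot> B) q \<I>"
      have "mor (Ev B \<bullet> (Mate A B ?Q ** Id B)) = q" using Ev_Mate[of ?Q A B] that by simp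
      moreover have "arr (Mate A B ?Q)" using that by simp
      ultimately show ?thesis
        unfolding arr_def mor_comp mor_tens mor_Id by (auto simp: Ev_def)
    qed
    have "\<forall>j. \<exists>m. j < n \<longrightarrow> m \<in> Hom C A (D B) \<and> ev C B \<cdot> (m \<star> ident C B) = p j"
      using mate[OF p] by blast
    from choice[OF this] obtain m where m: "\<And>j. j < n \<Longrightarrow> m j \<in> Hom C A (D B)"
      "\<And>j. j < n \<Longrightarrow> ev C B \<cdot> (m j \<star> ident C B) = p j" by blast
    have pn0: "p j \<noteq> 0" if "j < n" for j using pi[OF that that] zero_cmp[OF i[OF that]] uns by auto
    have "m 0 \<noteq> 0"
      using m(2)[OF n01(1)] pn0[OF n01(1)] zero_tensor[OF ident_in_Hom] cmp_zero[OF ev_in_Hom] by metis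
    then have "iso_arr A (D B) (m 0)" using schur_iso[OF A B m(1)[OF n01(1)]] by blast
    then obtain c where c: "m 1 = scl C c (m 0)" using Hom_simple[OF A m(1)[OF n01(2)]] by blast
    have "p 1 = scl C c (p 0)"
      using m(2)[OF n01(1)] m(2)[OF n01(2)] c tensor_scl_left[OF m(1)[OF n01(1)] ident_in_Hom]
        cmp_scl_right[OF tensor_in_Hom[OF m(1)[OF n01(1)] ident_in_Hom] ev_in_Hom] by simp
    then have "p 1 \<cdot> i 0 = scl C c (ident C \<I>)"
      using cmp_scl_left[OF i p, OF n01(1) n01(1)] pi[OF n01(1) n01(1)] by simp
    then have "c = 0" using pi[OF n01(2) n01(1)] uns by simp
    then show False using \<open>p 1 = scl C c (p 0)\<close> pn0[OF n01(2)] by simp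
  qed
  then show ?thesis using W by (simp add: direct_sum_single)
qed

end

context modular_tensor_category
begin

lemma additive_S_ob: "additive (S_ob Y)"
  unfolding additive_def using S_ob_direct_sum by blast

lemma S_independent:
  assumes "\<And>A. A \<in> Irr UNIV \<Longrightarrow> (\<Sum>B\<in>Irr UNIV. c B * S_ob (rep A) (rep B)) = 0" "E \<in> Irr UNIV"
  shows "c E = 0"
proof -
  obtain T where T: "\<And>A B. A \<in> Irr UNIV \<Longrightarrow> B \<in> Irr UNIV \<Longrightarrow>
      (\<Sum>D\<in>Irr UNIV. T A D * S_ob (rep D) (rep B)) = (if A = B then 1 else 0)"
    using S_matrix_invertible unfolding S_matrix_S_ob by blast
  have "c E = (\<Sum>B\<in>Irr UNIV. if E = B then c B else 0)"
    using finite_Irr assms(2) by simp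
  also have "\<dots> = (\<Sum>B\<in>Irr UNIV. c B * (if E = B then 1 else 0))"
    by (intro sum.cong) auto
  also have "\<dots> = (\<Sum>B\<in>Irr UNIV. \<Sum>D\<in>Irr UNIV. c B * (T E D * S_ob (rep D) (rep B)))"
    by (intro sum.cong refl) (simp add: T[OF assms(2), symmetric] sum_distrib_left)
  also have "\<dots> = (\<Sum>D\<in>Irr UNIV. \<Sum>B\<in>Irr UNIV. c B * (T E D * S_ob (rep D) (rep B)))"
    by (rule sum.swap)
  also have "\<dots> = (\<Sum>D\<in>Irr UNIV. T E D * (\<Sum>B\<in>Irr UNIV. c B * S_ob (rep D) (rep B)))"
    by (simp add: sum_distrib_left mult.left_commute)
  also have "\<dots> = 0" using assms(1) by simp
  finally show ?thesis .
qed

lemma S_unit_nonzero: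
  assumes "simple Y"
  shows "S_ob Y \<I> \<noteq> 0"
proof
  assume 0: "S_ob Y \<I> = 0"
  let ?A = "iso_class Y"
  have "S_ob Y X = 0" for X using S_ob_tensor[OF assms, of X X] 0 by simp
  then have z: "S_ob (rep ?A) X = 0" for X
    using S_ob_isomorphic[OF rep_iso_class[of Y], of X] by (metis S_ob_sym)
  obtain T where "(\<Sum>D\<in>Irr UNIV. S_ob (rep ?A) (rep D) * T D ?A) = 1"
    using S_matrix_invertible iso_class_in_Irr[OF assms] unfolding S_matrix_S_ob by metis
  then show False using z by simp
qed

text \<open>The character of the Grothendieck ring attached to the simple class \<open>A\<close>.\<close>

definition psi :: "'o set \<Rightarrow> 'o \<Rightarrow> 'k" where
  "psi A X = S_ob (rep A) X / S_ob (rep A) \<I>"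

lemma additive_psi: "additive (psi A)"
  using additive_S_ob[of "rep A"] unfolding additive_def psi_def by (simp add: sum_divide_distrib)

lemma psi_isomorphic: "isomorphic X Y \<Longrightarrow> psi A X = psi A Y"
  by (rule additive_isomorphic[OF additive_psi])

lemma psi_tensor:
  assumes "A \<in> Irr UNIV"
  shows "psi A (X \<odot> Y) = psi A X * psi A Y"
  using S_ob_tensor[OF Irr_rep(1)[OF assms], of X Y] S_unit_nonzero[OF Irr_rep(1)[OF assms]]
  by (simp add: psi_def divide_simps)

lemma psi_unit: "A \<in> Irr UNIV \<Longrightarrow> psi A \<I> = 1"
  using S_unit_nonzero Irr_rep(1) by (simp add: psi_def)

lemma psi_unit_rep: "A \<in> Irr UNIV \<Longrightarrow> psi A (rep (iso_class \<I>)) = 1"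
  using psi_unit psi_isomorphic[OF rep_iso_class[of \<I>], of A] by simp

lemma unit_in_Irr: "iso_class \<I> \<in> Irr UNIV"
  using unit_simple iso_class_in_Irr by blast

lemma psi_independent:
  assumes "\<And>A. A \<in> Irr UNIV \<Longrightarrow> (\<Sum>B\<in>Irr UNIV. c B * psi A (rep B)) = 0" "E \<in> Irr UNIV"
  shows "c E = 0"
proof (rule S_independent[OF _ assms(2)])
  fix A assume A: "A \<in> Irr UNIV"
  have "(\<Sum>B\<in>Irr UNIV. c B * S_ob (rep A) (rep B))
      = S_ob (rep A) \<I> * (\<Sum>B\<in>Irr UNIV. c B * psi A (rep B))"
    using S_unit_nonzero[OF Irr_rep(1)[OF A]] by (simp add: psi_def sum_distrib_left)
  then show "(\<Sum>B\<in>Irr UNIV. c B * S_ob (rep A) (rep B)) = 0" using assms(1)[OF A] by simp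
qed

lemma psi_separates:
  assumes "\<And>A. A \<in> Irr UNIV \<Longrightarrow> (\<Sum>B\<in>Irr UNIV. c B * psi A (rep B)) = (\<Sum>B\<in>Irr UNIV. c' B * psi A (rep B))"
    "E \<in> Irr UNIV"
  shows "c E = c' E"
proof -
  have "c E - c' E = 0"
    by (rule psi_independent[OF _ assms(2)]) (simp add: assms(1) left_diff_distrib sum_subtractf)
  then show ?thesis by simp
qed

lemma additive_times_combination:
  assumes "additive \<phi>" "\<And>X Y. \<phi> (X \<odot> Y) = \<phi> X * \<phi> Y"
  shows "\<phi> X * (\<Sum>B\<in>Irr UNIV. c B * \<phi> (rep B))
    = (\<Sum>E\<in>Irr UNIV. (\<Sum>B\<in>Irr UNIV. c B * of_nat (multiplicity (X \<odot> rep B) E)) * \<phi> (rep E))"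
proof -
  have "\<phi> X * (\<Sum>B\<in>Irr UNIV. c B * \<phi> (rep B)) = (\<Sum>B\<in>Irr UNIV. c B * \<phi> (X \<odot> rep B))"
    by (simp add: assms(2) sum_distrib_left mult.left_commute)
  also have "\<dots> = (\<Sum>B\<in>Irr UNIV. \<Sum>E\<in>Irr UNIV. c B * of_nat (multiplicity (X \<odot> rep B) E) * \<phi> (rep E))"
    by (intro sum.cong refl) (subst additive_multiplicity[OF assms(1)], simp add: sum_distrib_left mult.assoc)
  also have "\<dots> = (\<Sum>E\<in>Irr UNIV. \<Sum>B\<in>Irr UNIV. c B * of_nat (multiplicity (X \<odot> rep B) E) * \<phi> (rep E))"
    by (rule sum.swap)
  finally show ?thesis by (simp add: sum_distrib_right)
qed

text \<open>Since the characters \<open>psi\<close> identify the Grothendieck algebra with a power of the ground field,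
  every character of it is one of them.\<close>

lemma character_is_psi:
  assumes "additive \<phi>" "\<And>X Y. \<phi> (X \<odot> Y) = \<phi> X * \<phi> Y" "\<phi> \<I> = 1"
  obtains B where "B \<in> Irr UNIV" "\<And>X. \<phi> X = psi B X"
proof -
  obtain T where T: "\<And>A B. A \<in> Irr UNIV \<Longrightarrow> B \<in> Irr UNIV \<Longrightarrow>
      (\<Sum>D\<in>Irr UNIV. S_ob (rep A) (rep D) * T D B) = (if A = B then 1 else 0)"
    using S_matrix_invertible unfolding S_matrix_S_ob by blast
  define t where "t B D = T D B * S_ob (rep B) \<I>" for B D
  have t: "(\<Sum>D\<in>Irr UNIV. t B D * psi A (rep D)) = (if A = B then 1 else 0)"
    if AB: "A \<in> Irr UNIV" "B \<in> Irr UNIV" for A B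
  proof -
    have "(\<Sum>D\<in>Irr UNIV. t B D * psi A (rep D))
        = S_ob (rep B) \<I> / S_ob (rep A) \<I> * (\<Sum>D\<in>Irr UNIV. S_ob (rep A) (rep D) * T D B)"
      unfolding sum_distrib_left by (intro sum.cong refl) (simp add: t_def psi_def)
    then show ?thesis using T[OF AB] S_unit_nonzero[OF Irr_rep(1)[OF AB(1)]] by auto
  qed
  let ?e = "\<lambda>B. \<Sum>D\<in>Irr UNIV. t B D * \<phi> (rep D)"
  have unit: "(\<Sum>B\<in>Irr UNIV. t B E) = (if E = iso_class \<I> then 1 else 0)" if "E \<in> Irr UNIV" for E
  proof (rule psi_separates[OF _ that])
    fix A assume A: "A \<in> Irr UNIV"
    have "(\<Sum>D\<in>Irr UNIV. (\<Sum>B\<in>Irr UNIV. t B D) * psi A (rep D))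
        = (\<Sum>B\<in>Irr UNIV. \<Sum>D\<in>Irr UNIV. t B D * psi A (rep D))"
      unfolding sum_distrib_right by (rule sum.swap)
    also have "\<dots> = (\<Sum>B\<in>Irr UNIV. if A = B then 1 else 0)"
      using t[OF A] by (intro sum.cong) auto
    also have "\<dots> = 1" using finite_Irr A by simp
    also have "\<dots> = (\<Sum>B\<in>Irr UNIV. if B = iso_class \<I> then psi A (rep B) else 0)"
      using finite_Irr unit_in_Irr psi_unit_rep[OF A] by simp
    also have "\<dots> = (\<Sum>B\<in>Irr UNIV. (if B = iso_class \<I> then 1 else 0) * psi A (rep B))"
      by (intro sum.cong) auto
    finally show "(\<Sum>D\<in>Irr UNIV. (\<Sum>B\<in>Irr UNIV. t B D) * psi A (rep D))
        = (\<Sum>B\<in>Irr UNIV. (if B = iso_class \<I> then 1 else 0) * psi A (rep B))" .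
  qed
  have "(\<Sum>B\<in>Irr UNIV. ?e B) = (\<Sum>D\<in>Irr UNIV. (\<Sum>B\<in>Irr UNIV. t B D) * \<phi> (rep D))"
    unfolding sum_distrib_right by (rule sum.swap)
  also have "\<dots> = (\<Sum>D\<in>Irr UNIV. if D = iso_class \<I> then \<phi> (rep D) else 0)"
    using unit by (intro sum.cong) auto
  also have "\<dots> = 1"
    using finite_Irr unit_in_Irr assms(3) additive_isomorphic[OF assms(1) rep_iso_class[of \<I>]] by simp
  finally have "(\<Sum>B\<in>Irr UNIV. ?e B) \<noteq> 0" by simp
  then obtain B where B: "B \<in> Irr UNIV" "?e B \<noteq> 0"
    by (rule sum.not_neutral_contains_not_neutral)
  have "\<phi> X = psi B X" for X
  proof -
    let ?c = "\<lambda>E. \<Sum>D\<in>Irr UNIV. t B D * of_nat (multiplicity (X \<odot> rep D) E)"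
    have "?c E = psi B X * t B E" if "E \<in> Irr UNIV" for E
    proof (rule psi_separates[OF _ that])
      fix A assume A: "A \<in> Irr UNIV"
      have "(\<Sum>E\<in>Irr UNIV. ?c E * psi A (rep E)) = psi A X * (if A = B then 1 else 0)"
        using additive_times_combination[OF additive_psi psi_tensor[OF A], of X "t B"] t[OF A B(1)] by simp
      also have "\<dots> = psi B X * (if A = B then 1 else 0)" by simp
      also have "\<dots> = (\<Sum>E\<in>Irr UNIV. (psi B X * t B E) * psi A (rep E))"
        using t[OF A B(1)] by (simp add: mult.assoc flip: sum_distrib_left)
      finally show "(\<Sum>E\<in>Irr UNIV. ?c E * psi A (rep E)) = (\<Sum>E\<in>Irr UNIV. (psi B X * t B E) * psi A (rep E))" .
    qed
    then have "\<phi> X * ?e B = psi B X * ?e B"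
      unfolding additive_times_combination[OF assms(1,2)] by (simp add: sum_distrib_left mult.assoc)
    then show ?thesis using B(2) by simp
  qed
  then show thesis using that B(1) by blast
qed

lemma S_ob_isomorphic_left: "isomorphic X X' \<Longrightarrow> S_ob X Y = S_ob X' Y"
  using S_ob_isomorphic S_ob_sym by metis

lemma psi_iso_class: "psi (iso_class Y) X = S_ob Y X / S_ob Y \<I>"
  unfolding psi_def using S_ob_isomorphic_left[OF rep_iso_class] by metis

lemma psi_unit_dual: "psi (iso_class \<I>) (D X) = psi (iso_class \<I>) X"
  by (simp add: psi_iso_class S_ob_unit_dual)

lemma simple_invertible_if_trivial_on_adjoint:
  assumes A: "A \<in> Irr UNIV"
    and triv: "\<And>X. simple X \<Longrightarrow> psi A (X \<odot> D X) = psi (iso_class \<I>) (X \<odot> D X)"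
  shows "invertible_in UNIV (rep A)"
proof -
  let ?o = "iso_class \<I>"
  let ?\<phi> = "\<lambda>X. psi A (D X)"
  have "additive ?\<phi>"
    unfolding additive_def
  proof (intro allI impI)
    fix X Xs assume "direct_sum X Xs"
    then have "direct_sum (D X) (map D Xs)" by (rule direct_sum_dual)
    then have "psi A (D X) = (\<Sum>j<length (map D Xs). psi A (map D Xs ! j))"
      using additive_psi unfolding additive_def by blast
    then show "psi A (D X) = (\<Sum>j<length Xs. psi A (D (Xs ! j)))" by simp
  qed
  moreover have "?\<phi> (X \<odot> Y) = ?\<phi> X * ?\<phi> Y" for X Y
    using psi_isomorphic[OF isomorphic_dual_tensor] psi_tensor[OF A] by simp
  moreover have "?\<phi> \<I> = 1"
    using psi_isomorphic[OF isomorphic_dual_unit] psi_unit[OF A] by simp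
  ultimately obtain B where B: "B \<in> Irr UNIV" "\<And>X. psi A (D X) = psi B X"
    using character_is_psi by blast
  let ?W = "rep A \<odot> rep B"
  define c where "c = S_ob (rep A) \<I> * S_ob (rep B) \<I> / (S_ob \<I> \<I> * S_ob \<I> \<I>)"
  have c0: "c \<noteq> 0"
    using S_unit_nonzero Irr_rep(1) A B(1) unit_simple by (simp add: c_def)
  have W: "psi E ?W = c" if E: "E \<in> Irr UNIV" for E
  proof -
    let ?X = "rep E"
    have X: "simple ?X" by (rule Irr_rep(1)[OF E])
    have n: "S_ob ?X \<I> \<noteq> 0" "S_ob (rep A) \<I> \<noteq> 0" "S_ob (rep B) \<I> \<noteq> 0" "S_ob \<I> \<I> \<noteq> 0"
      using S_unit_nonzero X Irr_rep(1) A B(1) unit_simple by auto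
    have "psi A ?X * psi B ?X = psi A (?X \<odot> D ?X)" using B(2) psi_tensor[OF A] by simp
    also have "\<dots> = psi ?o ?X * psi ?o ?X"
      using triv[OF X] psi_tensor[OF unit_in_Irr] psi_unit_dual by simp
    finally have "S_ob ?X (rep A) / S_ob (rep A) \<I> * (S_ob ?X (rep B) / S_ob (rep B) \<I>)
        = S_ob ?X \<I> / S_ob \<I> \<I> * (S_ob ?X \<I> / S_ob \<I> \<I>)"
      unfolding psi_iso_class by (simp add: psi_def S_ob_sym[of _ ?X])
    then have "S_ob ?X (rep A) * S_ob ?X (rep B) = c * S_ob ?X \<I> * S_ob ?X \<I>"
      using n by (simp add: c_def field_simps)
    then have "S_ob ?X ?W = c * S_ob ?X \<I>"
      using S_ob_tensor[OF X, of "rep A" "rep B"] n(1) by simp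
    then show ?thesis using n(1) by (simp add: psi_def)
  qed
  have m: "of_nat (multiplicity ?W F) = (if F = ?o then c else 0)" if "F \<in> Irr UNIV" for F
  proof (rule psi_separates[OF _ that])
    fix E assume E: "E \<in> Irr UNIV"
    have "(\<Sum>F\<in>Irr UNIV. of_nat (multiplicity ?W F) * psi E (rep F)) = c"
      using additive_multiplicity[OF additive_psi, of E ?W] W[OF E] by simp
    also have "\<dots> = (\<Sum>F\<in>Irr UNIV. if F = ?o then c * psi E (rep F) else 0)"
      using finite_Irr unit_in_Irr psi_unit_rep[OF E] by simp
    also have "\<dots> = (\<Sum>F\<in>Irr UNIV. (if F = ?o then c else 0) * psi E (rep F))"
      by (intro sum.cong) auto
    finally show "(\<Sum>F\<in>Irr UNIV. of_nat (multiplicity ?W F) * psi E (rep F))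
        = (\<Sum>F\<in>Irr UNIV. (if F = ?o then c else 0) * psi E (rep F))" .
  qed
  let ?Ys = "decomposition ?W"
  have "multiplicity ?W ?o \<noteq> 0" using m[OF unit_in_Irr] c0 by auto
  then have n: "length ?Ys \<noteq> 0" unfolding multiplicity_def by (cases "length ?Ys") auto
  have "isomorphic (?Ys ! j) \<I>" if j: "j < length ?Ys" for j
  proof -
    let ?F = "iso_class (?Ys ! j)"
    have "?F \<in> Irr UNIV" by (rule iso_class_in_Irr[OF decomposition(1)[OF nth_mem[OF j]]])
    moreover have "multiplicity ?W ?F \<noteq> 0" using j unfolding multiplicity_def by auto
    ultimately have "?F = ?o" using m[of ?F] by (auto split: if_splits)
    then show ?thesis by (simp add: iso_class_eq)
  qed
  then have "direct_sum ?W (replicate (length ?Ys) \<I>)"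
    by (intro direct_sum_cong[OF decomposition(2)]) auto
  then have 1: "isomorphic ?W \<I>"
    using isomorphic_unit_if_simples[OF Irr_rep(1)[OF A] simple_dual[OF Irr_rep(1)[OF B(1)]] _ n] by blast
  moreover have "isomorphic (rep B \<odot> rep A) ?W"
    using braid_iso isomorphic_def by blast
  ultimately show ?thesis
    using isomorphic_trans unfolding invertible_in_def by blast
qed

lemma combination_vanishing_at_noninvertibles:
  assumes "finite Q" "Q \<subseteq> {A\<in>Irr UNIV. \<not> invertible_in UNIV (rep A)}"
  shows "\<exists>c. (\<forall>B\<in>Irr UNIV. c B \<noteq> 0 \<longrightarrow> rep B \<in> adjoint_subcategory) \<and>
    (\<forall>A\<in>Q. (\<Sum>B\<in>Irr UNIV. c B * psi A (rep B)) = 0) \<and>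
    (\<Sum>B\<in>Irr UNIV. c B * psi (iso_class \<I>) (rep B)) \<noteq> 0"
  using assms
proof (induction Q rule: finite_induct)
  case empty
  let ?c = "\<lambda>B. if B = iso_class \<I> then 1 else 0 :: 'k"
  have "(\<Sum>B\<in>Irr UNIV. ?c B * psi (iso_class \<I>) (rep B))
      = (\<Sum>B\<in>Irr UNIV. if B = iso_class \<I> then psi (iso_class \<I>) (rep B) else 0)"
    by (intro sum.cong) auto
  also have "\<dots> = 1" using finite_Irr unit_in_Irr psi_unit_rep by simp
  finally have "(\<Sum>B\<in>Irr UNIV. ?c B * psi (iso_class \<I>) (rep B)) \<noteq> 0" by simp
  moreover have "rep (iso_class \<I>) \<in> adjoint_subcategory"
    using fusion_subcategory_isomorphic[OF fusion_subcategory_adjoint _ rep_iso_class]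
      fusion_subcategory_adjoint unfolding fusion_subcategory_def by blast
  ultimately show ?case by (intro exI[of _ ?c]) auto
next
  case (insert A Q)
  then obtain c where c: "\<And>B. B \<in> Irr UNIV \<Longrightarrow> c B \<noteq> 0 \<Longrightarrow> rep B \<in> adjoint_subcategory"
    "\<And>A. A \<in> Q \<Longrightarrow> (\<Sum>B\<in>Irr UNIV. c B * psi A (rep B)) = 0"
    "(\<Sum>B\<in>Irr UNIV. c B * psi (iso_class \<I>) (rep B)) \<noteq> 0" by blast
  have A: "A \<in> Irr UNIV" "\<not> invertible_in UNIV (rep A)" using insert.prems by auto
  then obtain X where X: "simple X" "psi A (X \<odot> D X) \<noteq> psi (iso_class \<I>) (X \<odot> D X)"
    using simple_invertible_if_trivial_on_adjoint by blast
  let ?Z = "X \<odot> D X"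
  define c' where "c' E = (\<Sum>B\<in>Irr UNIV. c B * of_nat (multiplicity (?Z \<odot> rep B) E)) - psi A ?Z * c E" for E
  have val: "(\<Sum>E\<in>Irr UNIV. c' E * psi A' (rep E))
      = (psi A' ?Z - psi A ?Z) * (\<Sum>B\<in>Irr UNIV. c B * psi A' (rep B))" if "A' \<in> Irr UNIV" for A'
    unfolding left_diff_distrib additive_times_combination[OF additive_psi psi_tensor[OF that]]
    by (simp add: c'_def left_diff_distrib sum_subtractf sum_distrib_left mult.assoc)
  note ad = fusion_subcategory_adjoint
  have "rep E \<in> adjoint_subcategory" if E: "E \<in> Irr UNIV" "c' E \<noteq> 0" for E
  proof (cases "c E = 0")
    case True
    then have "(\<Sum>B\<in>Irr UNIV. c B * of_nat (multiplicity (?Z \<odot> rep B) E)) \<noteq> 0" using E(2) by (simp add: c'_def)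
    then obtain B where B: "B \<in> Irr UNIV" "c B * of_nat (multiplicity (?Z \<odot> rep B) E) \<noteq> 0"
      by (rule sum.not_neutral_contains_not_neutral)
    then have "?Z \<odot> rep B \<in> adjoint_subcategory"
      using c(1)[OF B(1)] tensor_dual_in_adjoint[OF X(1)] ad unfolding fusion_subcategory_def by auto
    moreover have "multiplicity (?Z \<odot> rep B) E \<noteq> 0" using B(2) by auto
    ultimately show ?thesis
      using fusion_subcategory_summand[OF ad _ Irr_rep(1)[OF E(1)]] multiplicity_nonzero by metis
  qed (use c(1) E in blast)
  moreover have "(\<Sum>E\<in>Irr UNIV. c' E * psi A' (rep E)) = 0" if "A' \<in> insert A Q" for A'
  proof -
    have "A' \<in> Irr UNIV" using that insert.prems by blast
    then show ?thesis using val c(2) that by auto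
  qed
  moreover have "(\<Sum>E\<in>Irr UNIV. c' E * psi (iso_class \<I>) (rep E)) \<noteq> 0"
    using val[OF unit_in_Irr] c(3) X(2) by simp
  ultimately show ?case by (intro exI[of _ c']) blast
qed

lemma transparent_to_invertibles_in_adjoint:
  assumes "simple g"
    and triv: "\<And>h. invertible_in UNIV h \<Longrightarrow> braid g h \<cdot> braid h g = ident C (h \<odot> g)"
  shows "g \<in> adjoint_subcategory"
proof -
  let ?o = "iso_class \<I>"
  let ?Q = "{A\<in>Irr UNIV. \<not> invertible_in UNIV (rep A)}"
  have "finite ?Q" using finite_Irr by simp
  then obtain c where c: "\<And>B. B \<in> Irr UNIV \<Longrightarrow> c B \<noteq> 0 \<Longrightarrow> rep B \<in> adjoint_subcategory"
    "\<And>A. A \<in> ?Q \<Longrightarrow> (\<Sum>B\<in>Irr UNIV. c B * psi A (rep B)) = 0"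
    "(\<Sum>B\<in>Irr UNIV. c B * psi ?o (rep B)) \<noteq> 0"
    using combination_vanishing_at_noninvertibles[of ?Q] by blast
  have inv: "psi A g = psi ?o g" if A: "A \<in> Irr UNIV" "invertible_in UNIV (rep A)" for A
  proof -
    let ?h = "rep A"
    have "S_ob ?h g = S_ob \<I> (?h \<odot> g)"
      using triv[OF A(2)] by (simp add: S_ob_def[of ?h] S_ob_sym[of \<I>] S_ob_unit)
    then have "S_ob ?h g * S_ob \<I> \<I> = S_ob ?h \<I> * S_ob \<I> g"
      using S_ob_tensor[OF unit_simple, of ?h g] by (simp add: S_ob_sym[of \<I> ?h])
    then show ?thesis
      using S_unit_nonzero[OF unit_simple] S_unit_nonzero[OF Irr_rep(1)[OF A(1)]]
      by (simp add: psi_iso_class) (simp add: psi_def field_simps)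
  qed
  have "(\<Sum>B\<in>Irr UNIV. c B * of_nat (multiplicity (g \<odot> rep B) E)) = psi ?o g * c E"
    if "E \<in> Irr UNIV" for E
  proof (rule psi_separates[OF _ that])
    fix A assume A: "A \<in> Irr UNIV"
    have "psi A g * (\<Sum>B\<in>Irr UNIV. c B * psi A (rep B)) = psi ?o g * (\<Sum>B\<in>Irr UNIV. c B * psi A (rep B))"
      using inv[OF A] c(2)[of A] A by (cases "invertible_in UNIV (rep A)") auto
    then show "(\<Sum>E\<in>Irr UNIV. (\<Sum>B\<in>Irr UNIV. c B * of_nat (multiplicity (g \<odot> rep B) E)) * psi A (rep E))
        = (\<Sum>E\<in>Irr UNIV. psi ?o g * c E * psi A (rep E))"
      unfolding additive_times_combination[OF additive_psi psi_tensor[OF A]]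
      by (simp add: sum_distrib_left mult.assoc)
  qed
  moreover obtain E where E: "E \<in> Irr UNIV" "c E * psi ?o (rep E) \<noteq> 0"
    using c(3) by (rule sum.not_neutral_contains_not_neutral)
  moreover from E have cE: "c E \<noteq> 0" by auto
  moreover have "psi ?o g \<noteq> 0"
    using S_unit_nonzero[OF assms(1)] S_unit_nonzero[OF unit_simple] by (simp add: psi_iso_class S_ob_sym[of \<I> g])
  ultimately have "(\<Sum>B\<in>Irr UNIV. c B * of_nat (multiplicity (g \<odot> rep B) E)) \<noteq> 0" by simp
  then obtain B where B: "B \<in> Irr UNIV" "c B * of_nat (multiplicity (g \<odot> rep B) E) \<noteq> 0"
    by (rule sum.not_neutral_contains_not_neutral)
  then have "multiplicity (g \<odot> rep B) E \<noteq> 0" "c B \<noteq> 0" by auto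
  then obtain p where p: "p \<in> Hom C (g \<odot> rep B) (rep E)" "p \<noteq> 0" by (metis multiplicity_nonzero)
  obtain f where f: "f \<in> Hom C g (rep E \<odot> D (rep B))" "f \<noteq> 0" using Hom_tensor_nonzero[OF p] .
  have "rep E \<odot> D (rep B) \<in> adjoint_subcategory"
    using c(1)[OF E(1) cE] c(1)[OF B(1) \<open>c B \<noteq> 0\<close>] fusion_subcategory_adjoint
    unfolding fusion_subcategory_def by blast
  then show ?thesis
    using fusion_subcategory_summand[OF fusion_subcategory_adjoint _ assms(1) f] by blast
qed

end

section \<open>The pointed subcategory\<close>

lemma (in comm_group) pow_card_subgroup:
  assumes "subgroup K G" "finite K" "k \<in> K"
  shows "k [^] card K = \<one>"
proof -
  interpret K: group "G\<lparr>carrier := K\<rparr>" by (rule subgroup_imp_group[OF assms(1)])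
  interpret K: comm_group "G\<lparr>carrier := K\<rparr>"
    by (rule K.group_comm_groupI) (use subgroup.subset[OF assms(1)] m_comm in auto)
  have "k [^]\<^bsub>G\<lparr>carrier := K\<rparr>\<^esub> card K = \<one>"
    using K.power_order_eq_one[of k] assms by simp
  then show ?thesis by (simp add: nat_pow_consistent[symmetric])
qed

lemma (in comm_group) torsion_subgroup: "subgroup {x \<in> carrier G. x [^] (m :: nat) = \<one>} G"
  by (rule subgroupI) (auto simp: nat_pow_distrib nat_pow_inv)

lemma (in comm_group) torsion_complement:
  fixes m :: nat
  assumes fin: "finite (carrier G)" and sub: "subgroup K G"
    and m: "m = card (carrier G) div card K" and cop: "coprime (card K) m"
  defines "H \<equiv> {x \<in> carrier G. x [^] m = \<one>}"
  shows torsion_complement_Int: "H \<inter> K = {\<one>}"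
    and torsion_complement_generates: "x \<in> carrier G \<Longrightarrow> \<exists>k\<in>K. \<exists>h\<in>H. x = k \<otimes> h"
    and card_torsion_complement: "card H = card (rcosets K)"
proof -
  let ?n = "card K"
  have K: "K \<subseteq> carrier G" "finite K" using sub fin subgroup.subset finite_subset by blast+
  have n0: "?n > 0" using K sub subgroup.one_closed card_gt_0_iff by blast
  have idx: "card (rcosets K) = m" "card (carrier G) = m * ?n"
    using lagrange[OF sub] m n0 unfolding Coset.order_def
    by (metis nonzero_mult_div_cancel_right not_gr_zero)+
  interpret N: normal K G by (rule subgroup_imp_normal[OF sub])
  interpret Q: comm_group "G Mod K" by (rule abelian_FactGroup[OF sub])
  obtain u v :: int where uv: "u * int ?n + v * int m = 1"
    using bezout_int[of "int ?n" "int m"] cop by (metis coprime_imp_gcd_eq_1 gcd_int_int_eq of_nat_1)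
  have split: "x = (x [^] m) [^] v \<otimes> (x [^] ?n) [^] u" if x: "x \<in> carrier G" for x
  proof -
    have "x = x [^] (v * int m + u * int ?n)" using uv x by (simp add: add.commute)
    also have "\<dots> = x [^] (int m * v) \<otimes> x [^] (int ?n * u)" using x by (simp add: int_pow_mult mult.commute)
    also have "\<dots> = (x [^] m) [^] v \<otimes> (x [^] ?n) [^] u" using x by (simp add: int_pow_pow[symmetric] int_pow_int)
    finally show ?thesis .
  qed
  show Int: "H \<inter> K = {\<one>}"
  proof
    show "H \<inter> K \<subseteq> {\<one>}"
    proof
      fix x assume x: "x \<in> H \<inter> K"
      then have "x \<in> carrier G" "x [^] m = \<one>" "x [^] ?n = \<one>"
        using pow_card_subgroup[OF sub K(2)] by (auto simp: H_def)
      then show "x \<in> {\<one>}" using split[of x] by simp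
    qed
    show "{\<one>} \<subseteq> H \<inter> K" using sub subgroup.one_closed by (auto simp: H_def)
  qed
  have gen: "\<exists>k\<in>K. \<exists>h\<in>H. x = k \<otimes> h" if x: "x \<in> carrier G" for x
  proof -
    have car: "carrier (G Mod K) = rcosets K" by (simp add: FactGroup_def)
    have "finite (rcosets K)" using fin by (simp add: RCOSETS_def)
    then have "(K #> x) [^]\<^bsub>G Mod K\<^esub> m = \<one>\<^bsub>G Mod K\<^esub>"
      using Q.power_order_eq_one[of "K #> x"] rcosetsI[OF K(1) x] by (simp add: car idx(1))
    then have "K #> (x [^] m) = K" using N.FactGroup_pow[OF x] by simp
    then have xm: "x [^] m \<in> K" using coset_join1 sub x by blast
    have xn: "x [^] ?n \<in> H"
    proof -
      have "(x [^] ?n) [^] m = x [^] card (carrier G)" using x idx(2) by (simp add: nat_pow_pow mult.commute)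
      then show ?thesis using x power_order_eq_one[OF fin] by (simp add: H_def)
    qed
    have H: "subgroup H G" unfolding H_def by (rule torsion_subgroup)
    note split[OF x]
    moreover have "(x [^] m) [^] v \<in> K" "(x [^] ?n) [^] u \<in> H"
      using subgroup_int_pow_closed xm xn sub H by auto
    ultimately show ?thesis by blast
  qed
  then show "x \<in> carrier G \<Longrightarrow> \<exists>k\<in>K. \<exists>h\<in>H. x = k \<otimes> h" .
  have "bij_betw (\<lambda>h. K #> h) H (rcosets K)"
    unfolding bij_betw_def
  proof
    have H: "subgroup H G" unfolding H_def by (rule torsion_subgroup)
    show "inj_on (\<lambda>h. K #> h) H"
    proof
      fix h h' assume hh: "h \<in> H" "h' \<in> H" "K #> h = K #> h'"
      then have c: "h \<in> carrier G" "h' \<in> carrier G" by (auto simp: H_def)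
      have "h \<in> K #> h'" using rcos_self[OF c(1) sub] hh(3) by simp
      then obtain k where k: "k \<in> K" "h = k \<otimes> h'" unfolding r_coset_def by blast
      then have "k = h \<otimes> inv h'" using c K(1) by (simp add: m_assoc subsetD)
      then have "k \<in> H" using H hh(1,2) by (simp add: subgroup.m_closed subgroup.m_inv_closed)
      then have "k = \<one>" using k(1) Int by blast
      then show "h = h'" using k c by simp
    qed
    show "(\<lambda>h. K #> h) ` H = rcosets K"
    proof
      show "(\<lambda>h. K #> h) ` H \<subseteq> rcosets K" by (auto simp: H_def RCOSETS_def)
      show "rcosets K \<subseteq> (\<lambda>h. K #> h) ` H"
      proof
        fix c assume "c \<in> rcosets K"
        then obtain x where x: "x \<in> carrier G" "c = K #> x" unfolding RCOSETS_def by blast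
        obtain k h where kh: "k \<in> K" "h \<in> H" "x = k \<otimes> h" using gen[OF x(1)] by blast
        have "K #> (k \<otimes> h) = (K #> k) #> h"
          using kh K(1) by (subst coset_mult_assoc) (auto simp: H_def)
        then show "c \<in> (\<lambda>h. K #> h) ` H"
          using kh x coset_join2[OF _ sub kh(1)] K(1) by auto
      qed
    qed
  qed
  then show "card H = card (rcosets K)" by (rule bij_betw_same_card)
qed

lemma power_coprime_eq_1:
  fixes z :: "'a :: monoid_mult"
  assumes "z ^ m = 1" "z ^ n = 1" "coprime m n"
  shows "z = 1"
proof (cases "m = 0")
  case True
  then show ?thesis using assms by simp
next
  case False
  then obtain x y where "m * x = n * y + 1" using bezout_nat[of m n] assms(3) by auto
  then have "z ^ (m * x) = z ^ (n * y) * z" by (simp only: power_add power_one_right)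
  then show ?thesis using assms(1,2) by (simp add: power_mult)
qed

context fusion_category
begin

abbreviation invertible :: "'o \<Rightarrow> bool" where "invertible \<equiv> invertible_in UNIV"

lemma invertible_iff: "invertible X \<longleftrightarrow> (\<exists>Y. isomorphic (X \<odot> Y) \<I> \<and> isomorphic (Y \<odot> X) \<I>)"
  by (simp add: invertible_in_def)

lemma simple_if_invertible: "invertible X \<Longrightarrow> simple X"
  using invertible_simple unfolding invertible_iff by blast

lemma invertible_unit: "invertible \<I>"
  using isomorphic_left_unit invertible_iff by blast

lemma isomorphic_tensor_middle:
  assumes "isomorphic (Y \<odot> Z) \<I>" "isomorphic (X \<odot> W) \<I>"
  shows "isomorphic ((X \<odot> Y) \<odot> (Z \<odot> W)) \<I>"
proof -
  have "isomorphic (Y \<odot> (Z \<odot> W)) W"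
    using isomorphic_trans[OF isomorphic_sym[OF isomorphic_assoc]
      isomorphic_trans[OF isomorphic_tensor[OF assms(1) isomorphic_refl] isomorphic_left_unit]] .
  then show ?thesis
    using isomorphic_trans[OF isomorphic_assoc
      isomorphic_trans[OF isomorphic_tensor[OF isomorphic_refl] assms(2)]] by blast
qed

lemma invertible_tensor:
  assumes "invertible X" "invertible Y"
  shows "invertible (X \<odot> Y)"
proof -
  obtain X' Y' where "isomorphic (X \<odot> X') \<I>" "isomorphic (X' \<odot> X) \<I>"
    "isomorphic (Y \<odot> Y') \<I>" "isomorphic (Y' \<odot> Y) \<I>"
    using assms unfolding invertible_iff by blast
  then show ?thesis
    unfolding invertible_iff by (intro exI[of _ "Y' \<odot> X'"] conjI isomorphic_tensor_middle)
qed

lemma iso_class_carrier: "iso_class X \<in> carrier (inv_group UNIV) \<longleftrightarrow> invertible X"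
proof
  assume "iso_class X \<in> carrier (inv_group UNIV)"
  then obtain Y where Y: "invertible Y" "isomorphic X Y"
    by (auto simp: inv_group_def iso_class_eq)
  then obtain Z where "isomorphic (Y \<odot> Z) \<I>" "isomorphic (Z \<odot> Y) \<I>" unfolding invertible_iff by blast
  then show "invertible X"
    using Y(2) isomorphic_trans[OF isomorphic_tensor] isomorphic_refl unfolding invertible_iff by blast
qed (auto simp: inv_group_def)

lemma carrierE:
  assumes "A \<in> carrier (inv_group UNIV)"
  obtains X where "A = iso_class X" "invertible X"
  using assms that by (auto simp: inv_group_def)

lemma inv_group_one: "\<one>\<^bsub>inv_group K\<^esub> = iso_class \<I>"
  by (simp add: inv_group_def)

lemma inv_group_mult: "iso_class X \<otimes>\<^bsub>inv_group K\<^esub> iso_class Y = iso_class (X \<odot> Y)"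
proof -
  have "(\<exists>X'\<in>iso_class X. \<exists>Y'\<in>iso_class Y. isomorphic (X' \<odot> Y') Z) \<longleftrightarrow> isomorphic (X \<odot> Y) Z" for Z
  proof
    assume "\<exists>X'\<in>iso_class X. \<exists>Y'\<in>iso_class Y. isomorphic (X' \<odot> Y') Z"
    then obtain X' Y' where "isomorphic X X'" "isomorphic Y Y'" "isomorphic (X' \<odot> Y') Z"
      unfolding Bex_def iso_class_mem by blast
    then show "isomorphic (X \<odot> Y) Z" using isomorphic_trans[OF isomorphic_tensor] by blast
  next
    assume "isomorphic (X \<odot> Y) Z"
    then show "\<exists>X'\<in>iso_class X. \<exists>Y'\<in>iso_class Y. isomorphic (X' \<odot> Y') Z"
      using isomorphic_refl iso_class_mem by blast
  qed
  then show ?thesis by (simp add: inv_group_def iso_class_def)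
qed

lemma finite_inv_group: "finite (carrier (inv_group UNIV))"
proof (rule finite_subset[OF _ finite_Irr])
  show "carrier (inv_group UNIV) \<subseteq> Irr UNIV"
    using simple_if_invertible iso_class_in_Irr by (auto elim!: carrierE)
qed

end

context braided_fusion_category
begin

lemma isomorphic_commute: "isomorphic (X \<odot> Y) (Y \<odot> X)"
  using braid_iso isomorphic_def by blast

lemma comm_group_inv_group: "comm_group (inv_group UNIV)"
proof (rule comm_groupI)
  fix A assume "A \<in> carrier (inv_group UNIV)"
  then obtain X where X: "A = iso_class X" "invertible X" by (rule carrierE)
  then obtain Y where Y: "isomorphic (X \<odot> Y) \<I>" "isomorphic (Y \<odot> X) \<I>" unfolding invertible_iff by blast
  then have "invertible Y" unfolding invertible_iff by blast
  then show "\<exists>B\<in>carrier (inv_group UNIV). B \<otimes>\<^bsub>inv_group UNIV\<^esub> A = \<one>\<^bsub>inv_group UNIV\<^esub>"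
    using X Y by (intro bexI[of _ "iso_class Y"])
      (auto simp: inv_group_mult inv_group_one iso_class_eq iso_class_carrier)
qed ((elim carrierE)?; simp add: inv_group_mult inv_group_one iso_class_eq iso_class_carrier
    invertible_tensor invertible_unit isomorphic_assoc isomorphic_commute isomorphic_left_unit)+

lemma scalar_monodromy_exists:
  assumes "invertible X" "invertible Y"
  obtains c where "scalar_monodromy X Y c"
  using End_simple[OF simple_if_invertible[OF invertible_tensor[OF assms]] monodromy_in_Hom]
  unfolding scalar_monodromy_def by blast

lemma scalar_monodromy_unit: "scalar_monodromy X \<I> 1"
  by (simp add: scalar_monodromy_def monodromy_unit)

definition bichar :: "'o set \<Rightarrow> 'o set \<Rightarrow> 'k" where
  "bichar A B = (THE c. scalar_monodromy (rep A) (rep B) c)"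

lemma invertible_rep: "invertible X \<Longrightarrow> invertible (rep (iso_class X))"
  using iso_class_carrier[of X] iso_class_carrier[of "rep (iso_class X)"] iso_class_eq rep_iso_class by metis

lemma bichar_eqI:
  assumes "invertible X" "invertible Y" "scalar_monodromy X Y c"
  shows "bichar (iso_class X) (iso_class Y) = c"
proof -
  let ?X = "rep (iso_class X)" and ?Y = "rep (iso_class Y)"
  have "scalar_monodromy ?X ?Y c"
    using scalar_monodromy_isomorphic[OF scalar_monodromy_sym[OF
      scalar_monodromy_isomorphic[OF scalar_monodromy_sym[OF assms(3)] rep_iso_class[of X]]] rep_iso_class[of Y]] .
  moreover have "simple (?X \<odot> ?Y)"
    using simple_if_invertible invertible_tensor invertible_rep assms by blast
  ultimately show ?thesis
    unfolding bichar_def using scalar_monodromy_unique by blast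
qed

lemma scalar_monodromy_bichar:
  assumes "invertible X" "invertible Y"
  shows "scalar_monodromy X Y (bichar (iso_class X) (iso_class Y))"
  using scalar_monodromy_exists[OF assms] bichar_eqI[OF assms] by metis

lemma bichar_sym:
  assumes "A \<in> carrier (inv_group UNIV)" "B \<in> carrier (inv_group UNIV)"
  shows "bichar A B = bichar B A"
  using assms by (elim carrierE) (simp add: bichar_eqI scalar_monodromy_sym scalar_monodromy_bichar)

lemma bichar_mult:
  assumes "A \<in> carrier (inv_group UNIV)" "B \<in> carrier (inv_group UNIV)" "E \<in> carrier (inv_group UNIV)"
  shows "bichar A (B \<otimes>\<^bsub>inv_group UNIV\<^esub> E) = bichar A B * bichar A E"
  using assms
  by (elim carrierE)
     (simp add: inv_group_mult bichar_eqI invertible_tensor scalar_monodromy_tensor scalar_monodromy_bichar)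

lemma bichar_one: "A \<in> carrier (inv_group UNIV) \<Longrightarrow> bichar A \<one>\<^bsub>inv_group UNIV\<^esub> = 1"
  by (elim carrierE) (simp add: inv_group_one bichar_eqI invertible_unit scalar_monodromy_unit)

lemma bichar_pow:
  assumes "A \<in> carrier (inv_group UNIV)" "B \<in> carrier (inv_group UNIV)"
  shows "bichar A (B [^]\<^bsub>inv_group UNIV\<^esub> (k :: nat)) = bichar A B ^ k"
proof -
  interpret P: comm_group "inv_group UNIV" by (rule comm_group_inv_group)
  show ?thesis
    by (induction k) (simp_all add: assms bichar_one bichar_mult)
qed

end

context premodular_category
begin

text \<open>The full subcategory of direct sums of objects with classes in \<open>H\<close>.\<close>

definition pointed_sub :: "'o set set \<Rightarrow> 'o set" where
  "pointed_sub H = {X. \<forall>W f. simple W \<and> f \<in> Hom C W X \<and> f \<noteq> 0 \<longrightarrow> iso_class W \<in> H}"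

lemma pointed_subD: "X \<in> pointed_sub H \<Longrightarrow> simple W \<Longrightarrow> f \<in> Hom C W X \<Longrightarrow> f \<noteq> 0 \<Longrightarrow> iso_class W \<in> H"
  by (auto simp: pointed_sub_def)

lemma simple_in_pointed_sub:
  assumes "simple W"
  shows "W \<in> pointed_sub H \<longleftrightarrow> iso_class W \<in> H"
proof
  have "ident C W \<noteq> 0" using assms by (simp add: simple_def)
  then show "W \<in> pointed_sub H \<Longrightarrow> iso_class W \<in> H"
    using pointed_subD[OF _ assms ident_in_Hom] by blast
  have "iso_class V = iso_class W" if "simple V" "f \<in> Hom C V W" "f \<noteq> 0" for V f
    using schur_isomorphic[OF that(1) assms that(2,3)] by (simp add: iso_class_eq)
  then show "iso_class W \<in> H \<Longrightarrow> W \<in> pointed_sub H"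
    unfolding pointed_sub_def by auto
qed

lemma direct_sum_in_pointed_sub:
  assumes "direct_sum X Ys"
  shows "X \<in> pointed_sub H \<longleftrightarrow> set Ys \<subseteq> pointed_sub H"
proof
  assume X: "X \<in> pointed_sub H"
  show "set Ys \<subseteq> pointed_sub H"
  proof
    fix Y assume "Y \<in> set Ys"
    then obtain j where j: "j < length Ys" "Y = Ys ! j" by (auto simp: in_set_conv_nth)
    obtain i p where ip: "i \<in> Hom C Y X" "p \<in> Hom C X Y" "p \<cdot> i = ident C Y"
      using direct_sum_incl[OF assms j(1)] j(2) by blast
    have "iso_class W \<in> H" if W: "simple W" "f \<in> Hom C W Y" "f \<noteq> 0" for W f
    proof -
      have "p \<cdot> (i \<cdot> f) = f" using cmp_assoc[OF W(2) ip(1,2)] ip(3) ident_cmp[OF W(2)] by simp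
      then have "i \<cdot> f \<noteq> 0" using W(3) cmp_zero[OF ip(2)] by metis
      then show ?thesis using pointed_subD[OF X W(1) cmp_in_Hom[OF W(2) ip(1)]] by blast
    qed
    then show "Y \<in> pointed_sub H" by (auto simp: pointed_sub_def)
  qed
next
  assume Ys: "set Ys \<subseteq> pointed_sub H"
  have "iso_class W \<in> H" if W: "simple W" "f \<in> Hom C W X" "f \<noteq> 0" for W f
  proof -
    obtain j p where "j < length Ys" "p \<in> Hom C X (Ys ! j)" "p \<cdot> f \<noteq> 0"
      using direct_sum_component_nonzero[OF assms W(2,3)] .
    then show ?thesis using Ys pointed_subD[OF _ W(1) cmp_in_Hom[OF W(2)]] nth_mem by blast
  qed
  then show "X \<in> pointed_sub H" by (auto simp: pointed_sub_def)
qed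

lemma dual_invertible:
  assumes "isomorphic (X \<odot> Y) \<I>" "isomorphic (Y \<odot> X) \<I>"
  shows "isomorphic Y (D X)"
proof -
  have X: "simple X" and Y: "simple Y" using invertible_simple assms by blast+
  obtain u v where u: "u \<in> Hom C (Y \<odot> X) \<I>" "v \<in> Hom C \<I> (Y \<odot> X)" "u \<cdot> v = ident C \<I>"
    using assms(2) unfolding isomorphic_def iso_arr_def is_inverse_def by blast
  have "u \<noteq> 0" using u zero_cmp[OF u(2)] unit_simple by (auto simp: simple_def)
  then obtain g where g: "g \<in> Hom C Y (\<I> \<odot> D X)" "g \<noteq> 0" using Hom_tensor_nonzero[OF u(1)] by blast
  have "simple (\<I> \<odot> D X)"
    using simple_isomorphic[OF simple_dual[OF X]] isomorphic_left_unit isomorphic_sym by blast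
  then show ?thesis
    using schur_isomorphic[OF Y _ g] isomorphic_left_unit isomorphic_trans by blast
qed

context
  fixes H assumes H: "subgroup H (inv_group UNIV)"
begin

interpretation P: comm_group "inv_group UNIV" by (rule comm_group_inv_group)

lemma subgroup_invertible: "iso_class X \<in> H \<Longrightarrow> invertible X"
  using subgroup.subset[OF H] iso_class_carrier by blast

lemma fusion_subcategory_pointed_sub: "fusion_subcategory (pointed_sub H)"
  unfolding fusion_subcategory_def
proof (intro conjI ballI allI impI)
  show "\<I> \<in> pointed_sub H"
    using subgroup.one_closed[OF H] unit_simple by (simp add: simple_in_pointed_sub inv_group_one)
  note decomposition_in = direct_sum_in_pointed_sub[OF decomposition(2), THEN iffD1, THEN subsetD]
  have cl: "simple Z \<and> iso_class Z \<in> H" if "X \<in> pointed_sub H" "Z \<in> set (decomposition X)" for X Z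
    using decomposition_in[OF that] decomposition(1)[OF that(2)] simple_in_pointed_sub by blast
  have swap: "V \<odot> U \<in> pointed_sub H" if "U \<odot> V \<in> pointed_sub H" for U V
    using direct_sum_in_pointed_sub[of "V \<odot> U" "[U \<odot> V]"] that
    by (simp add: direct_sum_single isomorphic_commute)
  show "X \<odot> Y \<in> pointed_sub H" if X: "X \<in> pointed_sub H" and Y: "Y \<in> pointed_sub H" for X Y
  proof -
    have "Z \<odot> W \<in> pointed_sub H" if "Z \<in> set (decomposition X)" "W \<in> set (decomposition Y)" for Z W
    proof -
      have h: "iso_class Z \<in> H" "iso_class W \<in> H" using cl X Y that by blast+
      then have "iso_class (Z \<odot> W) \<in> H" using subgroup.m_closed[OF H h] by (simp add: inv_group_mult)
      then show ?thesis
        using simple_in_pointed_sub simple_if_invertible subgroup_invertible by blast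
    qed
    then have "Z \<odot> Y \<in> pointed_sub H" if "Z \<in> set (decomposition X)" for Z
      using direct_sum_in_pointed_sub[OF direct_sum_tensor[OF decomposition(2)]] that by auto
    then have "Y \<odot> Z \<in> pointed_sub H" if "Z \<in> set (decomposition X)" for Z
      using swap that by blast
    then have "Y \<odot> X \<in> pointed_sub H"
      using direct_sum_in_pointed_sub[OF direct_sum_tensor[OF decomposition(2)]] by auto
    then show ?thesis by (rule swap)
  qed
  show "D X \<in> pointed_sub H" if X: "X \<in> pointed_sub H" for X
  proof -
    have "D Z \<in> pointed_sub H" if "Z \<in> set (decomposition X)" for Z
    proof -
      have Z: "simple Z" "iso_class Z \<in> H" using cl X that by blast+
      then obtain Y where Y: "isomorphic (Z \<odot> Y) \<I>" "isomorphic (Y \<odot> Z) \<I>"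
        using subgroup_invertible unfolding invertible_iff by blast
      have DY: "iso_class (D Z) = iso_class Y" using dual_invertible[OF Y] by (simp add: iso_class_eq isomorphic_sym)
      have "invertible Y" using Y invertible_iff by blast
      then have "inv\<^bsub>inv_group UNIV\<^esub> (iso_class Z) = iso_class Y"
        using P.inv_equality[of "iso_class Y" "iso_class Z"] Y(2) Z(2) subgroup.subset[OF H]
        by (auto simp: inv_group_mult inv_group_one iso_class_eq iso_class_carrier simp del: P.inv_equality)
      then have "iso_class (D Z) \<in> H" using subgroup.m_inv_closed[OF H Z(2)] DY by simp
      then show ?thesis using simple_in_pointed_sub[OF simple_dual[OF Z(1)]] by blast
    qed
    then show ?thesis
      using direct_sum_in_pointed_sub[OF direct_sum_dual[OF decomposition(2)]] by auto
  qed
  show "X \<in> pointed_sub H \<longleftrightarrow> set Ys \<subseteq> pointed_sub H" if "direct_sum X Ys" for X Ys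
    using direct_sum_in_pointed_sub[OF that] .
qed

lemma pointed_pointed_sub: "pointed (pointed_sub H)"
  unfolding pointed_def
proof (intro ballI impI)
  fix X assume X: "X \<in> pointed_sub H" "simple X"
  then obtain Y where Y: "isomorphic (X \<odot> Y) \<I>" "isomorphic (Y \<odot> X) \<I>"
    using simple_in_pointed_sub subgroup_invertible unfolding invertible_iff by blast
  have "D X \<in> pointed_sub H" using fusion_subcategory_pointed_sub X(1) unfolding fusion_subcategory_def by blast
  then have "Y \<in> pointed_sub H"
    using fusion_subcategory_isomorphic[OF fusion_subcategory_pointed_sub]
      isomorphic_sym[OF dual_invertible[OF Y]] by blast
  then show "invertible_in (pointed_sub H) X" using X(1) Y unfolding invertible_in_def by blast
qed

lemma modular_pointed_sub:
  assumes nondeg: "\<And>A. A \<in> H \<Longrightarrow> (\<And>B. B \<in> H \<Longrightarrow> bichar B A = 1) \<Longrightarrow> A = \<one>\<^bsub>inv_group UNIV\<^esub>"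
  shows "modular_subcategory (pointed_sub H)"
  unfolding modular_subcategory_def
proof (intro conjI fusion_subcategory_pointed_sub equalityI subsetI)
  fix X assume "X \<in> pointed_sub H \<inter> centralizer (pointed_sub H)"
  then have X: "X \<in> pointed_sub H" "\<And>Z. Z \<in> pointed_sub H \<Longrightarrow> braid X Z \<cdot> braid Z X = ident C (Z \<odot> X)"
    by (auto simp: centralizer_def)
  let ?Ys = "decomposition X"
  have "isomorphic (?Ys ! j) \<I>" if j: "j < length ?Ys" for j
  proof -
    let ?Y = "?Ys ! j"
    have Y: "?Y \<in> pointed_sub H"
      using direct_sum_in_pointed_sub[OF decomposition(2)] X(1) nth_mem[OF j] by blast
    then have YH: "iso_class ?Y \<in> H"
      using simple_in_pointed_sub[OF decomposition(1)[OF nth_mem[OF j]]] by blast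
    have "bichar B (iso_class ?Y) = 1" if B: "B \<in> H" for B
    proof -
      obtain Z where Z: "B = iso_class Z" "invertible Z"
        using B subgroup.subset[OF H] by (metis carrierE subsetD)
      then have "Z \<in> pointed_sub H" using B simple_in_pointed_sub simple_if_invertible by blast
      then have "braid ?Y Z \<cdot> braid Z ?Y = ident C (Z \<odot> ?Y)"
        using X(2) transparent_direct_sum_iff[OF decomposition(2)] j by blast
      then have "scalar_monodromy Z ?Y 1" by (simp add: scalar_monodromy_def)
      then show ?thesis using bichar_eqI Z subgroup_invertible[OF YH] by blast
    qed
    then have "iso_class ?Y = iso_class \<I>" using nondeg[OF YH] by (simp add: inv_group_one)
    then show ?thesis by (simp add: iso_class_eq)
  qed
  then have "direct_sum X (replicate (length ?Ys) \<I>)"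
    by (intro direct_sum_cong[OF decomposition(2)]) auto
  then show "X \<in> Vec" by (auto simp: Vec_def)
next
  fix X assume "X \<in> Vec"
  then obtain n where n: "direct_sum X (replicate n \<I>)" by (auto simp: Vec_def)
  have "\<I> \<in> pointed_sub H" using fusion_subcategory_pointed_sub unfolding fusion_subcategory_def by blast
  then have "X \<in> pointed_sub H" using direct_sum_in_pointed_sub[OF n] by auto
  moreover have "braid X Z \<cdot> braid Z X = ident C (Z \<odot> X)" for Z
    using transparent_direct_sum_iff[OF n, of Z] monodromy_unit by simp
  ultimately show "X \<in> pointed_sub H \<inter> centralizer (pointed_sub H)"
    by (simp add: centralizer_def)
qed

lemma Irr_pointed_sub: "Irr (pointed_sub H) = H"
proof
  show "Irr (pointed_sub H) \<subseteq> H" using simple_in_pointed_sub by (auto simp: Irr_def)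
  show "H \<subseteq> Irr (pointed_sub H)"
  proof
    fix A assume A: "A \<in> H"
    then obtain X where X: "A = iso_class X" "invertible X"
      using subgroup.subset[OF H] by (metis carrierE subsetD)
    then show "A \<in> Irr (pointed_sub H)"
      using A simple_in_pointed_sub simple_if_invertible by (auto simp: Irr_def)
  qed
qed

text \<open>Left multiplication by an invertible object permutes the basis of the Grothendieck ring, so \<open>1\<close>
  is its only non-negative real eigenvalue.\<close>

lemma FPdim_ob_pointed_sub:
  assumes A: "A \<in> H"
  shows "FPdim_ob (pointed_sub H) (rep A) = 1"
proof -
  let ?P = "inv_group UNIV" and ?A' = "inv\<^bsub>inv_group UNIV\<^esub> A"
  have fin: "finite H" using subgroup.subset[OF H] finite_inv_group finite_subset by blast
  have Hc: "B \<in> carrier ?P" if "B \<in> H" for B using that subgroup.subset[OF H] by blast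
  have inv_rep: "invertible (rep B)" "iso_class (rep B) = B" if B: "B \<in> H" for B
  proof -
    obtain X where "B = iso_class X" "invertible X" using Hc[OF B] by (rule carrierE)
    then show "invertible (rep B)" "iso_class (rep B) = B"
      using invertible_rep isomorphic_sym[OF rep_iso_class] by (auto simp: iso_class_eq)
  qed
  have A': "?A' \<in> H" using subgroup.m_inv_closed[OF H A] .
  have coeff: "fusion_coeff (rep A) B E = (if B = ?A' \<otimes>\<^bsub>?P\<^esub> E then 1 else 0)"
    if B: "B \<in> H" and E: "E \<in> H" for B E
  proof -
    have "isomorphic (rep E) (rep A \<odot> rep B) \<longleftrightarrow> E = A \<otimes>\<^bsub>?P\<^esub> B"
      using inv_group_mult[of UNIV "rep A" "rep B"] inv_rep A B E by (simp flip: iso_class_eq)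
    also have "\<dots> \<longleftrightarrow> B = ?A' \<otimes>\<^bsub>?P\<^esub> E"
      using Hc[OF A] Hc[OF B] Hc[OF E] by (auto simp: P.m_assoc[symmetric])
    finally show ?thesis
      unfolding fusion_coeff_def
      using dim_Hom_simple simple_if_invertible invertible_tensor inv_rep A B E by auto
  qed
  have bij: "bij_betw (\<lambda>E. ?A' \<otimes>\<^bsub>?P\<^esub> E) H H"
    unfolding bij_betw_def
  proof
    show inj: "inj_on (\<lambda>E. ?A' \<otimes>\<^bsub>?P\<^esub> E) H"
      using Hc A' by (auto intro!: inj_onI)
    show "(\<lambda>E. ?A' \<otimes>\<^bsub>?P\<^esub> E) ` H = H"
      by (rule endo_inj_surj[OF fin _ inj]) (use subgroup.m_closed[OF H A'] in auto)
  qed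
  have ev: "left_mult_eigenvalue (pointed_sub H) (rep A) r \<longleftrightarrow>
      (\<exists>v :: 'o set \<Rightarrow> real. (\<exists>B\<in>H. v B \<noteq> 0) \<and> (\<forall>E\<in>H. v (?A' \<otimes>\<^bsub>?P\<^esub> E) = r * v E))" for r
  proof -
    have "(\<Sum>B\<in>H. real (fusion_coeff (rep A) B E) * v B) = v (?A' \<otimes>\<^bsub>?P\<^esub> E)"
      if E: "E \<in> H" for v :: "'o set \<Rightarrow> real" and E
    proof -
      have "(\<Sum>B\<in>H. real (fusion_coeff (rep A) B E) * v B)
          = (\<Sum>B\<in>H. if B = ?A' \<otimes>\<^bsub>?P\<^esub> E then v B else 0)"
        by (intro sum.cong refl) (simp add: coeff[OF _ E])
      then show ?thesis using fin subgroup.m_closed[OF H A' E] by simp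
    qed
    then show ?thesis unfolding left_mult_eigenvalue_def Irr_pointed_sub by auto
  qed
  have "{r. 0 \<le> r \<and> left_mult_eigenvalue (pointed_sub H) (rep A) r} = {1}"
  proof (intro equalityI subsetI)
    fix r assume "r \<in> {r. 0 \<le> r \<and> left_mult_eigenvalue (pointed_sub H) (rep A) r}"
    then obtain v :: "'o set \<Rightarrow> real" where r: "0 \<le> r" and v: "\<exists>B\<in>H. v B \<noteq> 0"
      "\<And>E. E \<in> H \<Longrightarrow> v (?A' \<otimes>\<^bsub>?P\<^esub> E) = r * v E" unfolding ev by blast
    have "(\<Sum>E\<in>H. \<bar>v E\<bar>) = (\<Sum>E\<in>H. \<bar>v (?A' \<otimes>\<^bsub>?P\<^esub> E)\<bar>)"
      using sum.reindex_bij_betw[OF bij, of "\<lambda>E. \<bar>v E\<bar>"] by simp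
    also have "\<dots> = r * (\<Sum>E\<in>H. \<bar>v E\<bar>)"
      using r v(2) by (simp add: abs_mult sum_distrib_left)
    finally have "(\<Sum>E\<in>H. \<bar>v E\<bar>) = r * (\<Sum>E\<in>H. \<bar>v E\<bar>)" .
    moreover have "(\<Sum>E\<in>H. \<bar>v E\<bar>) \<noteq> 0"
      using v(1) fin by (simp add: sum_nonneg_eq_0_iff)
    ultimately show "r \<in> {1}" by simp
  next
    fix r :: real assume "r \<in> {1}"
    then show "r \<in> {r. 0 \<le> r \<and> left_mult_eigenvalue (pointed_sub H) (rep A) r}"
      unfolding mem_Collect_eq ev using A by (auto intro!: exI[of _ "\<lambda>_. 1"])
  qed
  then show ?thesis by (simp add: FPdim_ob_def)
qed

lemma FPdim_pointed_sub: "FPdim (pointed_sub H) = real (card H)"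
  by (simp add: FPdim_def Irr_pointed_sub FPdim_ob_pointed_sub)

end

end

context modular_tensor_category
begin

lemma bichar_radical:
  assumes "A \<in> carrier (inv_group UNIV)" "\<And>B. B \<in> carrier (inv_group UNIV) \<Longrightarrow> bichar B A = 1"
  shows "A \<in> carrier (inv_group adjoint_subcategory)"
proof -
  obtain g where g: "A = iso_class g" "invertible g" using assms(1) by (rule carrierE)
  have "braid g h \<cdot> braid h g = ident C (h \<odot> g)" if "invertible h" for h
    using scalar_monodromy_bichar[OF that g(2)] assms(2)[of "iso_class h"] that g(1)
    by (simp add: iso_class_carrier scalar_monodromy_def)
  then have ad: "g \<in> adjoint_subcategory"
    using transparent_to_invertibles_in_adjoint simple_if_invertible g(2) by blast
  obtain Y where Y: "isomorphic (g \<odot> Y) \<I>" "isomorphic (Y \<odot> g) \<I>" using g(2) invertible_iff by blast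
  have "Y \<in> adjoint_subcategory"
    using ad fusion_subcategory_adjoint fusion_subcategory_isomorphic isomorphic_sym[OF dual_invertible[OF Y]]
    unfolding fusion_subcategory_def by blast
  then have "invertible_in adjoint_subcategory g" using ad Y unfolding invertible_in_def by blast
  then show ?thesis using g(1) by (auto simp: inv_group_def)
qed

lemma pointed_modular_subcategory_exists:
  assumes G: "subgroup G (inv_group UNIV)"
    and ad: "carrier (inv_group adjoint_subcategory) \<subseteq> G"
    and cop: "coprime (card G) (card (carrier (inv_group UNIV)) div card G)"
  shows "\<exists>K. pointed K \<and> modular_subcategory K \<and>
    FPdim K = real (card (rcosets\<^bsub>inv_group UNIV\<^esub> G))"
proof -
  let ?P = "inv_group UNIV"
  interpret P: comm_group ?P by (rule comm_group_inv_group)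
  define m where "m = card (carrier ?P) div card G"
  define H where "H = {x \<in> carrier ?P. x [^]\<^bsub>?P\<^esub> m = \<one>\<^bsub>?P\<^esub>}"
  note compl = P.torsion_complement_Int P.torsion_complement_generates P.card_torsion_complement
  note compl' = compl[OF finite_inv_group G m_def cop[folded m_def], folded H_def]
  have H: "subgroup H ?P" unfolding H_def by (rule P.torsion_subgroup)
  have Gc: "G \<subseteq> carrier ?P" "finite G"
    using subgroup.subset[OF G] finite_inv_group finite_subset by blast+
  have "A = \<one>\<^bsub>?P\<^esub>" if A: "A \<in> H" and triv: "\<And>B. B \<in> H \<Longrightarrow> bichar B A = 1" for A
  proof -
    have Ac: "A \<in> carrier ?P" "A [^]\<^bsub>?P\<^esub> m = \<one>\<^bsub>?P\<^esub>" using A by (auto simp: H_def)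
    have "bichar B A = 1" if B: "B \<in> carrier ?P" for B
    proof -
      obtain k h where kh: "k \<in> G" "h \<in> H" "B = k \<otimes>\<^bsub>?P\<^esub> h" using compl'(2)[OF B] by blast
      have c: "k \<in> carrier ?P" "h \<in> carrier ?P" using kh Gc by (auto simp: H_def)
      have "bichar A k = 1"
      proof (rule power_coprime_eq_1)
        show "bichar A k ^ card G = 1"
          using bichar_pow[OF Ac(1) c(1), of "card G"] P.pow_card_subgroup[OF G Gc(2) kh(1)] bichar_one[OF Ac(1)]
          by simp
        show "bichar A k ^ m = 1"
          using bichar_pow[OF c(1) Ac(1), of m] Ac(2) bichar_one[OF c(1)] bichar_sym[OF Ac(1) c(1)] by simp
        show "coprime (card G) m" using cop by (simp add: m_def)
      qed
      moreover have "bichar A h = 1" using triv[OF kh(2)] bichar_sym[OF Ac(1) c(2)] by simp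
      ultimately show ?thesis
        using bichar_mult[OF Ac(1) c] kh(3) bichar_sym[OF B Ac(1)] by simp
    qed
    then have "A \<in> G" using bichar_radical[OF Ac(1)] ad by blast
    then show ?thesis using A compl'(1) by blast
  qed
  then have "modular_subcategory (pointed_sub H)" by (rule modular_pointed_sub[OF H])
  moreover have "FPdim (pointed_sub H) = real (card (rcosets\<^bsub>?P\<^esub> G))"
    using FPdim_pointed_sub[OF H] compl'(3) by simp
  ultimately show ?thesis using pointed_pointed_sub[OF H] by blast
qed

end

theorem theorem3p13:
  fixes C :: "('o, 'm::ab_group_add, 'k::{alg_closed_field, field_char_0}, 'z) rigid_cat_scheme"
    and piv :: "'o \<Rightarrow> 'm" and braid :: "'o \<Rightarrow> 'o \<Rightarrow> 'm" and G :: "'o set set"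
  assumes "modular_tensor_category C piv braid"
    and "subgroup G (fusion_category.inv_group C UNIV)"
    and "carrier (fusion_category.inv_group C (fusion_category.adjoint_subcategory C)) \<subseteq> G"
    and "coprime (card G) (card (carrier (fusion_category.inv_group C UNIV)) div card G)"
  shows "\<exists>K. fusion_category.pointed C K \<and>
             braided_fusion_category.modular_subcategory C braid K \<and>
             fusion_category.FPdim C K
               = real (card (rcosets\<^bsub>fusion_category.inv_group C UNIV\<^esub> G))"
proof -
  interpret modular_tensor_category C piv braid by (rule assms(1))
  show ?thesis by (rule pointed_modular_subcategory_exists[OF assms(2-4)])
qed

end
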